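(* Let $b(t)=\sum_{n=-r}^{s} b_n t^n$ be a Laurent polynomial with $r,s$ positive integers and $b_{-r}\neq 0$, $b_s\neq 0$. Let $0<\rho_l\le\rho_h<\infty$ be such that $\Lambda(b)=\bigcap_{\rho\in[\rho_l,\rho_h]}\operatorname{sp} T(b_\rho)$. Then $$\lim_{\Delta_\rho,\Delta_v\to 0}\Biggl[\ \sup_{\boldsymbol{\rho}\in\mathcal{P}(\Delta_\rho),\ \boldsymbol{v}\in\mathcal{P}(\Delta_v)} d_H\Biggl(\bigcap_{j=0}^{n}\operatorname{sp} T(b_{\rho_j}^D),\ \Lambda(b)\Biggr)\Biggr]=0,$$ where $\boldsymbol{\rho}=(\rho_j)_{j=0}^{n}$, $\mathcal{P}(\Delta_\rho)=\mathcal{P}_{[\rho_l,\rho_h]}(\Delta_\rho)$, $\boldsymbol{v}=(v_j)_{j=0}^{m}$, $\mathcal{P}(\Delta_v)=\mathcal{P}_{[0,2\pi]}(\Delta_v)$, and $b_{\rho_j}^D$ is the polygon discretization of $b_{\rho_j}$ with respect to $\boldsymbol{v}$.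
   Context: $\mathbb{T}$ is the unit circle in $\mathbb{C}$. For a continuous function (symbol) $a:\mathbb{T}\to\mathbb{C}$ with Fourier coefficients $(a_k)_{k\in\mathbb{Z}}$, $T(a)=(a_{j-k})_{j,k=0}^{\infty}$ is the Toeplitz operator on $\ell^2(\mathbb{N})$, a bounded operator, and $\operatorname{sp} T(a)$ is its spectrum. It is known (Gohberg) that $\operatorname{sp} T(a)=a(\mathbb{T})\cup\{\lambda\in\mathbb{C}\setminus a(\mathbb{T}):\operatorname{wind}(a-\lambda)\ne 0\}$, where $\operatorname{wind}(a-\lambda)$ is the winding number of the closed curve $v\mapsto a(e^{iv})$, $v\in[0,2\pi]$, around $\lambda$. For $\rho>0$, $b_\rho(t):=b(\rho t)$, $t\in\mathbb{T}$. The limit set: for $\lambda\in\mathbb{C}$ let $z_1(\lambda),\dots,z_{r+s}(\lambda)$ be the zeros, with multiplicity, of $z\mapsto z^r(b(z)-\lambda)$, ordered so that $|z_j(\lambda)|\le|z_{j+1}(\lambda)|$. Then $\Lambda(b):=\{\lambda\in\mathbb{C}: |z_r(\lambda)|=|z_{r+1}(\lambda)|\}$. It is a known theorem of Schmidt and Spitzer that $\Lambda(b)=\bigcap_{\rho\in(0,\infty)}\operatorname{sp} T(b_\rho)$. A partition of $[\alpha,\beta]$ is a finite sequence $\alpha=x_0<x_1<\dots<x_n=\beta$ (with $n$ arbitrary); its granularity is $\max_{0\le j\le n-1}(x_{j+1}-x_j)$. (If $\alpha=\beta$ the only partition is the single point $x_0=\alpha$, with granularity $0$.) $\mathcal{P}_{[\alpha,\beta]}(\Delta)$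 is the set of all partitions of $[\alpha,\beta]$ with granularity $\le\Delta$. Polygon discretization: given a partition $0=v_0<v_1<\dots<v_m=2\pi$ of $[0,2\pi]$ and $\rho>0$, $b_\rho^D:\mathbb{T}\to\mathbb{C}$ is the continuous symbol $$b_\rho^D(e^{iv}):=\frac{v-v_j}{v_{j+1}-v_j}\bigl(b_\rho(e^{iv_{j+1}})-b_\rho(e^{iv_j})\bigr)+b_\rho(e^{iv_j}),\qquad v\in[v_j,v_{j+1}).$$ $d_H$ is the Hausdorff metric on the set $\mathcal{C}$ of non-empty closed bounded subsets of $\mathbb{C}$: $d_H(A,B):=\inf\{\epsilon: A\subset(B)_\epsilon,\ B\subset(A)_\epsilon\}$, where $(X)_\epsilon:=\bigcup_{x\in X}\{z\in\mathbb{C}:|z-x|\le\epsilon\}$. *)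

theory Defs
  imports "HOL-Complex_Analysis.Complex_Analysis"
begin

definition ell2 :: "(nat \<Rightarrow> complex) set" where
  "ell2 = {x. summable (\<lambda>n. (cmod (x n))\<^sup>2)}"

definition ell2_norm :: "(nat \<Rightarrow> complex) \<Rightarrow> real" where
  "ell2_norm x = sqrt (\<Sum>n. (cmod (x n))\<^sup>2)"

text \<open>Operators are functions on all sequences; only their values on \<^const>\<open>ell2\<close> matter.\<close>

definition bounded_ell2_operator :: "((nat \<Rightarrow> complex) \<Rightarrow> (nat \<Rightarrow> complex)) \<Rightarrow> bool" where
  "bounded_ell2_operator A \<longleftrightarrow>
     (\<forall>x\<in>ell2. A x \<in> ell2) \<and>
     (\<forall>x\<in>ell2. \<forall>y\<in>ell2. A (\<lambda>n. x n + y n) = (\<lambda>n. A x n + A y n)) \<and>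
     (\<forall>c. \<forall>x\<in>ell2. A (\<lambda>n. c * x n) = (\<lambda>n. c * A x n)) \<and>
     (\<exists>C. \<forall>x\<in>ell2. ell2_norm (A x) \<le> C * ell2_norm x)"

text \<open>The spectrum of \<open>A\<close>, for a bounded operator \<open>A\<close>: those \<open>\<lambda>\<close> for which
  \<open>A - \<lambda> I\<close> has no two-sided inverse among the bounded operators.\<close>

definition ell2_spectrum :: "((nat \<Rightarrow> complex) \<Rightarrow> (nat \<Rightarrow> complex)) \<Rightarrow> complex set" where
  "ell2_spectrum A = {l. \<not> (\<exists>S. bounded_ell2_operator S \<and>
     (\<forall>x\<in>ell2. S (\<lambda>n. A x n - l * x n) = x) \<and>
     (\<forall>x\<in>ell2. (\<lambda>n. A (S x) n - l * S x n) = x))}"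

text \<open>Symbols are functions on the complex plane of which only the values on the unit circle matter.\<close>

definition fourier_coeff :: "(complex \<Rightarrow> complex) \<Rightarrow> int \<Rightarrow> complex" where
  "fourier_coeff a k =
     integral {0..2*pi} (\<lambda>v. a (cis v) * cis (- (of_int k * v))) / of_real (2*pi)"

definition toeplitz :: "(complex \<Rightarrow> complex) \<Rightarrow> (nat \<Rightarrow> complex) \<Rightarrow> (nat \<Rightarrow> complex)" where
  "toeplitz a x = (\<lambda>j. \<Sum>k. fourier_coeff a (int j - int k) * x k)"

definition laurent_poly :: "(int \<Rightarrow> complex) \<Rightarrow> nat \<Rightarrow> nat \<Rightarrow> complex \<Rightarrow> complex" where
  "laurent_poly b r s t = (\<Sum>n\<in>{- int r..int s}. b n * t powi n)"

definition dilate :: "real \<Rightarrow> (complex \<Rightarrow> complex) \<Rightarrow> complex \<Rightarrow> complex" where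
  "dilate \<rho> a t = a (of_real \<rho> * t)"

text \<open>The polynomial \<open>z\<^sup>r (b(z) - \<lambda>)\<close>; see \<open>poly_eigenvalue_poly\<close> below.\<close>

definition eigenvalue_poly :: "(int \<Rightarrow> complex) \<Rightarrow> nat \<Rightarrow> nat \<Rightarrow> complex \<Rightarrow> complex poly" where
  "eigenvalue_poly b r s l = (\<Sum>k\<le>r + s. monom (b (int k - int r)) k) - monom l r"

lemma poly_eigenvalue_poly:
  assumes "z \<noteq> 0"
  shows "poly (eigenvalue_poly b r s l) z = z ^ r * (laurent_poly b r s z - l)"
proof -
  have "(\<Sum>n\<in>{- int r..int s}. b n * z powi n)
      = (\<Sum>k\<le>r + s. b (int k - int r) * z powi (int k - int r))"
    by (rule sum.reindex_bij_witness[of _ "\<lambda>k. int k - int r" "\<lambda>n. nat (n + int r)"]) auto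
  then have "z ^ r * laurent_poly b r s z
      = (\<Sum>k\<le>r + s. z ^ r * (b (int k - int r) * z powi (int k - int r)))"
    by (simp only: laurent_poly_def sum_distrib_left)
  also have "\<dots> = (\<Sum>k\<le>r + s. b (int k - int r) * z ^ k)"
    using assms by (intro sum.cong) (simp_all add: power_int_diff)
  finally show ?thesis
    by (simp add: eigenvalue_poly_def poly_sum poly_monom right_diff_distrib)
qed

text \<open>The list \<open>zs\<close> enumerates the zeros with multiplicity by increasing modulus. It is
  indexed from \<open>0\<close>, so the \<open>r\<close>-th and \<open>(r+1)\<close>-st zeros are \<open>zs ! (r - 1)\<close> and \<open>zs ! r\<close>.
  The moduli do not depend on the choice of \<open>zs\<close>.\<close>

definition limit_set :: "(int \<Rightarrow> complex) \<Rightarrow> nat \<Rightarrow> nat \<Rightarrow> complex set" where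
  "limit_set b r s = {l. \<exists>zs. mset zs = proots (eigenvalue_poly b r s l) \<and>
     sorted (map cmod zs) \<and> cmod (zs ! (r - 1)) = cmod (zs ! r)}"

text \<open>The \<open>0\<close> matters only for one-point partitions.\<close>

definition granularity :: "real list \<Rightarrow> real" where
  "granularity xs = Max (insert 0 {xs ! Suc j - xs ! j | j. Suc j < length xs})"

definition partitions :: "real \<Rightarrow> real \<Rightarrow> real \<Rightarrow> real list set" where
  "partitions \<alpha> \<beta> \<Delta> = {xs. xs \<noteq> [] \<and> hd xs = \<alpha> \<and> last xs = \<beta> \<and>
     sorted_wrt (<) xs \<and> granularity xs \<le> \<Delta>}"

text \<open>Here \<open>vs\<close> is a partition of \<open>[0, 2\<pi>]\<close>, and \<open>Arg2pi t\<close> is the \<open>v \<in> [0, 2\<pi>)\<close>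
  with \<open>t = e\<^sup>i\<^sup>v\<close>.\<close>

definition polygon :: "real list \<Rightarrow> (complex \<Rightarrow> complex) \<Rightarrow> complex \<Rightarrow> complex" where
  "polygon vs a t =
     (let v = Arg2pi t;
          j = (THE j. Suc j < length vs \<and> vs ! j \<le> v \<and> v < vs ! Suc j)
      in of_real ((v - vs ! j) / (vs ! Suc j - vs ! j)) * (a (cis (vs ! Suc j)) - a (cis (vs ! j)))
         + a (cis (vs ! j)))"

definition nbhd :: "complex set \<Rightarrow> real \<Rightarrow> complex set" where
  "nbhd X \<epsilon> = (\<Union>x\<in>X. cball x \<epsilon>)"

text \<open>The infimum is taken in \<^typ>\<open>ennreal\<close>. On non-empty bounded sets it is the usual
  real infimum; if exactly one set is empty, the distance is infinite rather than
  an arbitrary default value.\<close>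

definition hausdorff_dist :: "complex set \<Rightarrow> complex set \<Rightarrow> ennreal" where
  "hausdorff_dist A B = Inf {ennreal \<epsilon> | \<epsilon>. A \<subseteq> nbhd B \<epsilon> \<and> B \<subseteq> nbhd A \<epsilon>}"

end

theory Submission
  imports Defs "HOL-Computational_Algebra.Fundamental_Theorem_Algebra"
begin

text \<open>
  For a partition of \<open>[0, 2\<pi>]\<close> of granularity \<open>\<Delta>\<close>, let \<open>E(w)\<close> be the error that polygon
  interpolation on the circle through \<open>w\<close> commits at \<open>w\<close>. The polygon symbol of radius \<open>\<rho>\<close> is
  then \<open>t \<mapsto> b(\<rho>t) + E(\<rho>t)\<close>, and on every annulus both the size and the Lipschitz constant of
  \<open>E\<close> are \<open>O(\<Delta>)\<close> (\<open>polygon_error_bound\<close>). Only two facts about Toeplitz operators enter,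
  neither of which mentions winding numbers. Invertibility survives uniformly small changes of
  the symbol (\<open>toeplitz_invertible_perturb\<close>). If \<open>T(a)\<close> is invertible and \<open>a\<close> differs from
  \<open>q(t)/t\<^sup>m\<close> by at most half of the modulus of the latter, then \<open>q\<close> has exactly \<open>m\<close> zeros in
  the open unit disc and none on the circle (\<open>toeplitz_invertible_count\<close>).

  The intersection of the polygon spectra lies near \<open>\<Lambda>(b)\<close>: by hypothesis a point \<open>\<mu>\<close> outside
  \<open>\<Lambda>(b)\<close> is missed by the spectrum of \<open>T(b\<^sub>\<rho>)\<close> for some \<open>\<rho>\<close>, stability gives the same for all
  nearby points and radii and all fine polygons, and compactness makes the neighbourhoods
  uniform (\<open>polygon_spectra_near_limit_set\<close>).

  Conversely, every point of \<open>\<Lambda>(b)\<close> lies near the intersection of the polygon spectra over any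
  set of radii in \<open>[\<rho>\<^sub>l, \<rho>\<^sub>h]\<close> (\<open>limit_set_approximated\<close>). Let \<open>l \<in> \<Lambda>(b)\<close> be such that
  \<open>z\<^sup>r (b(z) - l)\<close> has simple zeros only. These extend to holomorphic branches \<open>g\<^sub>i(\<mu>)\<close> on a
  disc around \<open>l\<close>, and for small \<open>\<Delta>\<close> the equation \<open>b(w) + E(w) = \<mu>\<close> has solutions \<open>w\<^sub>i(\<mu>)\<close>
  near \<open>g\<^sub>i(\<mu>)\<close>. Suppose that every \<open>\<mu>\<close> in the disc is missed by some polygon spectrum. By the
  counting theorem some circle then has exactly \<open>r\<close> of the points \<open>w\<^sub>i(\<mu>)\<close> inside and none on
  it. The set of their indices is locally constant in \<open>\<mu>\<close>, hence constant on the disc. If this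
  happens for arbitrarily small \<open>\<Delta>\<close>, there is a set \<open>I\<close> of \<open>r\<close> indices with \<open>\<bar>g\<^sub>i\<bar> \<le> \<bar>g\<^sub>k\<bar>\<close> on
  the whole disc for \<open>i \<in> I\<close> and \<open>k \<notin> I\<close> (\<open>branches_separate\<close>). Since \<open>l \<in> \<Lambda>(b)\<close>, equality
  holds at \<open>l\<close> for some pair, so the maximum principle makes \<open>g\<^sub>i / g\<^sub>k\<close> a constant \<open>\<omega>\<close>, and
  \<open>b(\<omega>z) = b(z)\<close>. These symmetries \<open>\<omega>\<close> form a finite group that acts freely on the zeros at
  \<open>l\<close>. The zeros of the critical modulus are a single orbit. The order of the group divides
  \<open>r\<close> and the number of zeros of smaller modulus, and therefore the number of elements of the
  orbit with index in \<open>I\<close>; but that number lies strictly between \<open>0\<close> and the order of the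
  group (\<open>dominated_branches_not_limit\<close>).

  Multiple zeros occur for finitely many \<open>l\<close> only, and these can be avoided because \<open>\<Lambda>(b)\<close> has
  no isolated points (\<open>limit_set_not_isolated\<close>).
\<close>

section \<open>Square-summable sequences and perturbation of inverses\<close>

lemma L2_set_le_ell2_norm:
  assumes "x \<in> ell2"
  shows "L2_set (\<lambda>k. cmod (x k)) {..<n} \<le> ell2_norm x"
  using assms unfolding ell2_def ell2_norm_def L2_set_def
  by (intro real_sqrt_le_mono sum_le_suminf) auto

lemma ell2_normI:
  assumes "\<And>n. L2_set (\<lambda>k. cmod (x k)) {..<n} \<le> C"
  shows "x \<in> ell2" "ell2_norm x \<le> C"
proof -
  have C: "0 \<le> C" using assms[of 0] by simp
  have le: "(\<Sum>k<n. (cmod (x k))\<^sup>2) \<le> C\<^sup>2" for n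
    using assms[of n] unfolding L2_set_def by (simp add: real_sqrt_le_iff C sqrt_le_D)
  have s: "summable (\<lambda>k. (cmod (x k))\<^sup>2)"
    by (rule summableI_nonneg_bounded[OF _ le]) auto
  then show "x \<in> ell2" by (simp add: ell2_def)
  have "(\<Sum>k. (cmod (x k))\<^sup>2) \<le> C\<^sup>2" by (rule suminf_le_const[OF s le])
  then show "ell2_norm x \<le> C" unfolding ell2_norm_def
    by (simp add: C real_le_lsqrt)
qed

lemma ell2_norm_nonneg [simp]: "x \<in> ell2 \<Longrightarrow> 0 \<le> ell2_norm x"
  using L2_set_le_ell2_norm[of x 0] by simp

lemma ell2_add:
  assumes "x \<in> ell2" "y \<in> ell2"
  shows "(\<lambda>n. x n + y n) \<in> ell2" "ell2_norm (\<lambda>n. x n + y n) \<le> ell2_norm x + ell2_norm y"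
proof -
  have "L2_set (\<lambda>k. cmod (x k + y k)) {..<n} \<le> ell2_norm x + ell2_norm y" for n
  proof -
    have "L2_set (\<lambda>k. cmod (x k + y k)) {..<n} \<le> L2_set (\<lambda>k. cmod (x k) + cmod (y k)) {..<n}"
      by (intro L2_set_mono norm_triangle_ineq) auto
    also have "\<dots> \<le> L2_set (\<lambda>k. cmod (x k)) {..<n} + L2_set (\<lambda>k. cmod (y k)) {..<n}"
      by (rule L2_set_triangle_ineq)
    finally show ?thesis
      using L2_set_le_ell2_norm[OF assms(1), of n] L2_set_le_ell2_norm[OF assms(2), of n] by simp
  qed
  from ell2_normI[OF this] show "(\<lambda>n. x n + y n) \<in> ell2"
    "ell2_norm (\<lambda>n. x n + y n) \<le> ell2_norm x + ell2_norm y" by blast+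
qed

lemma ell2_scale:
  assumes "x \<in> ell2"
  shows "(\<lambda>n. c * x n) \<in> ell2" "ell2_norm (\<lambda>n. c * x n) \<le> cmod c * ell2_norm x"
proof -
  have "L2_set (\<lambda>k. cmod (c * x k)) {..<n} \<le> cmod c * ell2_norm x" for n
    using L2_set_le_ell2_norm[OF assms, of n]
    by (simp add: norm_mult L2_set_right_distrib[symmetric] mult_left_mono)
  from ell2_normI[OF this] show "(\<lambda>n. c * x n) \<in> ell2"
    "ell2_norm (\<lambda>n. c * x n) \<le> cmod c * ell2_norm x" by blast+
qed

lemma ell2_diff:
  assumes "x \<in> ell2" "y \<in> ell2"
  shows "(\<lambda>n. x n - y n) \<in> ell2" "ell2_norm (\<lambda>n. x n - y n) \<le> ell2_norm x + ell2_norm y"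
  using ell2_add[OF assms(1) ell2_scale(1)[OF assms(2), of "-1"]] ell2_scale(2)[OF assms(2), of "-1"]
  by auto

lemma ell2_zero [simp]: "(\<lambda>_. 0) \<in> ell2" "ell2_norm (\<lambda>_. 0) = 0"
  by (auto simp: ell2_def ell2_norm_def)

lemma ell2_coeff_le:
  assumes "x \<in> ell2"
  shows "cmod (x k) \<le> ell2_norm x"
proof -
  have "cmod (x k) \<le> L2_set (\<lambda>k. cmod (x k)) {..<Suc k}"
    by (rule member_le_L2_set[where f = "\<lambda>k. cmod (x k)"]) auto
  then show ?thesis using L2_set_le_ell2_norm[OF assms, of "Suc k"] by linarith
qed

lemma ell2_norm_eq_0: "x \<in> ell2 \<Longrightarrow> ell2_norm x \<le> 0 \<Longrightarrow> x = (\<lambda>_. 0)"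
proof
  fix k assume "x \<in> ell2" "ell2_norm x \<le> 0"
  then have "cmod (x k) \<le> 0" using ell2_coeff_le[of x k] by linarith
  then show "x k = 0" by simp
qed

text \<open>Completeness of \<open>l\<^sup>2\<close> in the form that a contraction needs. The limit is taken entry by
  entry, and the norm bound passes to it through the finite sections.\<close>

lemma ell2_complete_geometric:
  assumes mem: "\<And>n. x n \<in> ell2" and c: "0 \<le> c" "c < 1"
    and step: "\<And>n. ell2_norm (\<lambda>k. x (Suc n) k - x n k) \<le> C * c ^ n"
  obtains X where "X \<in> ell2" "\<And>n. ell2_norm (\<lambda>k. X k - x n k) \<le> C * c ^ n / (1 - c)"
proof -
  have diff: "(\<lambda>k. x p k - x n k) \<in> ell2" for p n by (intro ell2_diff mem)
  have C: "0 \<le> C" using order_trans[OF ell2_norm_nonneg[OF diff[of "Suc 0" 0]] step[of 0]] by simp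
  have upto: "ell2_norm (\<lambda>k. x (n + p) k - x n k) \<le> (\<Sum>i<p. C * c ^ (n + i))" for n p
  proof (induction p)
    case (Suc p)
    have "(\<lambda>k. x (n + Suc p) k - x n k) = (\<lambda>k. (x (Suc (n + p)) k - x (n + p) k) + (x (n + p) k - x n k))"
      by auto
    then have "ell2_norm (\<lambda>k. x (n + Suc p) k - x n k)
        \<le> ell2_norm (\<lambda>k. x (Suc (n + p)) k - x (n + p) k) + ell2_norm (\<lambda>k. x (n + p) k - x n k)"
      using ell2_add(2)[OF diff diff] by metis
    then show ?case using Suc step[of "n + p"] by simp
  qed simp
  have geo: "(\<Sum>i<p. C * c ^ (n + i)) \<le> C * c ^ n / (1 - c)" for n p
  proof -
    have "(\<Sum>i<p. c ^ i) \<le> 1 / (1 - c)"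
      using c sum_le_suminf[of "\<lambda>i. c ^ i" "{..<p}"] suminf_geometric[of c] by (auto simp: summable_geometric)
    then have "C * c ^ n * (\<Sum>i<p. c ^ i) \<le> C * c ^ n * (1 / (1 - c))"
      using C c by (intro mult_left_mono) auto
    then show ?thesis by (simp add: sum_distrib_left power_add mult.assoc)
  qed
  have bnd: "ell2_norm (\<lambda>k. x (n + p) k - x n k) \<le> C * c ^ n / (1 - c)" for n p
    using upto geo order_trans by blast
  have conv: "convergent (\<lambda>n. x n k)" for k
  proof -
    have "summable (\<lambda>n. C * c ^ n)" using c by (intro summable_mult summable_geometric) auto
    moreover have "norm (x (Suc n) k - x n k) \<le> C * c ^ n" for n
      using ell2_coeff_le[OF diff[of "Suc n" n], of k] step[of n] by simp
    ultimately have "summable (\<lambda>n. x (Suc n) k - x n k)"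
      by (rule summable_comparison_test'[where N = 0])
    then have "convergent (\<lambda>n. (x n k - x 0 k) + x 0 k)"
      by (intro convergent_add convergent_const) (simp add: summable_iff_convergent sum_lessThan_telescope[of "\<lambda>n. x n k"])
    then show ?thesis by simp
  qed
  define X where "X k = lim (\<lambda>n. x n k)" for k
  have lim: "(\<lambda>n. x n k) \<longlonglongrightarrow> X k" for k
    using conv[of k] by (simp add: X_def convergent_LIMSEQ_iff)
  have "L2_set (\<lambda>k. cmod (X k - x n k)) {..<m} \<le> C * c ^ n / (1 - c)" for m n
  proof (rule LIMSEQ_le_const2)
    have lim': "(\<lambda>p. x (n + p) k) \<longlonglongrightarrow> X k" for k
      using LIMSEQ_ignore_initial_segment[OF lim[of k], of n] by (simp add: add.commute)
    show "(\<lambda>p. L2_set (\<lambda>k. cmod (x (n + p) k - x n k)) {..<m}) \<longlonglongrightarrow> L2_set (\<lambda>k. cmod (X k - x n k)) {..<m}"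
      unfolding L2_set_def
      by (intro tendsto_intros lim')
    show "\<exists>N. \<forall>p\<ge>N. L2_set (\<lambda>k. cmod (x (n + p) k - x n k)) {..<m} \<le> C * c ^ n / (1 - c)"
      using L2_set_le_ell2_norm[OF diff] bnd order_trans by blast
  qed
  from ell2_normI[OF this] have X: "(\<lambda>k. X k - x n k) \<in> ell2"
    "ell2_norm (\<lambda>k. X k - x n k) \<le> C * c ^ n / (1 - c)" for n by blast+
  have "X \<in> ell2" using ell2_add(1)[OF X(1)[of 0] mem[of 0]] by simp
  with X(2) that show ?thesis by blast
qed

definition ell2_linear :: "((nat \<Rightarrow> complex) \<Rightarrow> nat \<Rightarrow> complex) \<Rightarrow> bool" where
  "ell2_linear A \<longleftrightarrow> (\<forall>x\<in>ell2. A x \<in> ell2) \<and>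
     (\<forall>x\<in>ell2. \<forall>y\<in>ell2. A (\<lambda>n. x n + y n) = (\<lambda>n. A x n + A y n)) \<and>
     (\<forall>c. \<forall>x\<in>ell2. A (\<lambda>n. c * x n) = (\<lambda>n. c * A x n))"

lemma ell2_linearD:
  assumes "ell2_linear A" "x \<in> ell2" "y \<in> ell2"
  shows "A x \<in> ell2" "A (\<lambda>n. x n + y n) = (\<lambda>n. A x n + A y n)"
    "A (\<lambda>n. c * x n) = (\<lambda>n. c * A x n)" "A (\<lambda>n. x n - y n) = (\<lambda>n. A x n - A y n)"
proof -
  show "A x \<in> ell2" "A (\<lambda>n. x n + y n) = (\<lambda>n. A x n + A y n)" "A (\<lambda>n. c * x n) = (\<lambda>n. c * A x n)"
    using assms by (auto simp: ell2_linear_def)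
  have "A (\<lambda>n. x n + (-1) * y n) = (\<lambda>n. A x n + A (\<lambda>n. (-1) * y n) n)"
    using bspec[OF bspec[OF conjunct1[OF conjunct2[OF assms(1)[unfolded ell2_linear_def]]] assms(2)] ell2_scale(1)[OF assms(3), of "-1"]]
    by simp
  moreover have "A (\<lambda>n. (-1) * y n) = (\<lambda>n. (-1) * A y n)" using assms unfolding ell2_linear_def by blast
  ultimately show "A (\<lambda>n. x n - y n) = (\<lambda>n. A x n - A y n)" by simp
qed

definition ell2_inverse where
  "ell2_inverse A S \<longleftrightarrow> bounded_ell2_operator S \<and> (\<forall>x\<in>ell2. S (A x) = x) \<and> (\<forall>x\<in>ell2. A (S x) = x)"

lemma bounded_ell2_operator_linear: "bounded_ell2_operator S \<Longrightarrow> ell2_linear S"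
  by (auto simp: bounded_ell2_operator_def ell2_linear_def)

text \<open>The equation \<open>B x = y\<close> says that \<open>x = S (y - (B - A) x)\<close>, and the right-hand side is a
  contraction with factor \<open>C * \<epsilon>\<close>. The same estimate gives \<open>\<parallel>x\<parallel> \<le> C / (1 - C * \<epsilon>) * \<parallel>B x\<parallel>\<close>,
  hence injectivity of \<open>B\<close> and boundedness of the inverse.\<close>

lemma ell2_inverse_perturb:
  assumes inv: "ell2_inverse A S" and A: "ell2_linear A" and B: "ell2_linear B"
    and C: "\<And>x. x \<in> ell2 \<Longrightarrow> ell2_norm (S x) \<le> C * ell2_norm x" "0 \<le> C"
    and \<epsilon>: "\<And>x. x \<in> ell2 \<Longrightarrow> ell2_norm (\<lambda>n. B x n - A x n) \<le> \<epsilon> * ell2_norm x" "0 \<le> \<epsilon>" "C * \<epsilon> < 1"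
  shows "\<exists>S'. ell2_inverse B S'"
proof -
  define c where "c = C * \<epsilon>"
  have c: "0 \<le> c" "c < 1" using C \<epsilon> by (auto simp: c_def)
  have S: "ell2_linear S" using inv by (auto simp: ell2_inverse_def intro: bounded_ell2_operator_linear)
  have SA: "S (A x) = x" and AS: "A (S x) = x" if "x \<in> ell2" for x
    using inv that by (auto simp: ell2_inverse_def)
  note lin = ell2_linearD[OF A] ell2_linearD[OF B] ell2_linearD[OF S]
  have SBA: "ell2_norm (S (\<lambda>n. B x n - A x n)) \<le> c * ell2_norm x" if "x \<in> ell2" for x
  proof -
    have "(\<lambda>n. B x n - A x n) \<in> ell2" using that by (intro ell2_diff lin)
    then have "ell2_norm (S (\<lambda>n. B x n - A x n)) \<le> C * ell2_norm (\<lambda>n. B x n - A x n)" by (rule C)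
    also have "\<dots> \<le> C * (\<epsilon> * ell2_norm x)" using \<epsilon>(1)[OF that] C by (intro mult_left_mono)
    finally show ?thesis by (simp add: c_def)
  qed
  have bdd_below: "ell2_norm x \<le> C / (1 - c) * ell2_norm (B x)" if x: "x \<in> ell2" for x
  proof -
    have Bx: "B x \<in> ell2" and d: "(\<lambda>n. B x n - A x n) \<in> ell2" using x by (auto intro!: ell2_diff lin)
    have "S (\<lambda>n. B x n - (B x n - A x n)) = (\<lambda>n. S (B x) n - S (\<lambda>n. B x n - A x n) n)"
      by (rule lin(12)[OF Bx d])
    then have "x = (\<lambda>n. S (B x) n - S (\<lambda>n. B x n - A x n) n)" using SA[OF x] by simp
    then have "ell2_norm x \<le> ell2_norm (S (B x)) + ell2_norm (S (\<lambda>n. B x n - A x n))"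
      using ell2_diff(2)[OF lin(9)[OF Bx x] lin(9)[OF d x]] by metis
    also have "\<dots> \<le> C * ell2_norm (B x) + c * ell2_norm x" using C(1)[OF Bx] SBA[OF x] by simp
    finally show ?thesis using c by (simp add: field_simps)
  qed
  have inj: "x = y" if "x \<in> ell2" "y \<in> ell2" "B x = B y" for x y
  proof -
    have d: "(\<lambda>n. x n - y n) \<in> ell2" using that by (intro ell2_diff)
    have "B (\<lambda>n. x n - y n) = (\<lambda>n. 0)" using lin(8)[OF that(1,2)] that(3) by simp
    then have "ell2_norm (\<lambda>n. x n - y n) \<le> 0" using bdd_below[OF d] by simp
    from ell2_norm_eq_0[OF d this] show ?thesis by (simp add: fun_eq_iff)
  qed
  have surj: "\<exists>x\<in>ell2. B x = y" if y: "y \<in> ell2" for y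
  proof -
    define \<Phi> where "\<Phi> x = S (\<lambda>n. y n - (B x n - A x n))" for x
    have mem: "\<Phi> x \<in> ell2" if "x \<in> ell2" for x
      unfolding \<Phi>_def using y that by (intro lin(9)[where y = y] ell2_diff lin(1,5)) auto
    have contr: "ell2_norm (\<lambda>n. \<Phi> x n - \<Phi> z n) \<le> c * ell2_norm (\<lambda>n. x n - z n)" if x: "x \<in> ell2" and z: "z \<in> ell2" for x z
    proof -
      have xz: "(\<lambda>n. z n - x n) \<in> ell2" using x z by (intro ell2_diff)
      have m: "(\<lambda>n. y n - (B w n - A w n)) \<in> ell2" if "w \<in> ell2" for w
        using that y by (intro ell2_diff lin(1,5)) auto
      have "(\<lambda>n. \<Phi> x n - \<Phi> z n) = S (\<lambda>n. (y n - (B x n - A x n)) - (y n - (B z n - A z n)))"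
        unfolding \<Phi>_def by (rule lin(12)[OF m[OF x] m[OF z], symmetric])
      also have "(\<lambda>n. (y n - (B x n - A x n)) - (y n - (B z n - A z n))) = (\<lambda>n. B (\<lambda>n. z n - x n) n - A (\<lambda>n. z n - x n) n)"
        by (simp add: lin(4)[OF z x] lin(8)[OF z x] algebra_simps)
      finally have "ell2_norm (\<lambda>n. \<Phi> x n - \<Phi> z n) \<le> c * ell2_norm (\<lambda>n. z n - x n)"
        using SBA[OF xz] by simp
      also have "ell2_norm (\<lambda>n. z n - x n) = ell2_norm (\<lambda>n. x n - z n)"
        by (simp add: ell2_norm_def norm_minus_commute)
      finally show ?thesis .
    qed
    define xs where "xs n = (\<Phi> ^^ n) (\<lambda>_. 0)" for n
    have xs: "xs n \<in> ell2" for n by (induction n) (auto simp: xs_def mem)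
    have step: "ell2_norm (\<lambda>k. xs (Suc n) k - xs n k) \<le> ell2_norm (xs 1) * c ^ n" for n
    proof (induction n)
      case 0 then show ?case by (simp add: xs_def)
    next
      case (Suc n)
      have "ell2_norm (\<lambda>k. xs (Suc (Suc n)) k - xs (Suc n) k) \<le> c * ell2_norm (\<lambda>k. xs (Suc n) k - xs n k)"
        using contr[OF xs xs, of "Suc n" n] by (simp add: xs_def)
      also have "\<dots> \<le> c * (ell2_norm (xs 1) * c ^ n)" using Suc c by (intro mult_left_mono)
      finally show ?case by (simp add: ac_simps)
    qed
    obtain X where X: "X \<in> ell2" "\<And>n. ell2_norm (\<lambda>k. X k - xs n k) \<le> ell2_norm (xs 1) * c ^ n / (1 - c)"
      using ell2_complete_geometric[OF xs c step] by blast
    have "ell2_norm (\<lambda>k. \<Phi> X k - X k) \<le> 2 * ell2_norm (xs 1) / (1 - c) * c ^ n" for n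
    proof -
      have "(\<lambda>k. \<Phi> X k - X k) = (\<lambda>k. (\<Phi> X k - \<Phi> (xs n) k) - (X k - xs (Suc n) k))"
        by (simp add: xs_def)
      then have "ell2_norm (\<lambda>k. \<Phi> X k - X k) \<le> ell2_norm (\<lambda>k. \<Phi> X k - \<Phi> (xs n) k) + ell2_norm (\<lambda>k. X k - xs (Suc n) k)"
        using ell2_diff(2)[OF ell2_diff(1)[OF mem[OF X(1)] mem[OF xs[of n]]] ell2_diff(1)[OF X(1) xs[of "Suc n"]]]
        by simp
      also have "ell2_norm (\<lambda>k. \<Phi> X k - \<Phi> (xs n) k) \<le> c * (ell2_norm (xs 1) * c ^ n / (1 - c))"
        using contr[OF X(1) xs[of n]] X(2)[of n] c mult_left_mono order_trans by blast
      also have "ell2_norm (\<lambda>k. X k - xs (Suc n) k) \<le> c * (ell2_norm (xs 1) * c ^ n / (1 - c))"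
        using X(2)[of "Suc n"] by (simp add: mult_ac)
      finally have "ell2_norm (\<lambda>k. \<Phi> X k - X k) \<le> c * (2 * (ell2_norm (xs 1) * c ^ n / (1 - c)))" by (simp add: mult_ac)
      also have "\<dots> \<le> 1 * (2 * (ell2_norm (xs 1) * c ^ n / (1 - c)))"
        using c xs by (intro mult_right_mono) auto
      finally show ?thesis by simp
    qed
    moreover have "(\<lambda>n. 2 * ell2_norm (xs 1) / (1 - c) * c ^ n) \<longlonglongrightarrow> 2 * ell2_norm (xs 1) / (1 - c) * 0"
      using c by (intro tendsto_intros LIMSEQ_power_zero) auto
    ultimately have "ell2_norm (\<lambda>k. \<Phi> X k - X k) \<le> 0"
      using LIMSEQ_le_const by fastforce
    from ell2_norm_eq_0[OF ell2_diff(1)[OF mem[OF X(1)] X(1)] this] have fixp: "\<Phi> X = X"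
      by (simp add: fun_eq_iff)
    have m: "(\<lambda>n. y n - (B X n - A X n)) \<in> ell2" using X(1) y by (intro ell2_diff lin(1,5)) auto
    have "A X = (\<lambda>n. y n - (B X n - A X n))"
      using AS[OF m] fixp unfolding \<Phi>_def by simp
    then have "B X = y" by (auto simp: fun_eq_iff dest!: spec)
    with X(1) show ?thesis by blast
  qed
  define R where "R y = (SOME x. x \<in> ell2 \<and> B x = y)" for y
  have R: "R y \<in> ell2" "B (R y) = y" if "y \<in> ell2" for y
  proof -
    have "\<exists>x. x \<in> ell2 \<and> B x = y" using surj[OF that] by blast
    from someI_ex[OF this] have "R y \<in> ell2 \<and> B (R y) = y" unfolding R_def .
    then show "R y \<in> ell2" "B (R y) = y" by auto
  qed
  have RB: "R (B x) = x" if "x \<in> ell2" for x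
    using inj[OF R(1) that R(2)] lin(5)[OF that that] by simp
  have "bounded_ell2_operator R"
    unfolding bounded_ell2_operator_def
  proof (intro conjI ballI allI exI[of _ "C / (1 - c)"])
    fix x y :: "nat \<Rightarrow> complex" and a assume x: "x \<in> ell2" and y: "y \<in> ell2"
    show "R (\<lambda>n. x n + y n) = (\<lambda>n. R x n + R y n)"
      by (rule inj) (use x y R ell2_add(1) lin(6) in auto)
  next
    fix x :: "nat \<Rightarrow> complex" and a assume x: "x \<in> ell2"
    show "R (\<lambda>n. a * x n) = (\<lambda>n. a * R x n)"
      by (rule inj) (use x R ell2_scale(1) lin(7) in auto)
  next
    fix x assume x: "x \<in> ell2"
    show "ell2_norm (R x) \<le> C / (1 - c) * ell2_norm x" using bdd_below[OF R(1)[OF x]] R(2)[OF x] by simp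
  qed (use R in auto)
  then have "ell2_inverse B R" using R RB by (simp add: ell2_inverse_def)
  then show ?thesis by blast
qed

section \<open>Toeplitz operators with continuous symbols\<close>

abbreviation circle :: "complex set" where "circle \<equiv> sphere 0 1"

lemma circle_cis: "t \<in> circle \<longleftrightarrow> (\<exists>v\<in>{0..2*pi}. t = cis v)"
proof
  assume "t \<in> circle"
  then have "t = cis (Arg2pi t)" using Arg2pi[of t] by (simp add: cis_conv_exp is_Arg_def)
  then show "\<exists>v\<in>{0..2*pi}. t = cis v" using Arg2pi_ge_0[of t] Arg2pi_lt_2pi[of t] by force
qed auto

lemma continuous_on_circle_cis:
  assumes "continuous_on circle a"
  shows "continuous_on A (\<lambda>v. a (cis v))"
  by (rule continuous_on_compose2[OF assms]) (auto intro!: continuous_intros)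

lemma integral_cis_int: "((\<lambda>v. cis (of_int k * v)) has_integral (if k = 0 then 2 * pi else 0)) {0..2*pi}"
proof (cases "k = 0")
  case True
  then show ?thesis using has_integral_const_real[of "1::complex" 0 "2*pi"] by (simp add: scaleR_conv_of_real)
next
  case False
  define h where "h z = exp (\<i> * of_int k * z) / (\<i> * of_int k)" for z :: complex
  have h: "(h has_field_derivative exp (\<i> * of_int k * z)) (at z)" for z
    unfolding h_def using False by (auto intro!: derivative_eq_intros)
  have e: "exp (\<i> * of_int k * of_real v) = cis (of_int k * v)" for v :: real
    by (simp add: cis_conv_exp mult.assoc)
  have "((\<lambda>v. cis (of_int k * v)) has_integral h (of_real (2*pi)) - h (of_real 0)) {0..2*pi}"
    using has_vector_derivative_real_field[OF h] e
    by (intro fundamental_theorem_of_calculus[where f = "\<lambda>v. h (of_real v)"]) auto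
  moreover have "h (of_real (2*pi)) = h (of_real 0)"
    unfolding h_def e using cis_multiple_2pi[of "of_int k"] by (simp add: mult_ac)
  ultimately show ?thesis using False by simp
qed

lemma integrable_circle:
  fixes g :: "real \<Rightarrow> complex"
  assumes "continuous_on {0..2*pi} g"
  shows "g integrable_on {0..2*pi}"
  using assms by (rule integrable_continuous_interval)

lemma fourier_coeff_has_integral:
  assumes "continuous_on circle a"
  shows "((\<lambda>v. a (cis v) * cis (- (of_int k * v))) has_integral (of_real (2*pi) * fourier_coeff a k)) {0..2*pi}"
proof -
  have "(\<lambda>v. a (cis v) * cis (- (of_int k * v))) integrable_on {0..2*pi}"
    by (intro integrable_circle continuous_intros continuous_on_circle_cis assms)
  then show ?thesis by (simp add: fourier_coeff_def integrable_integral)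
qed

lemma fourier_coeff_eqI:
  assumes "((\<lambda>v. a (cis v) * cis (- (of_int k * v))) has_integral (of_real (2*pi) * c)) {0..2*pi}"
  shows "fourier_coeff a k = c"
  using integral_unique[OF assms] by (simp add: fourier_coeff_def)

lemma fourier_coeff_diff:
  assumes "continuous_on circle a" "continuous_on circle b"
  shows "fourier_coeff (\<lambda>t. a t - b t) k = fourier_coeff a k - fourier_coeff b k"
  by (rule fourier_coeff_eqI)
    (use has_integral_diff[OF fourier_coeff_has_integral[OF assms(1)] fourier_coeff_has_integral[OF assms(2)], of k k]
     in \<open>simp add: algebra_simps\<close>)

lemma fourier_coeff_trig:
  assumes "finite F"
  shows "fourier_coeff (\<lambda>t. \<Sum>n\<in>F. d n * t powi n) k = (if k \<in> F then d k else 0)"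
proof (rule fourier_coeff_eqI)
  have "((\<lambda>v. \<Sum>n\<in>F. d n * cis (of_int (n - k) * v)) has_integral
     (\<Sum>n\<in>F. d n * of_real (if n - k = 0 then 2 * pi else 0))) {0..2*pi}"
    using integral_cis_int by (intro has_integral_sum has_integral_mult_right assms)
  also have "(\<Sum>n\<in>F. d n * of_real (if n - k = 0 then 2 * pi else 0)) = of_real (2*pi) * (if k \<in> F then d k else 0)"
  proof -
    have "(\<Sum>n\<in>F. d n * of_real (if n - k = 0 then 2 * pi else 0)) = (\<Sum>n\<in>F. if n = k then of_real (2*pi) * d k else 0)"
      by (rule sum.cong) auto
    then show ?thesis using assms by simp
  qed
  also have "(\<lambda>v. \<Sum>n\<in>F. d n * cis (of_int (n - k) * v)) = (\<lambda>v. (\<Sum>n\<in>F. d n * cis v powi n) * cis (- (of_int k * v)))"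
    by (intro ext) (simp add: sum_distrib_right sum_distrib_left cis_power_int mult.assoc cis_mult algebra_simps)
  finally show "((\<lambda>v. (\<Sum>n\<in>F. d n * cis v powi n) * cis (- (of_int k * v))) has_integral of_real (2*pi) * (if k \<in> F then d k else 0)) {0..2*pi}" .
qed

lemma integral_mult_cnj_trig:
  assumes a: "continuous_on circle a" and F: "finite F"
  shows "((\<lambda>v. a (cis v) * cnj (\<Sum>n\<in>F. d n * cis v powi n)) has_integral
      (of_real (2*pi) * (\<Sum>n\<in>F. fourier_coeff a n * cnj (d n)))) {0..2*pi}"
proof -
  have "((\<lambda>v. \<Sum>n\<in>F. cnj (d n) * (a (cis v) * cis (- (of_int n * v)))) has_integral
      (\<Sum>n\<in>F. cnj (d n) * (of_real (2*pi) * fourier_coeff a n))) {0..2*pi}"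
    by (intro has_integral_sum has_integral_mult_right F fourier_coeff_has_integral a)
  then show ?thesis
    by (simp add: sum_distrib_left cis_power_int mult_ac cis_cnj)
qed

lemma continuous_on_trig:
  assumes "\<And>t. t \<in> A \<Longrightarrow> t \<noteq> 0"
  shows "continuous_on A (\<lambda>t::complex. \<Sum>n\<in>F. d n * t powi n)"
  using assms by (intro continuous_intros) auto

lemma Re_mult_cnj: "Re (z * cnj z) = (cmod z)\<^sup>2"
  unfolding cmod_power2 by (simp add: power2_eq_square)

lemma parseval_trig:
  assumes F: "finite F"
  shows "((\<lambda>v. (cmod (\<Sum>n\<in>F. d n * cis v powi n))\<^sup>2) has_integral (2*pi * (\<Sum>n\<in>F. (cmod (d n))\<^sup>2))) {0..2*pi}"
proof -
  let ?s = "\<lambda>t. \<Sum>n\<in>F. d n * t powi n"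
  have "((\<lambda>v. Re (?s (cis v) * cnj (?s (cis v)))) has_integral
     Re (of_real (2*pi) * (\<Sum>n\<in>F. fourier_coeff ?s n * cnj (d n)))) {0..2*pi}"
    by (intro has_integral_linear[OF _ bounded_linear_Re, unfolded o_def]
        integral_mult_cnj_trig[where a = ?s and d = d] F continuous_on_trig) auto
  moreover have "Re (of_real (2*pi) * (\<Sum>n\<in>F. fourier_coeff ?s n * cnj (d n))) = 2*pi * (\<Sum>n\<in>F. (cmod (d n))\<^sup>2)"
  proof -
    have "Re (of_real (2*pi) * (\<Sum>n\<in>F. fourier_coeff ?s n * cnj (d n))) = 2*pi * (\<Sum>n\<in>F. Re (d n * cnj (d n)))"
      using F by (simp add: fourier_coeff_trig)
    then show ?thesis by (simp only: Re_mult_cnj)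
  qed
  ultimately show ?thesis by (simp only: Re_mult_cnj)
qed

text \<open>With \<open>s\<close> the Fourier sum of \<open>a\<close> over \<open>F\<close>, expand the integral of \<open>\<bar>a - s\<bar>\<^sup>2 \<ge> 0\<close>; the
  mixed term and the integral of \<open>\<bar>s\<bar>\<^sup>2\<close> have the same value.\<close>

lemma bessel:
  assumes a: "continuous_on circle a" and F: "finite F"
    and I: "((\<lambda>v. (cmod (a (cis v)))\<^sup>2) has_integral I) {0..2*pi}"
  shows "2*pi * (\<Sum>n\<in>F. (cmod (fourier_coeff a n))\<^sup>2) \<le> I"
proof -
  define c where "c = fourier_coeff a"
  define s where "s t = (\<Sum>n\<in>F. c n * t powi n)" for t
  define P where "P = 2*pi * (\<Sum>n\<in>F. (cmod (c n))\<^sup>2)"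
  have 1: "((\<lambda>v. Re (a (cis v) * cnj (s (cis v)))) has_integral P) {0..2*pi}"
  proof -
    have "((\<lambda>v. Re (a (cis v) * cnj (s (cis v)))) has_integral
       Re (of_real (2*pi) * (\<Sum>n\<in>F. c n * cnj (c n)))) {0..2*pi}"
      using integral_mult_cnj_trig[OF a F, of c] unfolding s_def c_def
      by (intro has_integral_linear[OF _ bounded_linear_Re, unfolded o_def]) auto
    then show ?thesis by (simp add: P_def complex_norm_square[symmetric] del: of_real_power)
  qed
  have 2: "((\<lambda>v. (cmod (s (cis v)))\<^sup>2) has_integral P) {0..2*pi}"
    unfolding s_def P_def by (rule parseval_trig[OF F])
  have "((\<lambda>v. (cmod (a (cis v)))\<^sup>2 - 2 * Re (a (cis v) * cnj (s (cis v))) + (cmod (s (cis v)))\<^sup>2) has_integral I - 2 * P + P) {0..2*pi}"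
    by (intro has_integral_add has_integral_diff has_integral_mult_right I 1 2)
  then have "0 \<le> I - 2 * P + P"
  proof (rule has_integral_nonneg)
    fix v
    have "(cmod (a (cis v)))\<^sup>2 - 2 * Re (a (cis v) * cnj (s (cis v))) + (cmod (s (cis v)))\<^sup>2 = (cmod (a (cis v) - s (cis v)))\<^sup>2"
      unfolding cmod_power2 by (simp add: power2_eq_square algebra_simps)
    then show "0 \<le> (cmod (a (cis v)))\<^sup>2 - 2 * Re (a (cis v) * cnj (s (cis v))) + (cmod (s (cis v)))\<^sup>2" by simp
  qed
  then show ?thesis by (simp add: P_def c_def)
qed

lemma fourier_coeff_mult_trig:
  assumes a: "continuous_on circle a" and F: "finite F"
  shows "fourier_coeff (\<lambda>t. a t * (\<Sum>n\<in>F. d n * t powi n)) k = (\<Sum>n\<in>F. fourier_coeff a (k - n) * d n)"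
proof (rule fourier_coeff_eqI)
  have "((\<lambda>v. \<Sum>n\<in>F. d n * (a (cis v) * cis (- (of_int (k - n) * v)))) has_integral
      (\<Sum>n\<in>F. d n * (of_real (2*pi) * fourier_coeff a (k - n)))) {0..2*pi}"
    by (intro has_integral_sum has_integral_mult_right F fourier_coeff_has_integral a)
  also have "(\<lambda>v. \<Sum>n\<in>F. d n * (a (cis v) * cis (- (of_int (k - n) * v)))) =
     (\<lambda>v. a (cis v) * (\<Sum>n\<in>F. d n * cis v powi n) * cis (- (of_int k * v)))"
    by (intro ext) (simp add: sum_distrib_right sum_distrib_left cis_power_int mult.assoc cis_mult algebra_simps)
  finally show "((\<lambda>v. a (cis v) * (\<Sum>n\<in>F. d n * cis v powi n) * cis (- (of_int k * v))) has_integral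
    (of_real (2*pi) * (\<Sum>n\<in>F. fourier_coeff a (k - n) * d n))) {0..2*pi}"
    by (simp add: sum_distrib_left mult_ac)
qed

text \<open>The left-hand side collects Fourier coefficients of \<open>a * s\<close>, where \<open>s\<close> is the
  trigonometric polynomial with coefficients \<open>x\<close>. Bessel's inequality for \<open>a * s\<close> and Parseval's
  identity for \<open>s\<close> give the bound.\<close>

lemma toeplitz_finite_bound:
  assumes a: "continuous_on circle a" and M: "\<And>t. t \<in> circle \<Longrightarrow> cmod (a t) \<le> M"
  shows "L2_set (\<lambda>j. cmod (\<Sum>k<K. fourier_coeff a (int j - int k) * x k)) {..<J} \<le> M * L2_set (\<lambda>k. cmod (x k)) {..<K}"
proof -
  have M0: "0 \<le> M" using M[of 1] order_trans[OF norm_ge_zero[of "a 1"]] by simp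
  define F where "F = int ` {..<K}"
  define s where "s t = (\<Sum>n\<in>F. x (nat n) * t powi n)" for t
  define g where "g t = a t * s t" for t
  have s_cont: "continuous_on circle s" unfolding s_def by (rule continuous_on_trig) auto
  have g_cont: "continuous_on circle g" unfolding g_def by (intro continuous_intros a s_cont)
  have F: "finite F" by (simp add: F_def)
  have c: "fourier_coeff g (int j) = (\<Sum>k<K. fourier_coeff a (int j - int k) * x k)" for j
    unfolding g_def s_def fourier_coeff_mult_trig[OF a F] by (simp add: F_def sum.reindex)
  have sq: "((\<lambda>v. (cmod (s (cis v)))\<^sup>2) has_integral (2*pi * (\<Sum>k<K. (cmod (x k))\<^sup>2))) {0..2*pi}"
    using parseval_trig[OF F, of "x \<circ> nat"] by (simp add: s_def F_def sum.reindex)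
  have gint: "(\<lambda>v. (cmod (g (cis v)))\<^sup>2) integrable_on {0..2*pi}"
    by (intro integrable_continuous_interval continuous_intros continuous_on_circle_cis g_cont)
  have "integral {0..2*pi} (\<lambda>v. (cmod (g (cis v)))\<^sup>2) \<le> M\<^sup>2 * (2*pi * (\<Sum>k<K. (cmod (x k))\<^sup>2))"
  proof (rule has_integral_le[OF integrable_integral[OF gint] has_integral_mult_right[OF sq]])
    fix v
    have "cmod (g (cis v)) \<le> M * cmod (s (cis v))"
      using M[of "cis v"] by (simp add: g_def norm_mult mult_right_mono)
    then show "(cmod (g (cis v)))\<^sup>2 \<le> M\<^sup>2 * (cmod (s (cis v)))\<^sup>2"
      by (metis norm_ge_zero power_mono power_mult_distrib)
  qed
  moreover have "2*pi * (\<Sum>j<J. (cmod (fourier_coeff g (int j)))\<^sup>2) \<le> integral {0..2*pi} (\<lambda>v. (cmod (g (cis v)))\<^sup>2)"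
    using bessel[OF g_cont _ integrable_integral[OF gint], of "int ` {..<J}"] by (simp add: sum.reindex)
  ultimately have "2*pi * (\<Sum>j<J. (cmod (fourier_coeff g (int j)))\<^sup>2) \<le> M\<^sup>2 * (2*pi * (\<Sum>k<K. (cmod (x k))\<^sup>2))"
    by linarith
  then have "2*pi * (\<Sum>j<J. (cmod (fourier_coeff g (int j)))\<^sup>2) \<le> 2*pi * (M\<^sup>2 * (\<Sum>k<K. (cmod (x k))\<^sup>2))"
    by (simp only: mult.left_commute)
  then have "(\<Sum>j<J. (cmod (fourier_coeff g (int j)))\<^sup>2) \<le> M\<^sup>2 * (\<Sum>k<K. (cmod (x k))\<^sup>2)"
    by (rule mult_left_le_imp_le) simp
  then have "sqrt (\<Sum>j<J. (cmod (fourier_coeff g (int j)))\<^sup>2) \<le> sqrt (M\<^sup>2 * (\<Sum>k<K. (cmod (x k))\<^sup>2))"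
    by (rule real_sqrt_le_mono)
  then show ?thesis using M0 by (simp add: L2_set_def c real_sqrt_mult)
qed

lemma circle_bounded:
  assumes "continuous_on circle (a :: complex \<Rightarrow> complex)"
  obtains M where "\<And>t. t \<in> circle \<Longrightarrow> cmod (a t) \<le> M"
proof -
  have "bounded (a ` circle)" using assms by (intro compact_imp_bounded compact_continuous_image) auto
  then obtain M where "\<forall>x\<in>circle. cmod (a x) \<le> M" unfolding bounded_iff by blast
  then show ?thesis using that by blast
qed

lemma toeplitz_summable:
  assumes a: "continuous_on circle a" and x: "x \<in> ell2"
  shows "summable (\<lambda>k. fourier_coeff a (int j - int k) * x k)"
proof -
  obtain M where M: "\<And>t. t \<in> circle \<Longrightarrow> cmod (a t) \<le> M" using circle_bounded[OF a] by blast
  have gint: "(\<lambda>v. (cmod (a (cis v)))\<^sup>2) integrable_on {0..2*pi}"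
    by (intro integrable_continuous_interval continuous_intros continuous_on_circle_cis a)
  have "(\<Sum>k<K. (cmod (fourier_coeff a (int j - int k)))\<^sup>2) \<le> integral {0..2*pi} (\<lambda>v. (cmod (a (cis v)))\<^sup>2) / (2*pi)" for K
    using bessel[OF a _ integrable_integral[OF gint], of "(\<lambda>k. int j - int k) ` {..<K}"]
    by (simp add: sum.reindex inj_on_def field_simps)
  then have "summable (\<lambda>k. (cmod (fourier_coeff a (int j - int k)))\<^sup>2)"
    by (intro summableI_nonneg_bounded) auto
  then have "summable (\<lambda>k. (cmod (fourier_coeff a (int j - int k)))\<^sup>2 + (cmod (x k))\<^sup>2)"
    using x by (intro summable_add) (auto simp: ell2_def)
  moreover have "norm (fourier_coeff a (int j - int k) * x k) \<le> (cmod (fourier_coeff a (int j - int k)))\<^sup>2 + (cmod (x k))\<^sup>2" for k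
  proof -
    have "2 * (cmod (fourier_coeff a (int j - int k)) * cmod (x k)) \<le> (cmod (fourier_coeff a (int j - int k)))\<^sup>2 + (cmod (x k))\<^sup>2"
      using sum_squares_bound[of "cmod (fourier_coeff a (int j - int k))" "cmod (x k)"] by simp
    moreover have "0 \<le> cmod (fourier_coeff a (int j - int k)) * cmod (x k)" by simp
    ultimately show ?thesis unfolding norm_mult by linarith
  qed
  ultimately show ?thesis by (rule summable_comparison_test'[where N = 0])
qed

lemma toeplitz_bounded:
  assumes a: "continuous_on circle a" and M: "\<And>t. t \<in> circle \<Longrightarrow> cmod (a t) \<le> M" and x: "x \<in> ell2"
  shows "toeplitz a x \<in> ell2" "ell2_norm (toeplitz a x) \<le> M * ell2_norm x"
proof -
  have M0: "0 \<le> M" using M[of 1] order_trans[OF norm_ge_zero[of "a 1"]] by simp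
  have "L2_set (\<lambda>j. cmod (toeplitz a x j)) {..<J} \<le> M * ell2_norm x" for J
  proof (rule LIMSEQ_le_const2)
    show "(\<lambda>K. L2_set (\<lambda>j. cmod (\<Sum>k<K. fourier_coeff a (int j - int k) * x k)) {..<J})
      \<longlonglongrightarrow> L2_set (\<lambda>j. cmod (toeplitz a x j)) {..<J}"
      unfolding L2_set_def toeplitz_def
      by (intro tendsto_intros summable_LIMSEQ toeplitz_summable a x)
    show "\<exists>N. \<forall>K\<ge>N. L2_set (\<lambda>j. cmod (\<Sum>k<K. fourier_coeff a (int j - int k) * x k)) {..<J} \<le> M * ell2_norm x"
      using toeplitz_finite_bound[OF a M] L2_set_le_ell2_norm[OF x] M0
      by (meson mult_left_mono order_trans)
  qed
  from ell2_normI[OF this] show "toeplitz a x \<in> ell2" "ell2_norm (toeplitz a x) \<le> M * ell2_norm x" by blast+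
qed

lemma toeplitz_linear:
  assumes a: "continuous_on circle a"
  shows "ell2_linear (toeplitz a)"
proof -
  obtain M where M: "\<And>t. t \<in> circle \<Longrightarrow> cmod (a t) \<le> M" using circle_bounded[OF a] by blast
  show ?thesis
    unfolding ell2_linear_def
  proof (intro conjI ballI allI)
    fix x y :: "nat \<Rightarrow> complex" assume "x \<in> ell2" "y \<in> ell2"
    then show "toeplitz a (\<lambda>n. x n + y n) = (\<lambda>n. toeplitz a x n + toeplitz a y n)"
      unfolding toeplitz_def distrib_left by (intro ext suminf_add[symmetric] toeplitz_summable a)
  next
    fix x :: "nat \<Rightarrow> complex" and c assume x: "x \<in> ell2"
    show "toeplitz a (\<lambda>n. c * x n) = (\<lambda>n. c * toeplitz a x n)"
      unfolding toeplitz_def mult.left_commute[of _ c] by (intro ext suminf_mult toeplitz_summable a x)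
  qed (rule toeplitz_bounded(1)[OF a M])
qed

lemma toeplitz_diff:
  assumes "continuous_on circle a" "continuous_on circle b" "x \<in> ell2"
  shows "toeplitz (\<lambda>t. a t - b t) x = (\<lambda>n. toeplitz a x n - toeplitz b x n)"
  using assms by (simp add: toeplitz_def fourier_coeff_diff left_diff_distrib suminf_diff[symmetric] toeplitz_summable)

lemma toeplitz_const: "toeplitz (\<lambda>t. l) x = (\<lambda>n. l * x n)"
proof
  fix j
  have "fourier_coeff (\<lambda>t. l) k = (if k = 0 then l else 0)" for k
    using fourier_coeff_trig[of "{0}" "\<lambda>_. l" k] by simp
  then have "toeplitz (\<lambda>t. l) x j = (\<Sum>k. (if int j - int k = 0 then l else 0) * x k)"
    by (simp add: toeplitz_def)
  also have "\<dots> = (\<Sum>k\<in>{j}. (if int j - int k = 0 then l else 0) * x k)"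
    by (rule suminf_finite) auto
  finally show "toeplitz (\<lambda>t. l) x j = l * x j" by simp
qed

definition toeplitz_invertible :: "(complex \<Rightarrow> complex) \<Rightarrow> bool" where
  "toeplitz_invertible a \<longleftrightarrow> (\<exists>S. ell2_inverse (toeplitz a) S)"

lemma toeplitz_spectrum_iff:
  assumes a: "continuous_on circle a"
  shows "l \<in> ell2_spectrum (toeplitz a) \<longleftrightarrow> \<not> toeplitz_invertible (\<lambda>t. a t - l)"
proof -
  have "toeplitz (\<lambda>t. a t - l) x = (\<lambda>n. toeplitz a x n - l * x n)" if "x \<in> ell2" for x
    using toeplitz_diff[OF a _ that, of "\<lambda>_. l"] by (simp add: toeplitz_const)
  then show ?thesis
    unfolding ell2_spectrum_def toeplitz_invertible_def ell2_inverse_def bounded_ell2_operator_def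
    by auto
qed

text \<open>The map \<open>a \<mapsto> T(a)\<close> is linear and does not increase norms, the symbols being measured in
  the supremum norm on the circle.\<close>

lemma toeplitz_invertible_perturb:
  assumes a: "continuous_on circle a" and inv: "toeplitz_invertible a"
  shows "\<exists>\<delta>>0. \<forall>a'. continuous_on circle a' \<and> (\<forall>t\<in>circle. cmod (a' t - a t) \<le> \<delta>) \<longrightarrow> toeplitz_invertible a'"
proof -
  obtain S where S: "ell2_inverse (toeplitz a) S" using inv by (auto simp: toeplitz_invertible_def)
  then have "\<exists>C. \<forall>x\<in>ell2. ell2_norm (S x) \<le> C * ell2_norm x"
    unfolding ell2_inverse_def bounded_ell2_operator_def by blast
  then obtain C' where C': "\<And>x. x \<in> ell2 \<Longrightarrow> ell2_norm (S x) \<le> C' * ell2_norm x"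
    by blast
  define C where "C = max 0 C'"
  have C: "ell2_norm (S x) \<le> C * ell2_norm x" if "x \<in> ell2" for x
    using C'[OF that] mult_right_mono[of C' C "ell2_norm x"] that by (simp add: C_def)
  define \<delta> where "\<delta> = 1 / (C + 1) / 2"
  have C0: "0 \<le> C" by (simp add: C_def)
  have \<delta>: "0 < \<delta>" "C * \<delta> < 1" using C0 by (auto simp: \<delta>_def field_simps)
  show ?thesis
  proof (intro exI[of _ \<delta>] conjI \<delta>(1) allI impI)
    fix a' assume a': "continuous_on circle a' \<and> (\<forall>t\<in>circle. cmod (a' t - a t) \<le> \<delta>)"
    show "toeplitz_invertible a'"
      unfolding toeplitz_invertible_def
    proof (rule ell2_inverse_perturb[OF S toeplitz_linear toeplitz_linear C C0 _ less_imp_le[OF \<delta>(1)] \<delta>(2)])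
      fix x :: "nat \<Rightarrow> complex" assume x: "x \<in> ell2"
      show "ell2_norm (\<lambda>n. toeplitz a' x n - toeplitz a x n) \<le> \<delta> * ell2_norm x"
        using toeplitz_bounded(2)[of "\<lambda>t. a' t - a t" \<delta> x] a a' x
        by (auto simp: toeplitz_diff intro!: continuous_intros)
    qed (use a a' in auto)
  qed
qed

section \<open>Invertible Toeplitz operators and zeros in the disc\<close>

text \<open>A Laurent polynomial is kept as a quotient, so that the number of zeros of the numerator
  in the disc can be compared with the exponent of the denominator. The pair \<open>(p, m)\<close> is not
  determined by the function.\<close>

definition laurent_form :: "complex poly \<Rightarrow> nat \<Rightarrow> complex \<Rightarrow> complex" where
  "laurent_form p m t = poly p t / t ^ m"

lemma continuous_on_laurent_form [continuous_intros]:
  "(\<And>t. t \<in> A \<Longrightarrow> t \<noteq> 0) \<Longrightarrow> continuous_on A (laurent_form p m)"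
  unfolding laurent_form_def by (intro continuous_intros) auto

lemma fourier_coeff_cong:
  assumes "\<And>t. t \<in> circle \<Longrightarrow> a t = b t"
  shows "fourier_coeff a = fourier_coeff b"
  unfolding fourier_coeff_def using assms by (intro ext) (simp add: circle_cis)

lemma fourier_coeff_laurent_form:
  "fourier_coeff (laurent_form p m) k = (if k + int m \<ge> 0 then coeff p (nat (k + int m)) else 0)"
proof -
  let ?F = "(\<lambda>i. int i - int m) ` {..degree p}"
  have "fourier_coeff (laurent_form p m) = fourier_coeff (\<lambda>t. \<Sum>n\<in>?F. coeff p (nat (n + int m)) * t powi n)"
  proof (rule fourier_coeff_cong)
    fix t assume t: "t \<in> circle"
    then have "t \<noteq> 0" by auto
    then show "laurent_form p m t = (\<Sum>n\<in>?F. coeff p (nat (n + int m)) * t powi n)"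
      by (subst sum.reindex)
        (auto simp: inj_on_def laurent_form_def poly_altdef power_int_diff sum_divide_distrib)
  qed
  then have "fourier_coeff (laurent_form p m) k = (if k \<in> ?F then coeff p (nat (k + int m)) else 0)"
    by (simp add: fourier_coeff_trig)
  moreover have "coeff p (nat (k + int m)) = 0" if "k \<notin> ?F" "k + int m \<ge> 0"
  proof (rule coeff_eq_0, rule ccontr)
    assume "\<not> degree p < nat (k + int m)"
    then have "k = int (nat (k + int m)) - int m" "nat (k + int m) \<in> {..degree p}" using that(2) by auto
    with that(1) show False by blast
  qed
  moreover have "k + int m \<ge> 0" if "k \<in> ?F" using that by auto
  ultimately show ?thesis by auto
qed

text \<open>On generating functions, the operator multiplies by \<open>p\<close> and drops the first \<open>m\<close>
  coefficients.\<close>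

lemma toeplitz_laurent_form:
  "toeplitz (laurent_form p m) x j = fps_nth (fps_of_poly p * Abs_fps x) (j + m)"
proof -
  have "toeplitz (laurent_form p m) x j = (\<Sum>k\<in>{0..j+m}. fourier_coeff (laurent_form p m) (int j - int k) * x k)"
    unfolding toeplitz_def by (rule suminf_finite) (auto simp: fourier_coeff_laurent_form)
  also have "\<dots> = (\<Sum>k\<in>{0..j+m}. x k * coeff p (j + m - k))"
    by (rule sum.cong) (auto simp: fourier_coeff_laurent_form nat_diff_distrib nat_add_distrib of_nat_diff
      intro!: arg_cong[where f = "coeff p"])
  also have "\<dots> = fps_nth (Abs_fps x * fps_of_poly p) (j + m)"
    by (simp add: fps_mult_nth)
  finally show ?thesis by (simp add: mult.commute)
qed

definition zeros_inside :: "complex poly \<Rightarrow> real \<Rightarrow> nat" where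
  "zeros_inside p \<rho> = size (filter_mset (\<lambda>z. cmod z < \<rho>) (proots p))"

lemma poly_split_circle:
  fixes p :: "complex poly"
  assumes "p \<noteq> 0"
  obtains p1 p2 where "p = p1 * p2" "degree p1 = zeros_inside p \<rho>" "p1 \<noteq> 0" "p2 \<noteq> 0"
    "\<And>z. poly p1 z = 0 \<Longrightarrow> cmod z < \<rho>" "\<And>z. poly p2 z = 0 \<Longrightarrow> \<rho> \<le> cmod z"
proof
  define L where "L M = (\<Prod>x\<in>#M. [:-x, 1:])" for M :: "complex multiset"
  define p1 where "p1 = L (filter_mset (\<lambda>z. cmod z < \<rho>) (proots p))"
  define p2 where "p2 = smult (lead_coeff p) (L (filter_mset (\<lambda>z. \<not> cmod z < \<rho>) (proots p)))"
  have deg: "degree (L M) = size M \<and> L M \<noteq> 0" for M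
  proof (induction M)
    case (add x M)
    then show ?case unfolding L_def by (simp add: degree_mult_eq del: mult_pCons_left)
  qed (simp add: L_def)
  have root: "poly (L M) z = 0 \<longleftrightarrow> z \<in># M" for M z
    by (induction M) (auto simp: L_def)
  have "L (M + M') = L M * L M'" for M M' by (simp add: L_def)
  then have "L (proots p) = L (filter_mset (\<lambda>z. cmod z < \<rho>) (proots p)) * L (filter_mset (\<lambda>z. \<not> cmod z < \<rho>) (proots p))"
    using multiset_partition[of "proots p" "\<lambda>z. cmod z < \<rho>"] by metis
  moreover have "p = smult (lead_coeff p) (L (proots p))"
    unfolding L_def by (simp add: complex_poly_decompose_multiset)
  ultimately show "p = p1 * p2" unfolding p1_def p2_def by simp
  show "degree p1 = zeros_inside p \<rho>" unfolding p1_def zeros_inside_def using deg by blast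
  show "p1 \<noteq> 0" "p2 \<noteq> 0" using deg assms by (auto simp: p1_def p2_def)
  show "cmod z < \<rho>" if "poly p1 z = 0" for z using that root by (auto simp: p1_def)
  show "\<rho> \<le> cmod z" if "poly p2 z = 0" for z using that root assms by (auto simp: p2_def)
qed

text \<open>Split \<open>p = p1 * p2\<close> by the circle. The power series of \<open>1 / p2\<close> converges beyond the unit
  circle, so its coefficients form an element of \<open>l\<^sup>2\<close>. If \<open>p1\<close> had degree less than \<open>m\<close>, the
  operator would map them to \<open>0\<close>, because \<open>p * (1 / p2) = p1\<close>.\<close>

lemma toeplitz_invertible_zeros_ge:
  assumes inv: "toeplitz_invertible (laurent_form p m)" and p: "p \<noteq> 0"
    and nz: "\<And>t. t \<in> circle \<Longrightarrow> poly p t \<noteq> 0"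
  shows "m \<le> zeros_inside p 1"
proof (rule ccontr)
  assume less: "\<not> m \<le> zeros_inside p 1"
  obtain p1 p2 where pp: "p = p1 * p2" "degree p1 = zeros_inside p 1" "p1 \<noteq> 0" "p2 \<noteq> 0"
    "\<And>z. poly p1 z = 0 \<Longrightarrow> cmod z < 1" "\<And>z. poly p2 z = 0 \<Longrightarrow> 1 \<le> cmod z"
    using poly_split_circle[OF p] by metis
  have p2: "1 < cmod z" if "poly p2 z = 0" for z
    using pp(6)[OF that] nz[of z] that pp(1) by (cases "cmod z = 1") auto
  have fin: "finite {z. poly p2 z = 0}" using poly_roots_finite pp by blast
  define R where "R = Min (insert 2 (cmod ` {z. poly p2 z = 0}))"
  have R: "1 < R" "\<And>z. poly p2 z = 0 \<Longrightarrow> R \<le> cmod z"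
    unfolding R_def using fin p2 by auto
  define X where "X = inverse (fps_of_poly p2)"
  have p20: "poly p2 0 \<noteq> 0" using p2[of 0] by auto
  have X0: "fps_nth (fps_of_poly p2) 0 \<noteq> 0" using p20 by (simp add: poly_0_coeff_0)
  have "(\<lambda>z. inverse (poly p2 z)) has_fps_expansion X"
    unfolding X_def by (intro has_fps_expansion_inverse X0) (simp add: has_fps_expansion_def)
  then have "fps_expansion (\<lambda>z. inverse (poly p2 z)) 0 = X"
    by (rule fps_expansion_eqI)
  moreover have "fps_conv_radius (fps_expansion (\<lambda>z. inverse (poly p2 z)) 0) \<ge> ereal R"
    by (rule conv_radius_fps_expansion) (use R in \<open>force intro!: holomorphic_intros\<close>)
  ultimately have "ereal (norm (1::complex)) < fps_conv_radius X"
    using R(1) by (metis ereal_less(3) less_le_trans norm_one less_ereal.simps(1))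
  from norm_summable_fps[OF this] have sX: "summable (\<lambda>n. cmod (fps_nth X n))" by simp
  define x where "x = fps_nth X"
  have x: "x \<in> ell2"
  proof (rule ell2_normI(1))
    fix n
    have "L2_set (\<lambda>k. cmod (x k)) {..<n} \<le> (\<Sum>k<n. cmod (x k))" by (rule L2_set_le_sum) auto
    also have "\<dots> \<le> (\<Sum>k. cmod (x k))" using sX by (intro sum_le_suminf) (auto simp: x_def)
    finally show "L2_set (\<lambda>k. cmod (x k)) {..<n} \<le> (\<Sum>k. cmod (x k))" .
  qed
  have pX: "fps_of_poly p2 * X = 1" unfolding X_def using X0 by (simp add: inverse_mult_eq_1')
  moreover have eta: "Abs_fps (fps_nth X) = X" by (simp add: fps_eq_iff)
  ultimately have "fps_of_poly p * Abs_fps x = fps_of_poly p1"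
    by (simp add: pp(1) fps_of_poly_mult x_def mult.assoc eta)
  then have T0: "toeplitz (laurent_form p m) x = (\<lambda>_. 0)"
    using less by (intro ext) (simp add: toeplitz_laurent_form coeff_eq_0 pp(2))
  obtain S where S: "ell2_inverse (toeplitz (laurent_form p m)) S"
    using inv by (auto simp: toeplitz_invertible_def)
  have lin: "ell2_linear S" using S by (auto simp: ell2_inverse_def bounded_ell2_operator_linear)
  have "x = S (\<lambda>_. 0)" using S x T0 by (metis ell2_inverse_def)
  also have "\<dots> = (\<lambda>_. 0)" using ell2_linearD(3)[OF lin ell2_zero(1) ell2_zero(1), of 0] by simp
  finally have "X = 0" by (auto simp: x_def fps_eq_iff fun_eq_iff)
  with pX show False by simp
qed

text \<open>A zero of \<open>A\<close> lies in the disc of convergence of \<open>X\<close>. Evaluation there shows that it is a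
  zero of \<open>R\<close>; cancel the linear factor on both sides and repeat.\<close>

lemma fps_dvd_poly:
  fixes A R :: "complex poly" and X :: "complex fps"
  assumes "fps_of_poly A * X = fps_of_poly R" "A \<noteq> 0" "fps_conv_radius X \<ge> 1"
    "\<And>z. poly A z = 0 \<Longrightarrow> cmod z < 1"
  shows "A dvd R"
  using assms
proof (induction "degree A" arbitrary: A R)
  case 0
  then show ?case by (metis is_unit_iff_degree unit_imp_dvd)
next
  case (Suc n)
  then obtain \<alpha> where \<alpha>: "poly A \<alpha> = 0"
    by (metis Zero_not_Suc constant_degree fundamental_theorem_of_algebra)
  then obtain A' where A': "A = [:-\<alpha>, 1:] * A'" by (metis poly_eq_0_iff_dvd dvdE)
  have A'0: "A' \<noteq> 0" using A' Suc.prems(2) by auto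
  have cr: "ereal (cmod \<alpha>) < fps_conv_radius (fps_of_poly A' * X)"
  proof -
    have "ereal (cmod \<alpha>) < 1" using Suc.prems(4)[OF \<alpha>] by simp
    also have "1 \<le> min (fps_conv_radius (fps_of_poly A')) (fps_conv_radius X)" using Suc.prems(3) by simp
    also have "\<dots> \<le> fps_conv_radius (fps_of_poly A' * X)" by (rule fps_conv_radius_mult)
    finally show ?thesis .
  qed
  have eq: "fps_of_poly [:-\<alpha>, 1:] * (fps_of_poly A' * X) = fps_of_poly R"
    using Suc.prems(1) by (simp add: A' fps_of_poly_mult mult.assoc del: mult_pCons_left)
  have "eval_fps (fps_of_poly R) \<alpha> = eval_fps (fps_of_poly [:-\<alpha>, 1:]) \<alpha> * eval_fps (fps_of_poly A' * X) \<alpha>"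
    unfolding eq[symmetric] by (rule eval_fps_mult) (use cr in auto)
  then have "poly R \<alpha> = 0" by simp
  then obtain R' where R': "R = [:-\<alpha>, 1:] * R'" by (metis poly_eq_0_iff_dvd dvdE)
  have "fps_of_poly [:-\<alpha>, 1:] * (fps_of_poly A' * X) = fps_of_poly [:-\<alpha>, 1:] * fps_of_poly R'"
    unfolding eq R' by (rule fps_of_poly_mult)
  moreover have "fps_of_poly [:-\<alpha>, 1:] \<noteq> 0" by simp
  ultimately have "fps_of_poly A' * X = fps_of_poly R'" by (metis mult_left_cancel)
  moreover have "n = degree A'" using Suc.hyps(2) A' A'0 by (simp add: degree_mult_eq del: mult_pCons_left)
  ultimately have "A' dvd R'" using Suc.hyps(1) A'0 Suc.prems(3,4) A' by auto
  then show ?case unfolding A' R' by (rule mult_dvd_mono[OF dvd_refl])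
qed

text \<open>Solve \<open>T x = e\<^sub>0\<close>. The power series \<open>p * x\<close> is then a polynomial \<open>R\<close> of degree \<open>m\<close>, and
  the factor of \<open>p\<close> that carries the zeros inside the disc divides \<open>R\<close>.\<close>

lemma toeplitz_invertible_zeros_le:
  assumes inv: "toeplitz_invertible (laurent_form p m)" and p: "p \<noteq> 0"
  shows "zeros_inside p 1 \<le> m"
proof -
  obtain p1 p2 where pp: "p = p1 * p2" "degree p1 = zeros_inside p 1" "p1 \<noteq> 0" "p2 \<noteq> 0"
    "\<And>z. poly p1 z = 0 \<Longrightarrow> cmod z < 1" "\<And>z. poly p2 z = 0 \<Longrightarrow> 1 \<le> cmod z"
    using poly_split_circle[OF p] by metis
  obtain S where S: "ell2_inverse (toeplitz (laurent_form p m)) S"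
    using inv by (auto simp: toeplitz_invertible_def)
  define e :: "nat \<Rightarrow> complex" where "e n = (if n = 0 then 1 else 0)" for n
  have e: "e \<in> ell2"
  proof (rule ell2_normI(1)[where C = 1])
    fix n
    have "L2_set (\<lambda>k. cmod (e k)) {..<n} \<le> (\<Sum>k<n. cmod (e k))" by (rule L2_set_le_sum) auto
    also have "\<dots> = (\<Sum>k<n. if k = 0 then 1 else 0)" by (rule sum.cong) (auto simp: e_def)
    also have "\<dots> \<le> 1" by simp
    finally show "L2_set (\<lambda>k. cmod (e k)) {..<n} \<le> 1" .
  qed
  define x where "x = S e"
  have x: "x \<in> ell2" and Tx: "toeplitz (laurent_form p m) x = e"
    using S e unfolding x_def ell2_inverse_def bounded_ell2_operator_def by blast+
  define Y where "Y = fps_of_poly p * Abs_fps x"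
  define R where "R = (\<Sum>i\<le>m. monom (fps_nth Y i) i)"
  have Y: "fps_nth Y (j + m) = e j" for j
    using fun_cong[OF Tx, of j] by (simp add: toeplitz_laurent_form Y_def)
  have coeffR: "coeff R i = (if i \<le> m then fps_nth Y i else 0)" for i
    by (simp add: R_def coeff_sum)
  have "fps_nth Y i = coeff R i" for i
    using Y[of "i - m"] by (auto simp: coeffR e_def)
  then have "Y = fps_of_poly R" by (simp add: fps_eq_iff)
  then have eq: "fps_of_poly p1 * (fps_of_poly p2 * Abs_fps x) = fps_of_poly R"
    by (simp add: Y_def pp(1) fps_of_poly_mult mult.assoc)
  have "conv_radius x \<ge> 1"
  proof (rule conv_radius_geI_ex')
    fix r :: real assume r: "0 < r" "ereal r < 1"
    have "summable (\<lambda>n. ell2_norm x * r ^ n)" using r by (intro summable_mult summable_geometric) auto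
    then show "summable (\<lambda>n. x n * of_real r ^ n)"
      by (rule summable_comparison_test'[where N = 0])
        (use r ell2_coeff_le[OF x] in \<open>auto simp: norm_mult norm_power intro!: mult_right_mono\<close>)
  qed
  then have "1 \<le> min (fps_conv_radius (fps_of_poly p2)) (fps_conv_radius (Abs_fps x))"
    by (simp add: fps_conv_radius_def[of "Abs_fps x"])
  then have "fps_conv_radius (fps_of_poly p2 * Abs_fps x) \<ge> 1"
    using fps_conv_radius_mult order_trans by blast
  then have "p1 dvd R" using fps_dvd_poly[OF eq pp(3)] pp(5) by blast
  moreover have "coeff R m = 1" using Y[of 0] by (simp add: coeffR e_def)
  then have "R \<noteq> 0" by auto
  moreover have "degree R \<le> m" by (rule degree_le) (simp add: coeffR)
  ultimately show ?thesis using dvd_imp_degree_le[of p1 R] pp(2) by simp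
qed

text \<open>Counting by orders of zeros, as in Rouche's theorem.\<close>

lemma zeros_inside_alt:
  assumes "p \<noteq> 0"
  shows "zeros_inside p \<rho> = (\<Sum>z | poly p z = 0 \<and> cmod z < \<rho>. order z p)"
proof -
  have "zeros_inside p \<rho> = (\<Sum>z\<in>set_mset (filter_mset (\<lambda>z. cmod z < \<rho>) (proots p)). count (filter_mset (\<lambda>z. cmod z < \<rho>) (proots p)) z)"
    unfolding zeros_inside_def by (rule size_multiset_overloaded_eq)
  also have "\<dots> = (\<Sum>z | poly p z = 0 \<and> cmod z < \<rho>. order z p)"
    using assms by (intro sum.cong) auto
  finally show ?thesis .
qed

lemma zeros_inside_mult:
  assumes "p \<noteq> 0" "q \<noteq> 0"
  shows "zeros_inside (p * q) \<rho> = zeros_inside p \<rho> + zeros_inside q \<rho>"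
  using assms by (simp add: zeros_inside_def proots_mult)

lemma zeros_inside_monom:
  assumes "0 < \<rho>"
  shows "zeros_inside (monom 1 m) \<rho> = m"
proof -
  have "monom 1 m = ([:0, 1:] :: complex poly) ^ m" by (simp add: monom_altdef)
  then have "proots (monom 1 m :: complex poly) = repeat_mset m {#0#}"
    using proots_linear_factor[of "0 :: complex"] by (simp add: proots_power)
  moreover have "size (filter_mset (\<lambda>z. cmod z < \<rho>) (replicate_mset m 0)) = m"
    using assms by (induction m) auto
  ultimately show ?thesis by (simp add: zeros_inside_def)
qed

lemma zorder_poly_eq_order:
  fixes p :: "complex poly"
  assumes "p \<noteq> 0"
  shows "zorder (poly p) z = order z p"
proof -
  obtain q where q: "p = [:-z, 1:] ^ order z p * q" "\<not> [:-z, 1:] dvd q"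
    using order_decomp[OF assms] by blast
  show ?thesis
  proof (rule zorder_eqI[of UNIV z "poly q"])
    show "poly q z \<noteq> 0" using q(2) by (simp add: poly_eq_0_iff_dvd)
    show "poly p w = poly q w * (w - z) powi int (order z p)" for w
      by (subst q(1)) (simp add: poly_power)
  qed (auto intro: holomorphic_intros)
qed

lemma zeros_inside_rouche:
  assumes \<rho>: "0 < \<rho>" and less: "\<And>t. cmod t = \<rho> \<Longrightarrow> cmod (poly p t - poly q t) < cmod (poly q t)"
  shows "zeros_inside p \<rho> = zeros_inside q \<rho>"
proof -
  have nz: "poly q t \<noteq> 0" "poly p t \<noteq> 0" if "cmod t = \<rho>" for t using less[OF that] by auto
  have p: "p \<noteq> 0" and q: "q \<noteq> 0" using nz[of "of_real \<rho>"] \<rho> by auto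
  have wn: "(\<Sum>z | poly f z = 0. winding_number (circlepath 0 \<rho>) z * of_int (zorder (poly f) z)) = of_nat (zeros_inside f \<rho>)"
    if f: "f \<noteq> 0" and nzf: "\<And>t. cmod t = \<rho> \<Longrightarrow> poly f t \<noteq> 0" for f
  proof -
    have fin: "finite {z. poly f z = 0}" using f by (rule poly_roots_finite)
    have "(\<Sum>z | poly f z = 0. winding_number (circlepath 0 \<rho>) z * of_int (zorder (poly f) z))
      = (\<Sum>z | poly f z = 0. if cmod z < \<rho> then of_nat (order z f) else 0)"
    proof (rule sum.cong[OF refl])
      fix z assume z: "z \<in> {z. poly f z = 0}"
      show "winding_number (circlepath 0 \<rho>) z * of_int (zorder (poly f) z) = (if cmod z < \<rho> then of_nat (order z f) else 0)"
      proof (cases "cmod z < \<rho>")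
        case True
        then show ?thesis using winding_number_circlepath[of z 0 \<rho>] by (simp add: zorder_poly_eq_order[OF f])
      next
        case False
        with z nzf[of z] have "\<rho> < cmod z" by force
        then have "winding_number (circlepath 0 \<rho>) z = 0"
          by (intro winding_number_zero_outside[of _ "cball 0 \<rho>"]) (use \<rho> in auto)
        then show ?thesis using False by simp
      qed
    qed
    also have "\<dots> = of_nat (zeros_inside f \<rho>)"
      using fin by (simp add: zeros_inside_alt[OF f] sum.If_cases Int_def)
    finally show ?thesis .
  qed
  have "(\<Sum>z | poly q z + poly (p - q) z = 0. winding_number (circlepath 0 \<rho>) z * of_int (zorder (\<lambda>z. poly q z + poly (p - q) z) z))
     = (\<Sum>z | poly q z = 0. winding_number (circlepath 0 \<rho>) z * of_int (zorder (poly q) z))"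
    using Rouche_theorem[of UNIV "poly q" "poly (p - q)" "circlepath 0 \<rho>"]
      poly_roots_finite[OF p] poly_roots_finite[OF q] less \<rho> connected_UNIV
    by (simp add: holomorphic_intros)
  then have "(of_nat (zeros_inside p \<rho>) :: complex) = of_nat (zeros_inside q \<rho>)"
    by (simp add: wn[OF p nz(2)] wn[OF q nz(1)])
  then show ?thesis by (simp only: of_nat_eq_iff)
qed

lemma zeros_inside_scale:
  assumes p: "p \<noteq> 0" and c: "0 < c"
  shows "zeros_inside (pcompose p [:0, of_real c:]) 1 = zeros_inside p c"
proof -
  have prod: "pcompose (\<Prod>x\<in>#M. [:-x, 1:]) [:0, of_real c:] = smult (of_real c ^ size M) (\<Prod>x\<in>#M. [:-(x / of_real c), 1:])" for M :: "complex multiset"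
  proof (induction M)
    case (add x M)
    have "complex_of_real c \<noteq> 0" using c by simp
    then have "[:-x, of_real c:] = smult (of_real c) [:-(x / of_real c), 1:]" by simp
    moreover have "pcompose [:-x, 1:] [:0, of_real c:] = [:-x, of_real c:]" by (simp add: pcompose_pCons)
    ultimately show ?case using add
      by (simp only: image_mset_add_mset prod_mset.add_mset pcompose_mult size_add_mset power_Suc
          mult_smult_left mult_smult_right smult_smult mult.commute)
  qed (simp add: pcompose_1)
  have "p = smult (lead_coeff p) (\<Prod>x\<in>#proots p. [:-x, 1:])" by (simp add: complex_poly_decompose_multiset)
  then have "pcompose p [:0, of_real c:] = smult (lead_coeff p * of_real c ^ size (proots p)) (\<Prod>x\<in>#proots p. [:-(x / of_real c), 1:])"
    by (metis pcompose_smult prod smult_smult)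
  moreover have "lead_coeff p * of_real c ^ size (proots p) \<noteq> 0" using p c by simp
  moreover have "proots (\<Prod>x\<in>#M. [:-(x / of_real c), 1:]) = image_mset (\<lambda>x. x / of_real c) M" for M
  proof (induction M)
    case (add x M)
    have "(\<Prod>x\<in>#M. [:-(x / of_real c), 1:]) \<noteq> 0" by (auto simp: prod_mset_zero_iff)
    then show ?case using add by (simp add: proots_mult del: mult_pCons_left)
  qed simp
  ultimately have "proots (pcompose p [:0, of_real c:]) = image_mset (\<lambda>x. x / of_real c) (proots p)"
    by simp
  then show ?thesis using c
    by (simp add: zeros_inside_def filter_mset_image_mset norm_divide)
qed

text \<open>Replacing \<open>p(t)\<close> by \<open>p(c t)\<close> with \<open>c\<close> near \<open>1\<close> changes the symbol little, so the two
  inequalities above give exactly \<open>m\<close> zeros inside every circle of radius near \<open>1\<close> that carries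
  no zero. Comparing radii slightly below and slightly above \<open>1\<close> leaves no room for zeros on the
  unit circle.\<close>

lemma toeplitz_invertible_laurent_form:
  assumes inv: "toeplitz_invertible (laurent_form p m)" and p: "p \<noteq> 0"
  shows "zeros_inside p 1 = m" "\<And>t. t \<in> circle \<Longrightarrow> poly p t \<noteq> 0"
proof -
  have cont: "continuous_on circle (laurent_form q k)" for q k by (intro continuous_intros) auto
  obtain \<delta> where \<delta>: "\<delta> > 0" "\<And>a'. continuous_on circle a' \<Longrightarrow> (\<And>t. t \<in> circle \<Longrightarrow> cmod (a' t - laurent_form p m t) \<le> \<delta>) \<Longrightarrow> toeplitz_invertible a'"
    using toeplitz_invertible_perturb[OF cont inv] by blast
  have "uniformly_continuous_on (cball 0 2) (poly p)"
    by (intro compact_uniformly_continuous continuous_intros) auto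
  then obtain \<eta> where \<eta>: "\<eta> > 0" "\<And>z w. z \<in> cball 0 2 \<Longrightarrow> w \<in> cball 0 2 \<Longrightarrow> dist w z < \<eta> \<Longrightarrow> dist (poly p w) (poly p z) < \<delta>"
    using \<delta>(1) unfolding uniformly_continuous_on_def by metis
  have key: "zeros_inside p c = m" if c: "0 < c" "c < 2" "\<bar>c - 1\<bar> < \<eta>" and nz: "\<And>z. poly p z = 0 \<Longrightarrow> cmod z \<noteq> c" for c
  proof -
    define q where "q = pcompose p [:0, of_real c:]"
    have q0: "q \<noteq> 0" unfolding q_def using p c(1) by (simp add: pcompose_eq_0_iff)
    have pq: "poly q t = poly p (of_real c * t)" for t by (simp add: q_def poly_pcompose mult.commute)
    have "toeplitz_invertible (laurent_form q m)"
    proof (rule \<delta>(2)[OF cont])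
      fix t assume t: "t \<in> circle"
      have "dist (of_real c * t) t = cmod (of_real (c - 1) * t)"
        by (simp add: dist_norm algebra_simps)
      then have "dist (of_real c * t) t = \<bar>c - 1\<bar>" using t by (simp add: norm_mult del: of_real_diff)
      then have "dist (poly p (of_real c * t)) (poly p t) < \<delta>"
        using t c by (intro \<eta>(2)) (auto simp: norm_mult)
      then show "cmod (laurent_form q m t - laurent_form p m t) \<le> \<delta>"
        using t by (simp add: laurent_form_def pq diff_divide_distrib[symmetric] norm_divide norm_power dist_norm)
    qed
    moreover have "poly q t \<noteq> 0" if "t \<in> circle" for t
      using nz[of "of_real c * t"] that c by (auto simp: pq norm_mult)
    ultimately have "m \<le> zeros_inside q 1" "zeros_inside q 1 \<le> m"
      using q0 toeplitz_invertible_zeros_ge toeplitz_invertible_zeros_le by blast+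
    moreover have "zeros_inside q 1 = zeros_inside p c" unfolding q_def by (rule zeros_inside_scale[OF p c(1)])
    ultimately show ?thesis by simp
  qed
  \<comment> \<open>\<open>h\<close> is so small that every zero of modulus between \<open>1 - h\<close> and \<open>1 + h\<close> lies on the unit
    circle.\<close>
  define Z where "Z = (\<lambda>z. \<bar>cmod z - 1\<bar>) ` {z. poly p z = 0 \<and> cmod z \<noteq> 1}"
  have finZ: "finite Z" unfolding Z_def using poly_roots_finite[OF p] by simp
  define h where "h = Min (insert (min 1 \<eta>) Z) / 2"
  have "0 < Min (insert (min 1 \<eta>) Z)" using finZ \<eta>(1) by (subst Min_gr_iff) (auto simp: Z_def)
  then have h0: "0 < h" by (simp add: h_def)
  have "Min (insert (min 1 \<eta>) Z) \<le> min 1 \<eta>" by (rule Min_le) (use finZ in auto)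
  then have h1: "h < 1" "h < \<eta>" using h0 by (auto simp: h_def)
  have hZ: "h < \<bar>cmod z - 1\<bar>" if "poly p z = 0" "cmod z \<noteq> 1" for z
  proof -
    have "Min (insert (min 1 \<eta>) Z) \<le> \<bar>cmod z - 1\<bar>" using finZ that by (intro Min_le) (auto simp: Z_def)
    then show ?thesis using h0 by (auto simp: h_def)
  qed
  have "cmod z \<noteq> 1 + h \<and> cmod z \<noteq> 1 - h" if "poly p z = 0" for z
    using hZ[OF that] h0 by fastforce
  then have eq: "zeros_inside p (1 + h) = m" "zeros_inside p (1 - h) = m"
    using h0 h1 by (auto intro!: key)
  have "{z. poly p z = 0 \<and> cmod z < 1 - h} = {z. poly p z = 0 \<and> cmod z < 1}"
    using hZ h0 by force
  then show "zeros_inside p 1 = m" using eq(2) by (simp add: zeros_inside_alt[OF p])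
  fix t assume t: "t \<in> circle"
  show "poly p t \<noteq> 0"
  proof
    assume pt: "poly p t = 0"
    have fin: "finite {z. poly p z = 0}" using poly_roots_finite[OF p] .
    have "zeros_inside p (1 - h) < zeros_inside p (1 + h)"
      unfolding zeros_inside_alt[OF p]
    proof (rule sum_strict_mono2)
      show "finite {z. poly p z = 0 \<and> cmod z < 1 + h}" using fin by simp
      show "{z. poly p z = 0 \<and> cmod z < 1 - h} \<subseteq> {z. poly p z = 0 \<and> cmod z < 1 + h}" using h0 by auto
      show "t \<in> {z. poly p z = 0 \<and> cmod z < 1 + h} - {z. poly p z = 0 \<and> cmod z < 1 - h}" using pt t h0 by auto
      show "0 < order t p" using pt p by (simp add: order_root[of p t])
    qed auto
    with eq show False by simp
  qed
qed

definition is_laurent_on_circle :: "(complex \<Rightarrow> complex) \<Rightarrow> bool" where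
  "is_laurent_on_circle a \<longleftrightarrow> (\<exists>p m. \<forall>t\<in>circle. a t = laurent_form p m t)"

lemma is_laurentI: "(\<And>t. t \<in> circle \<Longrightarrow> a t = laurent_form p m t) \<Longrightarrow> is_laurent_on_circle a"
  by (auto simp: is_laurent_on_circle_def)

lemma is_laurent_const: "is_laurent_on_circle (\<lambda>t. c)"
  by (rule is_laurentI[of _ "[:c:]" 0]) (simp add: laurent_form_def)

lemma is_laurent_mult:
  assumes "is_laurent_on_circle a" "is_laurent_on_circle b"
  shows "is_laurent_on_circle (\<lambda>t. a t * b t)"
proof -
  obtain p m q n where "\<forall>t\<in>circle. a t = laurent_form p m t" "\<forall>t\<in>circle. b t = laurent_form q n t"
    using assms unfolding is_laurent_on_circle_def by blast
  then show ?thesis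
    by (intro is_laurentI[of _ "p * q" "m + n"]) (simp add: laurent_form_def power_add)
qed

lemma is_laurent_add:
  assumes "is_laurent_on_circle a" "is_laurent_on_circle b"
  shows "is_laurent_on_circle (\<lambda>t. a t + b t)"
proof -
  obtain p m q n where "\<forall>t\<in>circle. a t = laurent_form p m t" "\<forall>t\<in>circle. b t = laurent_form q n t"
    using assms unfolding is_laurent_on_circle_def by blast
  moreover have "t \<noteq> 0" if "t \<in> circle" for t using that by auto
  ultimately show ?thesis
    by (intro is_laurentI[of _ "p * monom 1 n + q * monom 1 m" "m + n"])
      (simp add: laurent_form_def power_add poly_monom add_frac_eq mult_ac)
qed

text \<open>On the circle, \<open>Re t = (t + 1 / t) / 2\<close>.\<close>

lemma is_laurent_Re: "is_laurent_on_circle (\<lambda>t. of_real (Re t))"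
proof (rule is_laurentI[of _ "[:1/2, 0, 1/2:]" 1])
  fix t assume t: "t \<in> circle"
  then have "t * cnj t = 1" by (simp add: complex_norm_square[symmetric])
  then have "t * (t + cnj t) = t * t + 1" by (simp add: distrib_left)
  moreover have "t + cnj t = 2 * of_real (Re t)" by (simp add: complex_add_cnj)
  moreover have "t \<noteq> 0" using t by auto
  ultimately show "of_real (Re t) = laurent_form [:1/2, 0, 1/2:] 1 t"
    by (simp add: laurent_form_def field_simps)
qed

lemma is_laurent_real_polynomial:
  assumes "real_polynomial_function f"
  shows "is_laurent_on_circle (\<lambda>t. of_real (f t))"
  using assms
proof induction
  case (linear f)
  have "f t = f 1 * Re t + f \<i> * Im t" for t
  proof -
    have "t = Re t *\<^sub>R 1 + Im t *\<^sub>R \<i>" by (simp add: complex_eq_iff)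
    then have "f t = f (Re t *\<^sub>R 1 + Im t *\<^sub>R \<i>)" by simp
    also have "\<dots> = Re t *\<^sub>R f 1 + Im t *\<^sub>R f \<i>"
      using linear by (simp add: bounded_linear.linear linear_add linear_cmul)
    finally show ?thesis by simp
  qed
  moreover have "is_laurent_on_circle (\<lambda>t. of_real (Im t))"
  proof -
    have "of_real (Im t) = (t + (-1) * of_real (Re t)) * (- \<i>)" for t
      by (simp add: complex_eq_iff)
    moreover have "is_laurent_on_circle (\<lambda>t. t)"
      by (rule is_laurentI[of _ "[:0, 1:]" 0]) (simp add: laurent_form_def)
    then have "is_laurent_on_circle (\<lambda>t. (t + (-1) * of_real (Re t)) * (- \<i>))"
      by (intro is_laurent_mult is_laurent_add is_laurent_const is_laurent_Re)
    ultimately show ?thesis by simp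
  qed
  then have "is_laurent_on_circle (\<lambda>t. of_real (f 1) * of_real (Re t) + of_real (f \<i>) * of_real (Im t))"
    by (intro is_laurent_mult is_laurent_add is_laurent_const is_laurent_Re)
  ultimately show ?case by (metis (mono_tags, lifting) of_real_add of_real_mult is_laurent_on_circle_def)
qed (use is_laurent_const is_laurent_add is_laurent_mult in auto)

text \<open>On the circle, polynomials in \<open>Re t\<close> and \<open>Im t\<close> are Laurent polynomials, so the theorem of
  Stone and Weierstrass applies to real and imaginary parts.\<close>

lemma laurent_approximation:
  assumes a: "continuous_on circle a" and e: "0 < e"
  obtains p m where "\<And>t. t \<in> circle \<Longrightarrow> cmod (laurent_form p m t - a t) < e"
proof -
  have c: "compact circle" by simp
  obtain f where f: "real_polynomial_function f" "\<And>t. t \<in> circle \<Longrightarrow> \<bar>Re (a t) - f t\<bar> < e / 2"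
    using Stone_Weierstrass_real_polynomial_function[OF c, of "\<lambda>t. Re (a t)" "e / 2"] a e
    by (auto intro: continuous_intros)
  obtain g where g: "real_polynomial_function g" "\<And>t. t \<in> circle \<Longrightarrow> \<bar>Im (a t) - g t\<bar> < e / 2"
    using Stone_Weierstrass_real_polynomial_function[OF c, of "\<lambda>t. Im (a t)" "e / 2"] a e
    by (auto intro: continuous_intros)
  have "is_laurent_on_circle (\<lambda>t. of_real (f t) + \<i> * of_real (g t))"
    by (intro is_laurent_add is_laurent_mult is_laurent_const is_laurent_real_polynomial f g)
  then obtain p m where pm: "\<forall>t\<in>circle. of_real (f t) + \<i> * of_real (g t) = laurent_form p m t"
    unfolding is_laurent_on_circle_def by blast
  show ?thesis
  proof (rule that[of p m])
    fix t assume t: "t \<in> circle"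
    have "cmod (laurent_form p m t - a t) \<le> \<bar>Re (laurent_form p m t - a t)\<bar> + \<bar>Im (laurent_form p m t - a t)\<bar>"
      by (rule cmod_le)
    also have "\<dots> = \<bar>f t - Re (a t)\<bar> + \<bar>g t - Im (a t)\<bar>"
      using bspec[OF pm t, symmetric] by simp
    finally show "cmod (laurent_form p m t - a t) < e" using f(2)[OF t] g(2)[OF t] by linarith
  qed
qed

text \<open>This replaces the index formula. A Laurent polynomial \<open>p(t)/t\<^sup>k\<close> close to \<open>a\<close> still has an
  invertible operator, so \<open>p\<close> has \<open>k\<close> zeros in the disc, and Rouche's theorem compares \<open>t\<^sup>m p\<close>
  with \<open>t\<^sup>k q\<close>. At a zero of \<open>q\<close> on the circle \<open>a\<close> would vanish too, and so would a suitable
  invertible Laurent polynomial near \<open>a\<close>, which is impossible.\<close>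

theorem toeplitz_invertible_count:
  assumes a: "continuous_on circle a" and inv: "toeplitz_invertible a"
    and near: "\<And>t. t \<in> circle \<Longrightarrow> cmod (a t - laurent_form q m t) \<le> cmod (laurent_form q m t) / 2"
  shows "zeros_inside q 1 = m" "\<And>t. t \<in> circle \<Longrightarrow> poly q t \<noteq> 0"
proof -
  have t0: "t \<noteq> 0" if "t \<in> circle" for t using that by auto
  have cont: "continuous_on circle (laurent_form q k)" for q k by (intro continuous_intros) auto
  obtain \<delta> where \<delta>: "\<delta> > 0" "\<And>a'. continuous_on circle a' \<Longrightarrow> (\<And>t. t \<in> circle \<Longrightarrow> cmod (a' t - a t) \<le> \<delta>) \<Longrightarrow> toeplitz_invertible a'"
    using toeplitz_invertible_perturb[OF a inv] by blast
  show nz: "poly q t \<noteq> 0" if t: "t \<in> circle" for t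
  proof
    assume "poly q t = 0"
    then have at: "a t = 0" using near[OF t] by (simp add: laurent_form_def)
    obtain p k where pk: "\<And>t. t \<in> circle \<Longrightarrow> cmod (laurent_form p k t - a t) < \<delta> / 3"
      using laurent_approximation[OF a, of "\<delta> / 3"] \<delta>(1) by auto
    \<comment> \<open>subtract a small constant from the approximation to make it vanish at \<open>t\<close>\<close>
    define p' where "p' = p - smult (laurent_form p k t) (monom 1 k)"
    have p': "laurent_form p' k u = laurent_form p k u - laurent_form p k t" if "u \<in> circle" for u
      using t0[OF that] by (simp add: p'_def laurent_form_def poly_monom diff_divide_distrib)
    have inv': "toeplitz_invertible (laurent_form p' k)"
    proof (rule \<delta>(2)[OF cont])
      fix u assume u: "u \<in> circle"
      have "laurent_form p' k u - a u = (laurent_form p k u - a u) - (laurent_form p k t - a t)"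
        using p'[OF u] at by simp
      also have "cmod \<dots> \<le> cmod (laurent_form p k u - a u) + cmod (laurent_form p k t - a t)"
        by (rule norm_triangle_ineq4)
      finally show "cmod (laurent_form p' k u - a u) \<le> \<delta>"
        using pk[OF u] pk[OF t] \<delta>(1) by linarith
    qed
    have pt: "poly p' t = 0" using p'[OF t] t0[OF t] by (simp add: laurent_form_def)
    show False
    proof (cases "p' = 0")
      case False
      then show False using toeplitz_invertible_laurent_form(2)[OF inv' _ t] pt by simp
    next
      case True
      \<comment> \<open>The approximation is constant, so \<open>a\<close> itself is small, and a small multiple of \<open>u - t\<close>
        is an approximation that vanishes at \<open>u = t\<close> without being zero.\<close>
      have "toeplitz_invertible (laurent_form [:- t * (\<delta>/3/2), \<delta>/3/2:] 0)"
      proof (rule \<delta>(2)[OF cont])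
        fix u assume u: "u \<in> circle"
        have "cmod (a u) \<le> cmod (laurent_form p k u - a u) + cmod (laurent_form p k t)"
          using p'[OF u] True norm_triangle_ineq4[of "laurent_form p k u" "laurent_form p k u - a u"]
          by (simp add: laurent_form_def)
        then have "cmod (a u) \<le> 2 * \<delta> / 3" using pk[OF u] pk[OF t] at by simp
        moreover have "cmod (laurent_form [:- t * (\<delta>/3/2), \<delta>/3/2:] 0 u) \<le> \<delta> / 3"
        proof -
          have "laurent_form [:- t * (\<delta>/3/2), \<delta>/3/2:] 0 u = of_real (\<delta>/3/2) * (u - t)"
            by (simp add: laurent_form_def algebra_simps)
          moreover have "cmod (u - t) \<le> 2" using norm_triangle_ineq4[of u t] u t by simp
          ultimately show ?thesis using \<delta>(1) by (simp add: norm_mult del: of_real_divide)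
        qed
        ultimately show "cmod (laurent_form [:- t * (\<delta>/3/2), \<delta>/3/2:] 0 u - a u) \<le> \<delta>"
          using norm_triangle_ineq4[of "laurent_form [:- t * (\<delta>/3/2), \<delta>/3/2:] 0 u" "a u"] by simp
      qed
      from toeplitz_invertible_laurent_form(2)[OF this _ t] \<delta>(1) show False by simp
    qed
  qed
  have ne: "circle \<noteq> {}" by (auto intro!: exI[of _ 1])
  obtain t1 where t1: "t1 \<in> circle" "\<And>t. t \<in> circle \<Longrightarrow> cmod (laurent_form q m t1) \<le> cmod (laurent_form q m t)"
    using continuous_attains_inf[OF _ ne continuous_on_norm[OF cont], of q m] by auto
  define c where "c = cmod (laurent_form q m t1)"
  have c: "0 < c" using nz[OF t1(1)] t0[OF t1(1)] by (simp add: c_def laurent_form_def)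
  obtain p k where pk: "\<And>t. t \<in> circle \<Longrightarrow> cmod (laurent_form p k t - a t) < min \<delta> (c / 2)"
    using laurent_approximation[OF a, of "min \<delta> (c / 2)"] \<delta>(1) c by auto
  have inv': "toeplitz_invertible (laurent_form p k)" by (rule \<delta>(2)[OF cont]) (use pk in force)
  have less: "cmod (laurent_form p k t - laurent_form q m t) < cmod (laurent_form q m t)" if t: "t \<in> circle" for t
  proof -
    have "cmod (laurent_form p k t - laurent_form q m t) \<le> cmod (laurent_form p k t - a t) + cmod (a t - laurent_form q m t)"
      by (rule norm_triangle_sub[of "laurent_form p k t - laurent_form q m t" "laurent_form p k t - a t", simplified, THEN order_trans]) simp
    also have "\<dots> < c / 2 + cmod (laurent_form q m t) / 2" using pk[OF t] near[OF t] by simp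
    also have "\<dots> \<le> cmod (laurent_form q m t)" using t1(2)[OF t] by (simp add: c_def)
    finally show ?thesis .
  qed
  have p0: "p \<noteq> 0" using less[OF t1(1)] by (auto simp: laurent_form_def)
  have q0: "q \<noteq> 0" using nz[OF t1(1)] by auto
  have "zeros_inside (monom 1 m * p) 1 = zeros_inside (monom 1 k * q) 1"
  proof (rule zeros_inside_rouche)
    fix t :: complex assume "cmod t = 1"
    then have t: "t \<in> circle" by simp
    have eq: "t ^ m * poly p t = t ^ (m + k) * laurent_form p k t" "t ^ k * poly q t = t ^ (m + k) * laurent_form q m t"
      using t0[OF t] by (auto simp: laurent_form_def power_add)
    have "cmod (t ^ (m + k) * (laurent_form p k t - laurent_form q m t)) < cmod (t ^ (m + k) * laurent_form q m t)"
      using less[OF t] t by (simp add: norm_mult norm_power)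
    then show "cmod (poly (monom 1 m * p) t - poly (monom 1 k * q) t) < cmod (poly (monom 1 k * q) t)"
      by (simp add: poly_monom eq right_diff_distrib)
  qed simp
  then have "m + zeros_inside p 1 = k + zeros_inside q 1"
    using p0 q0 by (simp add: zeros_inside_mult zeros_inside_monom)
  moreover have "zeros_inside p 1 = k" by (rule toeplitz_invertible_laurent_form(1)[OF inv' p0])
  ultimately show "zeros_inside q 1 = m" by simp
qed

section \<open>The error of polygon discretization\<close>

lemma real_path_lipschitz:
  fixes h :: "real \<Rightarrow> complex"
  assumes "\<And>u. u \<in> {x..y} \<Longrightarrow> (h has_vector_derivative h' u) (at u within {x..y})"
    "\<And>u. u \<in> {x..y} \<Longrightarrow> cmod (h' u) \<le> B" "p \<in> {x..y}" "q \<in> {x..y}"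
  shows "cmod (h p - h q) \<le> B * \<bar>p - q\<bar>"
proof -
  have "norm (h p - h q) \<le> B * norm (p - q)"
  proof (rule differentiable_bound[of "{x..y}" h "\<lambda>u t. t *\<^sub>R h' u"])
    show "(h has_derivative (\<lambda>t. t *\<^sub>R h' u)) (at u within {x..y})" if "u \<in> {x..y}" for u
      using assms(1)[OF that] by (simp add: has_vector_derivative_def)
    show "onorm (\<lambda>t. t *\<^sub>R h' u) \<le> B" if "u \<in> {x..y}" for u
      using assms(2)[OF that] by (intro onorm_le) (simp add: mult.commute[of B] mult_left_mono)
  qed (use assms in auto)
  then show ?thesis by simp
qed

text \<open>With \<open>m\<close> the slope of the chord, \<open>E' = m - g'\<close>. The slope is the mean of \<open>g'\<close> over the
  interval, so \<open>E'\<close> is bounded by the oscillation of \<open>g'\<close> on an interval of length \<open>\<Delta>\<close>.\<close>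

lemma interpolation_error_lipschitz:
  fixes g :: "real \<Rightarrow> complex"
  assumes g: "\<And>u. (g has_vector_derivative g' u) (at u)"
    and K: "\<And>u w. cmod (g' u - g' w) \<le> K * \<bar>u - w\<bar>" "0 \<le> K"
    and xy: "x < y" "y - x \<le> \<Delta>"
    and E: "\<And>v. E v = of_real ((v - x) / (y - x)) * (g y - g x) + g x - g v"
    and p: "p \<in> {x..y}" and q: "q \<in> {x..y}"
  shows "cmod (E p - E q) \<le> K * \<Delta> * \<bar>p - q\<bar>" "E x = 0" "E y = 0"
proof -
  define m where "m = (g y - g x) / of_real (y - x)"
  have E': "E = (\<lambda>v. (v - x) *\<^sub>R m + g x - g v)"
    by (intro ext) (simp add: E m_def scaleR_conv_of_real)
  have dE: "(E has_vector_derivative (m - g' u)) (at u within {x..y})" for u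
    unfolding E' by (auto intro!: derivative_eq_intros has_vector_derivative_at_within[OF g])
  have bnd: "cmod (m - g' u) \<le> K * \<Delta>" if u: "u \<in> {x..y}" for u
  proof -
    have "cmod ((g y - y *\<^sub>R g' u) - (g x - x *\<^sub>R g' u)) \<le> (K * \<Delta>) * \<bar>y - x\<bar>"
    proof (rule real_path_lipschitz[where h' = "\<lambda>w. g' w - g' u" and x = x and y = y])
      fix w assume w: "w \<in> {x..y}"
      show "((\<lambda>w. g w - w *\<^sub>R g' u) has_vector_derivative g' w - g' u) (at w within {x..y})"
        by (auto intro!: derivative_eq_intros has_vector_derivative_at_within[OF g])
      have "K * \<bar>w - u\<bar> \<le> K * \<Delta>" using u w xy K(2) by (intro mult_left_mono) auto
      then show "cmod (g' w - g' u) \<le> K * \<Delta>" using K(1)[of w u] by linarith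
    qed (use xy in auto)
    also have "(g y - y *\<^sub>R g' u) - (g x - x *\<^sub>R g' u) = of_real (y - x) * (m - g' u)"
    proof -
      have "of_real (y - x) * m = g y - g x" using xy by (simp add: m_def)
      then show ?thesis by (simp add: right_diff_distrib scaleR_conv_of_real) (simp add: algebra_simps)
    qed
    finally show ?thesis using xy by (simp add: norm_mult mult.commute del: of_real_diff)
  qed
  show "cmod (E p - E q) \<le> K * \<Delta> * \<bar>p - q\<bar>"
    by (rule real_path_lipschitz[OF dE bnd p q])
  show "E x = 0" "E y = 0" using xy by (auto simp: E)
qed

lemma partition_ends:
  assumes "xs \<in> partitions \<alpha> \<beta> \<Delta>"
  shows "xs \<noteq> []" "xs ! 0 = \<alpha>" "xs ! (length xs - 1) = \<beta>"
  using assms by (auto simp: partitions_def hd_conv_nth last_conv_nth)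

lemma partition_less:
  assumes "xs \<in> partitions \<alpha> \<beta> \<Delta>" "i < k" "k < length xs"
  shows "xs ! i < xs ! k"
  using assms by (auto simp: partitions_def sorted_wrt_iff_nth_less)

lemma finite_gaps: "finite {xs ! Suc j - xs ! j | j. Suc j < length xs}" for xs :: "real list"
  by (rule finite_subset[of _ "(\<lambda>j. xs ! Suc j - xs ! j) ` {..<length xs}"]) auto

text \<open>The last conjunct evaluates the description that selects the edge in the definition of a
  polygon.\<close>

lemma partition_interval:
  assumes vs: "vs \<in> partitions \<alpha> \<beta> \<Delta>" and v: "\<alpha> \<le> v" "v < \<beta>"
  obtains j where "Suc j < length vs" "vs ! j \<le> v" "v < vs ! Suc j"
    "(THE j. Suc j < length vs \<and> vs ! j \<le> v \<and> v < vs ! Suc j) = j"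
proof -
  note ne = partition_ends(1)[OF vs] and hd = partition_ends(2)[OF vs] and last = partition_ends(3)[OF vs]
    and mono = partition_less[OF vs]
  define j where "j = Max {i. i < length vs \<and> vs ! i \<le> v}"
  have fin: "finite {i. i < length vs \<and> vs ! i \<le> v}" and ex: "0 \<in> {i. i < length vs \<and> vs ! i \<le> v}"
    using ne hd v by auto
  have j: "j < length vs" "vs ! j \<le> v" using Max_in[OF fin] ex unfolding j_def by blast+
  have jmax: "i \<le> j" if "i < length vs" "vs ! i \<le> v" for i
    unfolding j_def using that fin by (intro Max_ge) auto
  have Sj: "Suc j < length vs"
  proof (rule ccontr)
    assume "\<not> Suc j < length vs"
    then have "j = length vs - 1" using j(1) by linarith
    then show False using j(2) last v by simp
  qed
  have less: "v < vs ! Suc j" using jmax[of "Suc j"] Sj by force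
  have "i = j" if "Suc i < length vs" "vs ! i \<le> v" "v < vs ! Suc i" for i
  proof (rule antisym)
    show "i \<le> j" using jmax that by simp
    show "j \<le> i"
    proof (rule ccontr)
      assume "\<not> j \<le> i"
      then have "vs ! Suc i \<le> vs ! j" using mono[of "Suc i" j] j(1) by (cases "Suc i = j") auto
      then show False using that(3) j(2) by linarith
    qed
  qed
  then have "(THE j. Suc j < length vs \<and> vs ! j \<le> v \<and> v < vs ! Suc j) = j"
    using Sj j(2) less by blast
  with that Sj j(2) less show ?thesis by blast
qed

lemma partition_gap:
  assumes "vs \<in> partitions \<alpha> \<beta> \<Delta>" "Suc j < length vs"
  shows "vs ! Suc j - vs ! j \<le> \<Delta>" "vs ! j < vs ! Suc j" "\<alpha> \<le> vs ! j" "vs ! Suc j \<le> \<beta>"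
proof -
  have "vs ! Suc j - vs ! j \<le> granularity vs"
    unfolding granularity_def using assms(2) by (intro Max_ge) (auto simp: finite_gaps)
  then show "vs ! Suc j - vs ! j \<le> \<Delta>" using assms(1) by (simp add: partitions_def)
  note hd = partition_ends(2)[OF assms(1)] and last = partition_ends(3)[OF assms(1)] and mono = partition_less[OF assms(1)]
  show "vs ! j < vs ! Suc j" using mono assms(2) by simp
  show "\<alpha> \<le> vs ! j" using mono[of 0 j] assms(2) hd by (cases j) auto
  show "vs ! Suc j \<le> \<beta>" using mono[of "Suc j" "length vs - 1"] assms(2) last
    by (cases "Suc j = length vs - 1") (auto intro: less_imp_le)
qed

lemma partitions_nonneg: "xs \<in> partitions \<alpha> \<beta> \<Delta> \<Longrightarrow> 0 \<le> \<Delta>"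
proof -
  assume "xs \<in> partitions \<alpha> \<beta> \<Delta>"
  moreover have "0 \<le> granularity xs" unfolding granularity_def using finite_gaps[of xs] by (intro Max_ge) auto
  ultimately show "0 \<le> \<Delta>" by (simp add: partitions_def)
qed

lemma partitions_mono: "\<Delta> \<le> \<Delta>' \<Longrightarrow> partitions \<alpha> \<beta> \<Delta> \<subseteq> partitions \<alpha> \<beta> \<Delta>'"
  by (auto simp: partitions_def)

lemma partition_near:
  assumes xs: "xs \<in> partitions \<alpha> \<beta> \<Delta>" and x: "\<alpha> \<le> x" "x \<le> \<beta>" and \<Delta>: "0 \<le> \<Delta>"
  obtains y where "y \<in> set xs" "\<bar>x - y\<bar> \<le> \<Delta>"
proof (cases "x < \<beta>")
  case True
  obtain j where j: "Suc j < length xs" "xs ! j \<le> x" "x < xs ! Suc j"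
    using partition_interval[OF xs x(1) True] by metis
  show ?thesis using that[of "xs ! j"] j partition_gap(1)[OF xs j(1)] by auto
next
  case False
  then have "x = last xs" "xs \<noteq> []" using x xs by (auto simp: partitions_def)
  then show ?thesis using that[of x] \<Delta> by simp
qed

lemma partition_subset:
  assumes "xs \<in> partitions \<alpha> \<beta> \<Delta>"
  shows "set xs \<subseteq> {\<alpha>..\<beta>}"
proof
  fix x assume "x \<in> set xs"
  then obtain i where i: "i < length xs" "x = xs ! i" by (auto simp: in_set_conv_nth)
  note hd = partition_ends(2)[OF assms] and last = partition_ends(3)[OF assms] and mono = partition_less[OF assms]
  have "\<alpha> \<le> xs ! i" using mono[of 0 i] i hd by (cases i) auto
  moreover have "xs ! i \<le> \<beta>" using mono[of i "length xs - 1"] i last by (cases "i = length xs - 1") (auto intro: less_imp_le)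
  ultimately show "x \<in> {\<alpha>..\<beta>}" using i by simp
qed

lemma sin_ge_half:
  assumes "0 \<le> x" "x \<le> pi / 2"
  shows "x / 2 \<le> sin x"
proof (cases "x \<le> pi / 3")
  case True
  have "sin 0 - 0 / 2 \<le> sin x - x / 2"
  proof (rule DERIV_nonneg_imp_nondecreasing[OF assms(1)])
    fix u assume u: "0 \<le> u" "u \<le> x"
    have "cos (pi / 3) \<le> cos u" using u True pi_gt_zero by (intro cos_monotone_0_pi_le) auto
    then have "0 \<le> cos u - 1 / 2" by (simp add: cos_60)
    moreover have "((\<lambda>x. sin x - x / 2) has_real_derivative cos u - 1 / 2) (at u)"
      by (auto intro!: derivative_eq_intros)
    ultimately show "\<exists>y. ((\<lambda>x. sin x - x / 2) has_real_derivative y) (at u) \<and> 0 \<le> y" by blast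
  qed
  then show ?thesis by simp
next
  case False
  have "sin (pi / 3) \<le> sin x" using False assms by (intro sin_monotone_2pi_le) auto
  moreover have "1.7 \<le> sqrt 3" by (rule real_le_rsqrt) (simp add: power2_eq_square)
  moreover have "pi < 3.2" using pi_approx by simp
  ultimately show ?thesis using assms by (simp add: sin_60)
qed

text \<open>Turns Lipschitz bounds in the angle into Lipschitz bounds in the point. The minimum is the
  length of the shorter arc.\<close>

lemma arc_le_chord:
  assumes "0 \<le> d" "d \<le> 2 * pi"
  shows "min d (2 * pi - d) \<le> 2 * cmod (cis (v + d) - cis v)"
proof -
  have "(cmod (cis (v + d) - cis v))\<^sup>2 = (cmod (cis d - 1))\<^sup>2"
  proof -
    have "cis (v + d) - cis v = cis v * (cis d - 1)" by (simp add: cis_mult right_diff_distrib)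
    then show ?thesis by (simp add: norm_mult)
  qed
  also have "\<dots> = (cos d - 1)\<^sup>2 + (sin d)\<^sup>2" by (simp add: cmod_power2)
  also have "\<dots> = 2 - 2 * cos d" using sin_cos_squared_add[of d] by (simp add: power2_diff)
  also have "\<dots> = (2 * sin (d / 2))\<^sup>2"
    using cos_double_sin[of "d / 2"] by (simp add: power_mult_distrib)
  finally have "cmod (cis (v + d) - cis v) = \<bar>2 * sin (d / 2)\<bar>"
    by (metis abs_norm_cancel real_sqrt_abs)
  moreover have "min d (2 * pi - d) \<le> 4 * sin (d / 2)"
  proof (cases "d \<le> pi")
    case True
    then show ?thesis using sin_ge_half[of "d / 2"] assms by simp
  next
    case False
    have "(2 * pi - d) / 2 / 2 \<le> sin ((2 * pi - d) / 2)" using False assms by (intro sin_ge_half) auto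
    also have "(2 * pi - d) / 2 = pi - d / 2" by simp
    finally show ?thesis by simp
  qed
  ultimately show ?thesis by simp
qed

lemma cis_Arg2pi_circle:
  assumes "t \<in> circle"
  shows "cis (Arg2pi t) = t"
proof -
  have "t = of_real (cmod t) * exp (\<i> * of_real (Arg2pi t))"
    using Arg2pi[of t] unfolding is_Arg_def by blast
  moreover have "cmod t = 1" using assms by simp
  ultimately show ?thesis by (metis cis_conv_exp mult_1 of_real_1)
qed

text \<open>Interpolation errors are Lipschitz in the angle on each edge and vanish at the nodes, so
  they can be estimated through the nodes between two points. The path may run directly from one
  angle to the other or through the angle \<open>0\<close>, which is a node as well; the shorter of the two
  gives the bound.\<close>

lemma polygon_error_lipschitz:
  assumes g: "\<And>u. ((\<lambda>v. a (cis v)) has_vector_derivative g' u) (at u)"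
    and K: "\<And>u w. cmod (g' u - g' w) \<le> K * \<bar>u - w\<bar>" "0 \<le> K"
    and vs: "vs \<in> partitions 0 (2*pi) \<Delta>" and \<Delta>: "0 \<le> \<Delta>"
    and t: "t \<in> circle" "t' \<in> circle"
  shows "cmod ((polygon vs a t - a t) - (polygon vs a t' - a t')) \<le> 2 * K * \<Delta> * cmod (t - t')"
    "cmod (polygon vs a t - a t) \<le> 2 * pi * K * \<Delta>"
proof -
  define e where "e t = polygon vs a t - a t" for t
  define E where "E j v = of_real ((v - vs ! j) / (vs ! Suc j - vs ! j)) * (a (cis (vs ! Suc j)) - a (cis (vs ! j))) + a (cis (vs ! j)) - a (cis v)" for j v
  have piece: "\<exists>j. Suc j < length vs \<and> vs ! j \<le> Arg2pi t \<and> Arg2pi t < vs ! Suc j \<and> e t = E j (Arg2pi t)" if t: "t \<in> circle" for t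
  proof -
    have c: "cis (Arg2pi t) = t" by (rule cis_Arg2pi_circle[OF t])
    obtain j where j: "Suc j < length vs" "vs ! j \<le> Arg2pi t" "Arg2pi t < vs ! Suc j"
      "(THE j. Suc j < length vs \<and> vs ! j \<le> Arg2pi t \<and> Arg2pi t < vs ! Suc j) = j"
      using partition_interval[OF vs Arg2pi_ge_0[of t] Arg2pi_lt_2pi[of t]] by blast
    have "e t = E j (Arg2pi t)" unfolding e_def E_def polygon_def Let_def j(4) c by (rule refl)
    with j(1-3) show ?thesis by blast
  qed
  have Elip: "cmod (E j p - E j q) \<le> K * \<Delta> * \<bar>p - q\<bar>" "E j (vs ! j) = 0" "E j (vs ! Suc j) = 0"
    if "Suc j < length vs" "p \<in> {vs ! j..vs ! Suc j}" "q \<in> {vs ! j..vs ! Suc j}" for j p q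
    by (rule interpolation_error_lipschitz[where g = "\<lambda>v. a (cis v)" and g' = g' and E = "E j",
        OF g K partition_gap(2)[OF vs that(1)] partition_gap(1)[OF vs that(1)] E_def that(2,3)])+
  have one: "cmod (e t) \<le> K * \<Delta> * (Arg2pi t - vs ! j)" "cmod (e t) \<le> K * \<Delta> * (vs ! Suc j - Arg2pi t)"
    if j: "Suc j < length vs" "vs ! j \<le> Arg2pi t" "Arg2pi t < vs ! Suc j" "e t = E j (Arg2pi t)" for t j
    using Elip[of j "Arg2pi t" "vs ! j"] Elip[of j "Arg2pi t" "vs ! Suc j"] j by auto
  have K\<Delta>: "0 \<le> K * \<Delta>" using K \<Delta> by simp
  have main: "cmod (e t - e t') \<le> 2 * (K * \<Delta>) * cmod (t - t')"
    if t: "t \<in> circle" "t' \<in> circle" and le: "Arg2pi t \<le> Arg2pi t'" for t t'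
  proof -
    define v v' where "v = Arg2pi t" and "v' = Arg2pi t'"
    have c: "cis v = t" "cis v' = t'" unfolding v_def v'_def by (rule cis_Arg2pi_circle[OF t(1)], rule cis_Arg2pi_circle[OF t(2)])
    obtain j where j: "Suc j < length vs" "vs ! j \<le> v" "v < vs ! Suc j" "e t = E j v"
      using piece[OF t(1)] unfolding v_def by blast
    obtain k where k: "Suc k < length vs" "vs ! k \<le> v'" "v' < vs ! Suc k" "e t' = E k v'"
      using piece[OF t(2)] unfolding v'_def by blast
    note oj = one[OF j[unfolded v_def], folded v_def] and ok = one[OF k[unfolded v'_def], folded v'_def]
    have short: "cmod (e t - e t') \<le> K * \<Delta> * (v' - v)"
    proof (cases "k \<le> j")
      case True
      have "k = j"
      proof (rule ccontr)
        assume "k \<noteq> j"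
        then have "vs ! Suc k \<le> vs ! j" using True vs j(1)
          by (cases "Suc k = j") (auto simp: partitions_def sorted_wrt_iff_nth_less less_imp_le)
        then show False using k(3) j(2) le by (simp add: v_def v'_def)
      qed
      then show ?thesis using Elip(1)[of j v v'] j k le by (simp add: v_def v'_def abs_minus_commute)
    next
      case False
      then have "vs ! Suc j \<le> vs ! k" using vs k(1)
        by (cases "Suc j = k") (auto simp: partitions_def sorted_wrt_iff_nth_less less_imp_le)
      have "cmod (e t - e t') \<le> K * \<Delta> * (vs ! Suc j - v) + K * \<Delta> * (v' - vs ! k)"
        using norm_triangle_ineq4[of "e t" "e t'"] oj(2) ok(1) by linarith
      also have "\<dots> = K * \<Delta> * ((vs ! Suc j - v) + (v' - vs ! k))" by (simp add: distrib_left)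
      also have "\<dots> \<le> K * \<Delta> * (v' - v)" using \<open>vs ! Suc j \<le> vs ! k\<close> K\<Delta> by (intro mult_left_mono) auto
      finally show ?thesis .
    qed
    have long: "cmod (e t - e t') \<le> K * \<Delta> * (2 * pi - (v' - v))"
    proof -
      have "cmod (e t - e t') \<le> K * \<Delta> * (v - vs ! j) + K * \<Delta> * (vs ! Suc k - v')"
        using norm_triangle_ineq4[of "e t" "e t'"] oj(1) ok(2) by linarith
      also have "\<dots> = K * \<Delta> * ((v - vs ! j) + (vs ! Suc k - v'))" by (simp add: distrib_left)
      also have "\<dots> \<le> K * \<Delta> * (2 * pi - (v' - v))"
        using partition_gap(3)[OF vs j(1)] partition_gap(4)[OF vs k(1)] K\<Delta> by (intro mult_left_mono) auto
      finally show ?thesis .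
    qed
    have "cmod (e t - e t') \<le> K * \<Delta> * min (v' - v) (2 * pi - (v' - v))"
      using short long by (simp add: min_def)
    also have "\<dots> \<le> K * \<Delta> * (2 * cmod (cis (v + (v' - v)) - cis v))"
      using K\<Delta> le Arg2pi_lt_2pi[of t'] Arg2pi_ge_0[of t]
      by (intro mult_left_mono arc_le_chord) (auto simp: v_def v'_def)
    also have "\<dots> = 2 * (K * \<Delta>) * cmod (t - t')" using c by (simp add: norm_minus_commute)
    finally show ?thesis .
  qed
  have "cmod (e t - e t') \<le> 2 * (K * \<Delta>) * cmod (t - t')"
    using main[OF t] main[OF t(2,1)] by (cases "Arg2pi t \<le> Arg2pi t'") (auto simp: norm_minus_commute)
  then show "cmod ((polygon vs a t - a t) - (polygon vs a t' - a t')) \<le> 2 * K * \<Delta> * cmod (t - t')"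
    by (simp add: e_def mult.assoc)
  obtain j where j: "Suc j < length vs" "vs ! j \<le> Arg2pi t" "Arg2pi t < vs ! Suc j" "e t = E j (Arg2pi t)"
    using piece[OF t(1)] by blast
  have "K * \<Delta> * (Arg2pi t - vs ! j) \<le> K * \<Delta> * (2 * pi)"
    using K\<Delta> Arg2pi_lt_2pi[of t] partition_gap(3)[OF vs j(1)] by (intro mult_left_mono) auto
  then show "cmod (polygon vs a t - a t) \<le> 2 * pi * K * \<Delta>"
    using one(1)[OF j] by (simp add: e_def mult_ac)
qed

lemma polygon_sum:
  "polygon vs (\<lambda>t. \<Sum>n\<in>F. c n * f n t) t = (\<Sum>n\<in>F. c n * polygon vs (f n) t)"
proof -
  have "z * ((\<Sum>n\<in>F. c n * p n) - (\<Sum>n\<in>F. c n * q n)) + (\<Sum>n\<in>F. c n * q n) = (\<Sum>n\<in>F. c n * (z * (p n - q n) + q n))"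
    for z :: complex and p q
    by (simp add: sum_subtractf[symmetric] sum_distrib_left sum.distrib[symmetric]) (simp add: algebra_simps)
  then show ?thesis unfolding polygon_def Let_def .
qed

lemma cis_int_has_vector_derivative:
  "((\<lambda>v. cis v powi n) has_vector_derivative \<i> * of_int n * cis (of_int n * u)) (at u within A)"
proof -
  have h: "((\<lambda>z. exp (\<i> * of_int n * z)) has_field_derivative \<i> * of_int n * exp (\<i> * of_int n * z)) (at z)" for z
    by (auto intro!: derivative_eq_intros)
  have e: "exp (\<i> * of_int n * of_real v) = cis (of_int n * v)" for v :: real
    by (simp add: cis_conv_exp mult.assoc)
  show ?thesis
    using has_vector_derivative_real_field[OF h, of u A] by (simp add: e cis_power_int)
qed

lemma cis_int_lipschitz: "cmod (cis (of_int n * u) - cis (of_int n * w)) \<le> \<bar>of_int n\<bar> * \<bar>u - w\<bar>"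
proof -
  have "cmod (cis u powi n - cis w powi n) \<le> \<bar>of_int n\<bar> * \<bar>u - w\<bar>"
    by (rule real_path_lipschitz[where h' = "\<lambda>v. \<i> * of_int n * cis (of_int n * v)" and x = "min u w" and y = "max u w"])
      (auto intro!: cis_int_has_vector_derivative simp: norm_mult)
  then show ?thesis by (simp add: cis_power_int)
qed

text \<open>The derivative \<open>i n e\<^sup>i\<^sup>n\<^sup>v\<close> of the monomial in the angle has Lipschitz constant \<open>n\<^sup>2\<close>.\<close>

lemma polygon_monomial_error:
  assumes vs: "vs \<in> partitions 0 (2*pi) \<Delta>" and \<Delta>: "0 \<le> \<Delta>" and t: "t \<in> circle" "t' \<in> circle"
  shows "cmod ((polygon vs (\<lambda>t. t powi n) t - t powi n) - (polygon vs (\<lambda>t. t powi n) t' - t' powi n))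
      \<le> 2 * (of_int n)\<^sup>2 * \<Delta> * cmod (t - t')"
    "cmod (polygon vs (\<lambda>t. t powi n) t - t powi n) \<le> 2 * pi * (of_int n)\<^sup>2 * \<Delta>"
proof -
  have K: "cmod (\<i> * of_int n * cis (of_int n * u) - \<i> * of_int n * cis (of_int n * w)) \<le> (of_int n)\<^sup>2 * \<bar>u - w\<bar>" for u w
  proof -
    have "cmod (\<i> * of_int n * cis (of_int n * u) - \<i> * of_int n * cis (of_int n * w)) = \<bar>of_int n\<bar> * cmod (cis (of_int n * u) - cis (of_int n * w))"
      by (simp add: right_diff_distrib[symmetric] norm_mult)
    also have "\<dots> \<le> \<bar>of_int n\<bar> * (\<bar>of_int n\<bar> * \<bar>u - w\<bar>)" by (intro mult_left_mono cis_int_lipschitz) auto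
    finally show ?thesis by (simp add: power2_eq_square mult.assoc[symmetric])
  qed
  show "cmod ((polygon vs (\<lambda>t. t powi n) t - t powi n) - (polygon vs (\<lambda>t. t powi n) t' - t' powi n))
      \<le> 2 * (of_int n)\<^sup>2 * \<Delta> * cmod (t - t')"
    by (rule polygon_error_lipschitz(1)[OF cis_int_has_vector_derivative K _ vs \<Delta> t]) simp
  show "cmod (polygon vs (\<lambda>t. t powi n) t - t powi n) \<le> 2 * pi * (of_int n)\<^sup>2 * \<Delta>"
    by (rule polygon_error_lipschitz(2)[OF cis_int_has_vector_derivative K _ vs \<Delta> t]) simp
qed

lemma powi_lipschitz:
  fixes R1 R2 :: real
  assumes "0 < R1"
  shows "\<exists>C\<ge>0. \<forall>x\<in>{R1..R2}. \<forall>y\<in>{R1..R2}. \<bar>x powi n\<bar> \<le> C \<and> \<bar>x powi n - y powi n\<bar> \<le> C * \<bar>x - y\<bar>"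
proof -
  have "continuous_on {R1..R2} (\<lambda>x. x powi n)" and c': "continuous_on {R1..R2} (\<lambda>x. of_int n * x powi (n - 1))"
    using assms by (auto intro!: continuous_intros)
  then have "bounded ((\<lambda>x. x powi n) ` {R1..R2})" "bounded ((\<lambda>x. of_int n * x powi (n - 1)) ` {R1..R2})"
    by (auto intro!: compact_imp_bounded compact_continuous_image)
  then obtain B B' where B: "\<forall>x\<in>{R1..R2}. norm (x powi n) \<le> B" "\<forall>x\<in>{R1..R2}. norm (of_int n * x powi (n - 1)) \<le> B'"
    unfolding bounded_iff by blast
  define C where "C = max 0 (max B B')"
  have "norm (x powi n - y powi n) \<le> C * norm (x - y)" if "x \<in> {R1..R2}" "y \<in> {R1..R2}" for x y
  proof (rule field_differentiable_bound[of "{R1..R2}" "\<lambda>x. x powi n" "\<lambda>x. of_int n * x powi (n - 1)"])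
    show "((\<lambda>x. x powi n) has_field_derivative of_int n * z powi (n - 1)) (at z within {R1..R2})" if "z \<in> {R1..R2}" for z
      using that assms by (auto intro!: derivative_eq_intros)
    show "norm (of_int n * z powi (n - 1)) \<le> C" if "z \<in> {R1..R2}" for z
      using bspec[OF B(2) that] by (simp add: C_def)
  qed (use that in auto)
  moreover have "norm (x powi n) \<le> C" if "x \<in> {R1..R2}" for x using bspec[OF B(1) that] by (simp add: C_def)
  ultimately show ?thesis by (intro exI[of _ C]) (auto simp: C_def)
qed

lemma sgn_lipschitz:
  fixes w w' :: complex
  assumes "0 < R" "R \<le> cmod w" "R \<le> cmod w'"
  shows "cmod (sgn w - sgn w') \<le> 2 / R * cmod (w - w')"
proof -
  have nz: "cmod w > 0" "cmod w' > 0" using assms by linarith+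
  have "sgn w - sgn w' = (w - w') / of_real (cmod w) + (of_real (cmod w' - cmod w) / of_real (cmod w)) * sgn w'"
    using nz by (simp add: sgn_eq field_simps)
  also have "cmod \<dots> \<le> cmod ((w - w') / of_real (cmod w)) + cmod ((of_real (cmod w' - cmod w) / of_real (cmod w)) * sgn w')"
    by (rule norm_triangle_ineq)
  also have "\<dots> = cmod (w - w') / cmod w + \<bar>cmod w' - cmod w\<bar> / cmod w"
    using nz by (simp add: norm_mult norm_divide norm_sgn del: of_real_diff)
  also have "\<dots> \<le> cmod (w - w') / cmod w + cmod (w - w') / cmod w"
    using norm_triangle_ineq3[of w' w] nz by (intro add_left_mono divide_right_mono) (auto simp: norm_minus_commute)
  also have "\<dots> \<le> cmod (w - w') / R + cmod (w - w') / R"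
    using assms by (intro add_mono divide_left_mono mult_pos_pos nz) auto
  finally show ?thesis by simp
qed

definition annulus :: "real \<Rightarrow> real \<Rightarrow> complex set" where
  "annulus R1 R2 = {w. R1 \<le> cmod w \<and> cmod w \<le> R2}"

lemma compact_annulus: "compact (annulus R1 R2)"
proof -
  have "annulus R1 R2 = cball 0 R2 - ball 0 R1" by (auto simp: annulus_def)
  then show ?thesis by (simp add: compact_diff)
qed

text \<open>Smallness of the Lipschitz constant is as important as smallness of the size: it makes the
  equation \<open>b(w) + E(w) = \<mu>\<close> solvable by contraction, and it controls \<open>b + E - \<mu>\<close> near a
  solution, where the function itself becomes arbitrarily small.\<close>

definition small_lipschitz :: "complex set \<Rightarrow> real \<Rightarrow> (complex \<Rightarrow> complex) \<Rightarrow> bool" where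
  "small_lipschitz A \<kappa> E \<longleftrightarrow> (\<forall>w\<in>A. cmod (E w) \<le> \<kappa>) \<and>
     (\<forall>w\<in>A. \<forall>w'\<in>A. cmod (E w - E w') \<le> \<kappa> * cmod (w - w'))"

lemma small_lipschitzD:
  assumes "small_lipschitz A \<kappa> E" "w \<in> A" "w' \<in> A"
  shows "cmod (E w) \<le> \<kappa>" "cmod (E w - E w') \<le> \<kappa> * cmod (w - w')"
  using assms by (auto simp: small_lipschitz_def)

lemma small_lipschitz_mono:
  assumes "small_lipschitz A \<kappa> E" "\<kappa> \<le> \<kappa>'"
  shows "small_lipschitz A \<kappa>' E"
  using assms mult_right_mono[OF assms(2) norm_ge_zero] unfolding small_lipschitz_def
  by (meson order_trans)

text \<open>Collecting the errors for all radii in one function of \<open>w = \<rho> t\<close> allows zeros to be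
  counted on all circles at once.\<close>

definition polygon_error :: "(int \<Rightarrow> complex) \<Rightarrow> nat \<Rightarrow> nat \<Rightarrow> real list \<Rightarrow> complex \<Rightarrow> complex" where
  "polygon_error b r s vs w = polygon vs (dilate (cmod w) (laurent_poly b r s)) (sgn w) - laurent_poly b r s w"

lemma polygon_error_expand:
  assumes "w \<noteq> 0"
  shows "polygon_error b r s vs w = (\<Sum>n\<in>{- int r..int s}.
     b n * of_real (cmod w powi n) * (polygon vs (\<lambda>t. t powi n) (sgn w) - sgn w powi n))"
proof -
  have "dilate (cmod w) (laurent_poly b r s) = (\<lambda>t. \<Sum>n\<in>{- int r..int s}. (b n * of_real (cmod w powi n)) * t powi n)"
    by (intro ext) (simp add: dilate_def laurent_poly_def power_int_mult_distrib mult.assoc of_real_power_int)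
  moreover have "laurent_poly b r s w = (\<Sum>n\<in>{- int r..int s}. (b n * of_real (cmod w powi n)) * sgn w powi n)"
  proof -
    have "w powi n = of_real (cmod w powi n) * sgn w powi n" for n
    proof -
      have "w = of_real (cmod w) * sgn w" using assms by (simp add: sgn_eq)
      then show ?thesis by (metis of_real_power_int power_int_mult_distrib)
    qed
    then show ?thesis by (simp add: laurent_poly_def mult.assoc)
  qed
  ultimately show ?thesis
    by (simp add: polygon_error_def polygon_sum sum_subtractf[symmetric] right_diff_distrib)
qed

text \<open>Each monomial contributes the product of a radial factor, which is smooth in the modulus,
  and an angular interpolation error, which is small together with its Lipschitz constant.\<close>

lemma polygon_error_bound:
  assumes R: "0 < R1"
  obtains C where "0 \<le> C" "\<And>\<Delta> vs. vs \<in> partitions 0 (2*pi) \<Delta> \<Longrightarrow>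
    small_lipschitz (annulus R1 R2) (C * \<Delta>) (polygon_error b r s vs)"
proof -
  have "\<forall>n. \<exists>C\<ge>0. \<forall>x\<in>{R1..R2}. \<forall>y\<in>{R1..R2}. \<bar>x powi n\<bar> \<le> C \<and> \<bar>x powi n - y powi n\<bar> \<le> C * \<bar>x - y\<bar>"
    using powi_lipschitz[OF R] by blast
  then obtain P where P: "\<And>n. 0 \<le> P n" "\<And>n x y. x \<in> {R1..R2} \<Longrightarrow> y \<in> {R1..R2} \<Longrightarrow> \<bar>x powi n\<bar> \<le> P n \<and> \<bar>x powi n - y powi n\<bar> \<le> P n * \<bar>x - y\<bar>"
    unfolding choice_iff by blast
  define K where "K n = 2 * pi * (of_int n)\<^sup>2 + 4 / R1 * (of_int n)\<^sup>2" for n :: int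
  have K: "2 * pi * (of_int n)\<^sup>2 \<le> K n" "2 * (of_int n)\<^sup>2 * (2 / R1) \<le> K n" "0 \<le> K n" for n
    using R pi_gt_zero by (auto simp: K_def)
  define C where "C n = cmod (b n) * (P n * K n)" for n
  have C0: "0 \<le> C n" for n using P(1) K(3) by (simp add: C_def)
  define D where "D = (\<Sum>n\<in>{- int r..int s}. C n)"
  show ?thesis
  proof (rule that[of D])
    show "0 \<le> D" unfolding D_def using C0 by (intro sum_nonneg)
    fix \<Delta> :: real and vs assume vs: "vs \<in> partitions 0 (2*pi) \<Delta>"
    then have \<Delta>: "0 \<le> \<Delta>" by (rule partitions_nonneg)
    have "cmod (polygon_error b r s vs w) \<le> D * \<Delta> \<and>
        cmod (polygon_error b r s vs w - polygon_error b r s vs w') \<le> D * \<Delta> * cmod (w - w')"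
      if w: "w \<in> annulus R1 R2" "w' \<in> annulus R1 R2" for w w'
    proof
      have ww: "R1 \<le> cmod w" "cmod w \<in> {R1..R2}" "R1 \<le> cmod w'" "cmod w' \<in> {R1..R2}"
        using w by (auto simp: annulus_def)
      then have nz: "w \<noteq> 0" "w' \<noteq> 0" using R by auto
      define e where "e n w = polygon vs (\<lambda>t. t powi n) (sgn w) - sgn w powi n" for n w
      define X where "X n w = complex_of_real (cmod w powi n)" for n w
      have t: "sgn w \<in> circle" "sgn w' \<in> circle" using nz by (auto simp: norm_sgn)
      have e1: "cmod (e n w) \<le> K n * \<Delta>" for n
      proof -
        have "cmod (e n w) \<le> 2 * pi * (of_int n)\<^sup>2 * \<Delta>" unfolding e_def by (rule polygon_monomial_error(2)[OF vs \<Delta> t])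
        also have "\<dots> \<le> K n * \<Delta>" using K(1) \<Delta> by (rule mult_right_mono)
        finally show ?thesis .
      qed
      have X1: "cmod (X n w) \<le> P n" "cmod (X n w') \<le> P n" "cmod (X n w - X n w') \<le> P n * cmod (w - w')" for n
      proof -
        show "cmod (X n w) \<le> P n" "cmod (X n w') \<le> P n" unfolding X_def norm_of_real using P(2) ww by blast+
        have "cmod (X n w - X n w') = \<bar>cmod w powi n - cmod w' powi n\<bar>"
          unfolding X_def of_real_diff[symmetric] norm_of_real ..
        also have "\<dots> \<le> P n * \<bar>cmod w - cmod w'\<bar>" using P(2) ww by blast
        also have "\<dots> \<le> P n * cmod (w - w')" using P(1) norm_triangle_ineq3 by (intro mult_left_mono)
        finally show "cmod (X n w - X n w') \<le> P n * cmod (w - w')" .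
      qed
      have e2: "cmod (e n w - e n w') \<le> 2 * (of_int n)\<^sup>2 * (2 / R1) * \<Delta> * cmod (w - w')" for n
      proof -
        have "cmod (e n w - e n w') \<le> 2 * (of_int n)\<^sup>2 * \<Delta> * cmod (sgn w - sgn w')"
          unfolding e_def by (rule polygon_monomial_error(1)[OF vs \<Delta> t])
        also have "\<dots> \<le> 2 * (of_int n)\<^sup>2 * \<Delta> * (2 / R1 * cmod (w - w'))"
          using \<Delta> by (intro mult_left_mono sgn_lipschitz R ww) auto
        finally show ?thesis by (simp add: mult_ac)
      qed
      have exp: "polygon_error b r s vs w = (\<Sum>n\<in>{- int r..int s}. b n * X n w * e n w)"
        "polygon_error b r s vs w' = (\<Sum>n\<in>{- int r..int s}. b n * X n w' * e n w')"
        unfolding X_def e_def by (rule polygon_error_expand[OF nz(1)], rule polygon_error_expand[OF nz(2)])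
      have "cmod (polygon_error b r s vs w) \<le> (\<Sum>n\<in>{- int r..int s}. C n * \<Delta>)"
        unfolding exp
      proof (rule order_trans[OF norm_sum sum_mono])
        fix n
        have "cmod (X n w) * cmod (e n w) \<le> P n * (K n * \<Delta>)"
          using X1(1) e1 P(1) by (intro mult_mono) auto
        then have "cmod (b n) * (cmod (X n w) * cmod (e n w)) \<le> cmod (b n) * (P n * (K n * \<Delta>))"
          by (rule mult_left_mono) simp
        then show "cmod (b n * X n w * e n w) \<le> C n * \<Delta>" by (simp add: norm_mult C_def mult.assoc)
      qed
      then show "cmod (polygon_error b r s vs w) \<le> D * \<Delta>" by (simp add: D_def sum_distrib_right)
      have "cmod (polygon_error b r s vs w - polygon_error b r s vs w') \<le> (\<Sum>n\<in>{- int r..int s}. C n * \<Delta> * cmod (w - w'))"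
        unfolding exp sum_subtractf[symmetric]
      proof (rule order_trans[OF norm_sum sum_mono])
        fix n
        have "X n w * e n w - X n w' * e n w' = (X n w - X n w') * e n w + X n w' * (e n w - e n w')"
          by (simp add: algebra_simps)
        then have "cmod (X n w * e n w - X n w' * e n w') \<le> cmod (X n w - X n w') * cmod (e n w) + cmod (X n w') * cmod (e n w - e n w')"
          by (metis norm_mult norm_triangle_ineq)
        also have "\<dots> \<le> (P n * cmod (w - w')) * (2 * pi * (of_int n)\<^sup>2 * \<Delta>) + P n * (2 * (of_int n)\<^sup>2 * (2 / R1) * \<Delta> * cmod (w - w'))"
          using X1 e2 P(1) polygon_monomial_error(2)[OF vs \<Delta> t, of n] by (intro add_mono mult_mono) (auto simp: e_def)
        also have "\<dots> = P n * K n * \<Delta> * cmod (w - w')" by (simp add: K_def algebra_simps)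
        finally have "cmod (b n) * cmod (X n w * e n w - X n w' * e n w') \<le> cmod (b n) * (P n * K n * \<Delta> * cmod (w - w'))"
          by (rule mult_left_mono) simp
        moreover have "b n * X n w * e n w - b n * X n w' * e n w' = b n * (X n w * e n w - X n w' * e n w')"
          by (simp add: algebra_simps)
        ultimately show "cmod (b n * X n w * e n w - b n * X n w' * e n w') \<le> C n * \<Delta> * cmod (w - w')"
          by (simp add: norm_mult C_def mult.assoc)
      qed
      then show "cmod (polygon_error b r s vs w - polygon_error b r s vs w') \<le> D * \<Delta> * cmod (w - w')"
        by (simp add: D_def sum_distrib_right)
    qed
    then show "small_lipschitz (annulus R1 R2) (D * \<Delta>) (polygon_error b r s vs)"
      unfolding small_lipschitz_def by blast
  qed
qed

section \<open>Zeros of the symbol and the limit set\<close>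

locale banded_symbol =
  fixes b :: "int \<Rightarrow> complex" and r s :: nat
  assumes r: "0 < r" and s: "0 < s" and br: "b (- int r) \<noteq> 0" and bs: "b (int s) \<noteq> 0"
begin

abbreviation "N \<equiv> r + s"
abbreviation "symb \<equiv> laurent_poly b r s"
abbreviation "chi \<equiv> eigenvalue_poly b r s"

lemma coeff_chi: "coeff (chi l) k = (if k \<le> N then b (int k - int r) else 0) - (if k = r then l else 0)"
  by (auto simp: eigenvalue_poly_def coeff_sum)

lemma degree_chi: "degree (chi l) = N"
proof (rule antisym)
  show "degree (chi l) \<le> N" by (rule degree_le) (auto simp: coeff_chi)
  have "coeff (chi l) N \<noteq> 0" using s bs by (simp add: coeff_chi)
  then show "N \<le> degree (chi l)" by (rule le_degree)
qed

lemma lead_coeff_chi: "lead_coeff (chi l) = b (int s)"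
  using s by (simp add: degree_chi coeff_chi)

lemma chi_neq_0: "chi l \<noteq> 0"
  using lead_coeff_chi[of l] bs by auto

lemma poly_chi_0: "poly (chi l) 0 \<noteq> 0"
  using r br by (simp add: poly_0_coeff_0 coeff_chi)

lemma poly_chi: "z \<noteq> 0 \<Longrightarrow> poly (chi l) z = z ^ r * (symb z - l)"
  by (rule poly_eigenvalue_poly)

lemma root_chi_iff: "poly (chi l) z = 0 \<longleftrightarrow> z \<noteq> 0 \<and> symb z = l"
  using poly_chi_0 poly_chi by (cases "z = 0") auto

lemma symb_holomorphic: "0 \<notin> A \<Longrightarrow> symb holomorphic_on A"
  unfolding laurent_poly_def by (intro holomorphic_intros) auto

lemma symb_continuous: "0 \<notin> A \<Longrightarrow> continuous_on A symb"
  by (intro holomorphic_on_imp_continuous_on symb_holomorphic)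

lemma simple_roots:
  assumes "rsquarefree (chi l)"
  shows "card {z. poly (chi l) z = 0} = N" "\<And>z. poly (chi l) z = 0 \<Longrightarrow> deriv symb z \<noteq> 0"
proof -
  have ord: "order z (chi l) = 1" if "poly (chi l) z = 0" for z
    using rsquarefree_root_order[OF assms that chi_neq_0] .
  have "N = size (proots (chi l))" by (simp add: size_proots_complex degree_chi)
  also have "\<dots> = (\<Sum>z | poly (chi l) z = 0. order z (chi l))"
    unfolding size_multiset_overloaded_eq using chi_neq_0 by simp
  also have "\<dots> = card {z. poly (chi l) z = 0}" using ord by simp
  finally show "card {z. poly (chi l) z = 0} = N" ..
  fix z assume z: "poly (chi l) z = 0"
  then have z0: "z \<noteq> 0" "symb z = l" by (auto simp: root_chi_iff)
  have d: "(symb has_field_derivative deriv symb z) (at z)"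
    using symb_holomorphic[of "- {0}"] z0 by (intro holomorphic_derivI[of _ "- {0}"]) auto
  have "((\<lambda>z. z ^ r * (symb z - l)) has_field_derivative z ^ r * deriv symb z) (at z)"
    using z0 by (auto intro!: derivative_eq_intros d)
  then have "(poly (chi l) has_field_derivative z ^ r * deriv symb z) (at z)"
    by (rule has_field_derivative_transform_within_open[of _ _ _ "- {0}"]) (use z0 in \<open>auto simp: poly_chi\<close>)
  then have "poly (pderiv (chi l)) z = z ^ r * deriv symb z" using poly_DERIV DERIV_unique by blast
  moreover have "poly (pderiv (chi l)) z \<noteq> 0" using assms z by (simp add: rsquarefree_roots)
  ultimately show "deriv symb z \<noteq> 0" by auto
qed

text \<open>All \<open>N\<close> zeros of \<open>chi \<mu>\<close> as holomorphic functions of \<open>\<mu>\<close>. Being \<open>N\<close> distinct preimages of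
  \<open>\<mu>\<close>, the values exhaust the zeros, each of which is simple.\<close>

definition branches :: "complex set \<Rightarrow> (nat \<Rightarrow> complex \<Rightarrow> complex) \<Rightarrow> bool" where
  "branches D g \<longleftrightarrow> (\<forall>i<N. g i holomorphic_on D) \<and>
     (\<forall>\<mu>\<in>D. inj_on (\<lambda>i. g i \<mu>) {..<N} \<and> (\<forall>i<N. g i \<mu> \<noteq> 0 \<and> symb (g i \<mu>) = \<mu>))"

lemma branches_subset: "branches D g \<Longrightarrow> D' \<subseteq> D \<Longrightarrow> branches D' g"
  unfolding branches_def by (meson holomorphic_on_subset subsetD)

lemma branches_roots:
  assumes "branches D g" "\<mu> \<in> D"
  shows "{z. poly (chi \<mu>) z = 0} = (\<lambda>i. g i \<mu>) ` {..<N}"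
proof (rule sym, rule card_seteq)
  show "finite {z. poly (chi \<mu>) z = 0}" using poly_roots_finite[OF chi_neq_0] .
  show "(\<lambda>i. g i \<mu>) ` {..<N} \<subseteq> {z. poly (chi \<mu>) z = 0}"
    using assms by (auto simp: branches_def root_chi_iff)
  have "card {z. poly (chi \<mu>) z = 0} \<le> N" using card_poly_roots_bound[OF chi_neq_0[of \<mu>]] by (simp add: degree_chi)
  also have "N = card ((\<lambda>i. g i \<mu>) ` {..<N})" using assms by (simp add: card_image branches_def)
  finally show "card {z. poly (chi \<mu>) z = 0} \<le> card ((\<lambda>i. g i \<mu>) ` {..<N})" .
qed

text \<open>At simple zeros the derivative of the symbol does not vanish, so the symbol has local
  inverses. They are taken on discs so small that their values stay apart and away from \<open>0\<close>.\<close>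

lemma branches_exist:
  assumes "rsquarefree (chi l)"
  obtains \<delta> g where "\<delta> > 0" "branches (ball l \<delta>) g"
proof -
  define Z where "Z = {z. poly (chi l) z = 0}"
  have finZ: "finite Z" unfolding Z_def using poly_roots_finite[OF chi_neq_0] .
  have cardZ: "card Z = N" and dZ: "\<And>z. z \<in> Z \<Longrightarrow> deriv symb z \<noteq> 0"
    using simple_roots[OF assms] by (auto simp: Z_def)
  have Z0: "z \<noteq> 0" "symb z = l" if "z \<in> Z" for z using that by (auto simp: Z_def root_chi_iff)
  obtain \<zeta> where \<zeta>: "bij_betw \<zeta> {..<N} Z"
    using ex_bij_betw_nat_finite[OF finZ] cardZ by (auto simp: atLeast0LessThan)
  have \<zeta>Z: "\<zeta> i \<in> Z" if "i < N" for i using \<zeta> that by (auto simp: bij_betw_def)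
  define d where "d = Min (insert 1 ((\<lambda>(z, w). dist z w) ` {(z, w). z \<in> insert 0 Z \<and> w \<in> insert 0 Z \<and> z \<noteq> w})) / 2"
  have fin: "finite {(z, w). z \<in> insert 0 Z \<and> w \<in> insert 0 Z \<and> z \<noteq> w}"
    by (rule finite_subset[of _ "insert 0 Z \<times> insert 0 Z"]) (use finZ in auto)
  have d0: "0 < d" unfolding d_def using fin by (simp add: Min_gr_iff) 
  have dd: "2 * d \<le> dist z w" if "z \<in> insert 0 Z" "w \<in> insert 0 Z" "z \<noteq> w" for z w
    unfolding d_def using fin that by (simp, intro Min_le) (auto intro!: image_eqI[of _ _ "(z, w)"])
  have "\<exists>e h. 0 < e \<and> e \<le> d \<and> h holomorphic_on symb ` ball z e \<and> open (symb ` ball z e) \<and> (\<forall>w\<in>ball z e. h (symb w) = w)"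
    if z: "z \<in> Z" for z
  proof -
    have hol: "symb holomorphic_on (- {0})" by (rule symb_holomorphic) simp
    obtain e where e: "e > 0" "ball z e \<subseteq> - {0}" "inj_on symb (ball z e)"
      using has_complex_derivative_locally_injective[OF hol _ _ dZ[OF z]] Z0[OF z] by blast
    define e' where "e' = min e d"
    have e': "0 < e'" "e' \<le> d" "ball z e' \<subseteq> ball z e" using e d0 by (auto simp: e'_def)
    have hol': "symb holomorphic_on ball z e'" using hol e e' by (meson holomorphic_on_subset order_trans)
    have inj: "inj_on symb (ball z e')" using e(3) e'(3) by (rule inj_on_subset)
    obtain h where "h holomorphic_on symb ` ball z e'" "\<And>w. w \<in> ball z e' \<Longrightarrow> h (symb w) = w"
      using holomorphic_has_inverse[OF hol' open_ball inj] by metis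
    moreover have "open (symb ` ball z e')" using open_mapping_thm3[OF hol' _ inj] by simp
    ultimately show ?thesis using e' by blast
  qed
  then obtain e h where eh: "\<And>z. z \<in> Z \<Longrightarrow> 0 < e z \<and> e z \<le> d \<and> h z holomorphic_on symb ` ball z (e z) \<and> open (symb ` ball z (e z)) \<and> (\<forall>w\<in>ball z (e z). h z (symb w) = w)"
    by metis
  define V where "V = (\<Inter>z\<in>Z. symb ` ball z (e z))"
  have "open V" unfolding V_def using finZ eh by (intro open_INT) auto
  moreover have "l \<in> V" unfolding V_def
  proof
    fix z assume z: "z \<in> Z"
    then have "l = symb z" "z \<in> ball z (e z)" using eh Z0 by auto
    then show "l \<in> symb ` ball z (e z)" by blast
  qed
  ultimately obtain \<delta> where \<delta>: "\<delta> > 0" "ball l \<delta> \<subseteq> V" using open_contains_ball by blast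
  have "branches (ball l \<delta>) (\<lambda>i. h (\<zeta> i))"
    unfolding branches_def
  proof (intro conjI allI ballI impI)
    fix i assume i: "i < N"
    show "h (\<zeta> i) holomorphic_on ball l \<delta>"
      using eh[OF \<zeta>Z[OF i]] \<delta>(2) \<zeta>Z[OF i] by (auto simp: V_def intro: holomorphic_on_subset)
  next
    fix \<mu> assume \<mu>: "\<mu> \<in> ball l \<delta>"
    have hb: "h z \<mu> \<in> ball z d \<and> symb (h z \<mu>) = \<mu>" if z: "z \<in> Z" for z
    proof -
      have "\<mu> \<in> symb ` ball z (e z)" using \<mu> \<delta>(2) z by (auto simp: V_def)
      then obtain w where w: "w \<in> ball z (e z)" "\<mu> = symb w" by blast
      then show ?thesis using eh[OF z] by auto
    qed
    show "inj_on (\<lambda>i. h (\<zeta> i) \<mu>) {..<N}"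
    proof (rule inj_onI)
      fix i j assume ij: "i \<in> {..<N}" "j \<in> {..<N}" "h (\<zeta> i) \<mu> = h (\<zeta> j) \<mu>"
      then have z: "\<zeta> i \<in> Z" "\<zeta> j \<in> Z" using \<zeta>Z by auto
      have "dist (\<zeta> i) (\<zeta> j) < d + d"
        using dist_triangle_less_add[of "\<zeta> i" "h (\<zeta> i) \<mu>" d "\<zeta> j" d] hb[OF z(1)] hb[OF z(2)] ij(3)
        by (simp add: dist_commute)
      then have "\<zeta> i = \<zeta> j" using dd[of "\<zeta> i" "\<zeta> j"] z by force
      then show "i = j" using \<zeta> ij by (auto simp: bij_betw_def inj_on_def)
    qed
    fix i assume i: "i < N"
    show "symb (h (\<zeta> i) \<mu>) = \<mu>" using hb[OF \<zeta>Z[OF i]] by blast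
    show "h (\<zeta> i) \<mu> \<noteq> 0"
    proof
      assume "h (\<zeta> i) \<mu> = 0"
      then have "dist (\<zeta> i) 0 < d" using hb[OF \<zeta>Z[OF i]] by simp
      then show False using dd[of "\<zeta> i" 0] \<zeta>Z[OF i] Z0(1)[OF \<zeta>Z[OF i]] d0 by auto
    qed
  qed
  with \<delta>(1) that show ?thesis by blast
qed

text \<open>A multiple zero is a zero of \<open>b'\<close>, hence of the polynomial \<open>q(z) = z\<^sup>r\<^sup>+\<^sup>1 b'(z)\<close>, which
  is the same for all \<open>l\<close>.\<close>

lemma critical_values_finite: "finite {l. \<not> rsquarefree (chi l)}"
proof -
  define q where "q = [:0, 1:] * pderiv (chi 0) - smult (of_nat r) (chi 0)"
  have "coeff q N = of_nat s * b (int s)"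
  proof -
    obtain M where M: "N = Suc M" using r by (cases N) auto
    have "coeff (pderiv (chi 0)) M = of_nat (Suc M) * coeff (chi 0) (Suc M)" by (rule coeff_pderiv)
    also have "coeff (chi 0) (Suc M) = b (int s)" unfolding M[symmetric] using s by (simp add: coeff_chi)
    finally have "coeff (pderiv (chi 0)) M = of_nat N * b (int s)" unfolding M .
    moreover have "coeff (chi 0) N = b (int s)" using s by (simp add: coeff_chi)
    moreover have "coeff q N = coeff (pderiv (chi 0)) M - of_nat r * coeff (chi 0) N"
      unfolding q_def M by (simp del: coeff_pderiv)
    ultimately show ?thesis by (simp add: algebra_simps)
  qed
  then have "q \<noteq> 0" using s bs by auto
  then have "finite {z. poly q z = 0}" by (rule poly_roots_finite)
  moreover have "{l. \<not> rsquarefree (chi l)} \<subseteq> symb ` {z. poly q z = 0}"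
  proof
    fix l assume "l \<in> {l. \<not> rsquarefree (chi l)}"
    then obtain z where z: "poly (chi l) z = 0" "poly (pderiv (chi l)) z = 0" by (auto simp: rsquarefree_roots)
    then have z0: "z \<noteq> 0" "symb z = l" by (auto simp: root_chi_iff)
    obtain r' where r': "r = Suc r'" using r by (cases r) auto
    have chi_l: "chi l = chi 0 - monom l r" by (simp add: eigenvalue_poly_def)
    have "poly (chi 0) z = l * z ^ r" using z(1) by (simp add: chi_l poly_monom)
    moreover have "poly (pderiv (chi 0)) z = of_nat r * l * z ^ (r - 1)"
      using z(2) by (simp add: chi_l pderiv_diff pderiv_monom poly_monom)
    ultimately have "poly q z = 0" by (simp add: q_def r')
    with z0(2) show "l \<in> symb ` {z. poly q z = 0}" by blast
  qed
  ultimately show ?thesis by (meson finite_imageI finite_subset)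
qed

lemma sorted_zeros:
  assumes zs: "mset zs = proots (chi l)" "sorted (map cmod zs)"
  shows "length zs = N" "set zs = {z. poly (chi l) z = 0}"
    "\<And>i k. i \<le> k \<Longrightarrow> k < N \<Longrightarrow> cmod (zs ! i) \<le> cmod (zs ! k)"
    "zeros_inside (chi l) \<rho> = card {i. i < N \<and> cmod (zs ! i) < \<rho>}"
proof -
  show len: "length zs = N" using arg_cong[OF zs(1), of size] by (simp add: size_proots_complex degree_chi)
  show "set zs = {z. poly (chi l) z = 0}"
    using arg_cong[OF zs(1), of set_mset] chi_neq_0 by simp
  show "cmod (zs ! i) \<le> cmod (zs ! k)" if "i \<le> k" "k < N" for i k
    using sorted_nth_mono[OF zs(2), of i k] that len by simp
  have "zeros_inside (chi l) \<rho> = size (mset (filter (\<lambda>z. cmod z < \<rho>) zs))"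
    by (simp add: zeros_inside_def zs(1)[symmetric])
  also have "\<dots> = card {i. i < N \<and> cmod (zs ! i) < \<rho>}"
    unfolding size_mset length_filter_conv_card len ..
  finally show "zeros_inside (chi l) \<rho> = card {i. i < N \<and> cmod (zs ! i) < \<rho>}" .
qed

text \<open>Trades sorted lists of zeros for separating circles, which can be found by counting zeros
  and are stable under perturbation: the \<open>r\<close>-th modulus is smaller than the next one iff some
  circle free of zeros has exactly \<open>r\<close> zeros inside.\<close>

lemma limit_set_iff:
  "l \<in> limit_set b r s \<longleftrightarrow> \<not> (\<exists>\<rho>. zeros_inside (chi l) \<rho> = r \<and> (\<forall>z. poly (chi l) z = 0 \<longrightarrow> cmod z \<noteq> \<rho>))"
proof -
  have main: "cmod (zs ! (r - 1)) < cmod (zs ! r) \<longleftrightarrow> (\<exists>\<rho>. zeros_inside (chi l) \<rho> = r \<and> (\<forall>z. poly (chi l) z = 0 \<longrightarrow> cmod z \<noteq> \<rho>))"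
    and le: "cmod (zs ! (r - 1)) \<le> cmod (zs ! r)"
    if zs: "mset zs = proots (chi l)" "sorted (map cmod zs)" for zs
  proof -
    note len = sorted_zeros(1)[OF zs] and set = sorted_zeros(2)[OF zs]
      and mono = sorted_zeros(3)[OF zs] and zi = sorted_zeros(4)[OF zs]
    show "cmod (zs ! (r - 1)) \<le> cmod (zs ! r)" using s by (intro mono) auto
    show "cmod (zs ! (r - 1)) < cmod (zs ! r) \<longleftrightarrow> (\<exists>\<rho>. zeros_inside (chi l) \<rho> = r \<and> (\<forall>z. poly (chi l) z = 0 \<longrightarrow> cmod z \<noteq> \<rho>))"
    proof
      assume less: "cmod (zs ! (r - 1)) < cmod (zs ! r)"
      define \<rho> where "\<rho> = (cmod (zs ! (r - 1)) + cmod (zs ! r)) / 2"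
      have lo: "cmod (zs ! i) < \<rho>" if "i < r" for i
      proof -
        have "cmod (zs ! i) \<le> cmod (zs ! (r - 1))" using that s by (intro mono) auto
        then show ?thesis using less by (simp add: \<rho>_def)
      qed
      have hi: "\<rho> < cmod (zs ! i)" if "r \<le> i" "i < N" for i
        using mono[of r i] that less by (simp add: \<rho>_def)
      have "{i. i < N \<and> cmod (zs ! i) < \<rho>} = {..<r}"
      proof (intro set_eqI iffI)
        fix i assume "i \<in> {i. i < N \<and> cmod (zs ! i) < \<rho>}"
        then show "i \<in> {..<r}" using hi[of i] by (cases "i < r") auto
      next
        fix i assume "i \<in> {..<r}"
        then show "i \<in> {i. i < N \<and> cmod (zs ! i) < \<rho>}" using lo[of i] by simp
      qed
      then have "zeros_inside (chi l) \<rho> = r" by (simp add: zi)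
      moreover have "cmod z \<noteq> \<rho>" if "poly (chi l) z = 0" for z
      proof -
        have "z \<in> set zs" using that unfolding set by simp
        then obtain i where "i < N" "z = zs ! i" unfolding in_set_conv_nth len by blast
        then show ?thesis using lo[of i] hi[of i] by (cases "i < r") auto
      qed
      ultimately show "\<exists>\<rho>. zeros_inside (chi l) \<rho> = r \<and> (\<forall>z. poly (chi l) z = 0 \<longrightarrow> cmod z \<noteq> \<rho>)" by blast
    next
      assume "\<exists>\<rho>. zeros_inside (chi l) \<rho> = r \<and> (\<forall>z. poly (chi l) z = 0 \<longrightarrow> cmod z \<noteq> \<rho>)"
      then obtain \<rho> where \<rho>: "card {i. i < N \<and> cmod (zs ! i) < \<rho>} = r" "\<And>z. poly (chi l) z = 0 \<Longrightarrow> cmod z \<noteq> \<rho>"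
        by (auto simp: zi)
      have "cmod (zs ! (r - 1)) < \<rho>"
      proof (rule ccontr)
        assume c: "\<not> cmod (zs ! (r - 1)) < \<rho>"
        have "{i. i < N \<and> cmod (zs ! i) < \<rho>} \<subseteq> {..<r - 1}"
        proof
          fix i assume i: "i \<in> {i. i < N \<and> cmod (zs ! i) < \<rho>}"
          show "i \<in> {..<r - 1}" using mono[of "r - 1" i] i c by (cases "r - 1 \<le> i") auto
        qed
        from card_mono[OF _ this] have "r \<le> r - 1" unfolding \<rho>(1) by simp
        then show False using r by simp
      qed
      moreover have "\<not> cmod (zs ! r) < \<rho>"
      proof
        assume c: "cmod (zs ! r) < \<rho>"
        have "{..r} \<subseteq> {i. i < N \<and> cmod (zs ! i) < \<rho>}"
        proof
          fix i assume i: "i \<in> {..r}"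
          then have "cmod (zs ! i) \<le> cmod (zs ! r)" using s by (intro mono) auto
          then show "i \<in> {i. i < N \<and> cmod (zs ! i) < \<rho>}" using i c s by auto
        qed
        from card_mono[OF _ this] show False unfolding \<rho>(1) by simp
      qed
      ultimately show "cmod (zs ! (r - 1)) < cmod (zs ! r)" by linarith
    qed
  qed
  obtain zs0 where zs0: "mset zs0 = proots (chi l)" using ex_mset by blast
  define zs where "zs = sort_key cmod zs0"
  have zs: "mset zs = proots (chi l)" "sorted (map cmod zs)" by (simp_all add: zs_def zs0)
  have "l \<in> limit_set b r s \<longleftrightarrow> (\<exists>zs. mset zs = proots (chi l) \<and> sorted (map cmod zs) \<and> \<not> cmod (zs ! (r - 1)) < cmod (zs ! r))"
  proof -
    have "cmod (zs ! (r - 1)) = cmod (zs ! r) \<longleftrightarrow> \<not> cmod (zs ! (r - 1)) < cmod (zs ! r)"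
      if "mset zs = proots (chi l)" "sorted (map cmod zs)" for zs
      using le[OF that] by linarith
    then show ?thesis unfolding limit_set_def mem_Collect_eq by blast
  qed
  also have "\<dots> \<longleftrightarrow> \<not> (\<exists>\<rho>. zeros_inside (chi l) \<rho> = r \<and> (\<forall>z. poly (chi l) z = 0 \<longrightarrow> cmod z \<noteq> \<rho>))"
    using main zs by blast
  finally show ?thesis .
qed

end

section \<open>Zeros of the perturbed symbol\<close>

lemma compact_family_bounds:
  fixes f :: "'j \<Rightarrow> 'a::topological_space \<Rightarrow> real"
  assumes "finite J" "compact D" "\<And>j. j \<in> J \<Longrightarrow> continuous_on D (f j)"
    and pos: "\<And>j x. j \<in> J \<Longrightarrow> x \<in> D \<Longrightarrow> 0 < f j x"
  shows "\<exists>c>0. \<exists>C>0. \<forall>j\<in>J. \<forall>x\<in>D. c \<le> f j x \<and> f j x \<le> C"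
  using assms(1,3) pos
proof (induction J rule: finite_induct)
  case empty
  show ?case by (rule exI[of _ 1], intro conjI exI[of _ 1] zero_less_one) simp
next
  case (insert j J)
  have "\<exists>c>0. \<exists>C>0. \<forall>j\<in>J. \<forall>x\<in>D. c \<le> f j x \<and> f j x \<le> C"
    by (rule insert.IH) (use insert.prems in simp_all)
  then obtain c C where c: "0 < c" "0 < C" "\<forall>j\<in>J. \<forall>x\<in>D. c \<le> f j x \<and> f j x \<le> C" by (elim exE conjE)
  show ?case
  proof (cases "D = {}")
    case False
    have cont: "continuous_on D (f j)" by (rule insert.prems(1)) simp
    obtain x where x: "x \<in> D" "\<forall>z\<in>D. f j x \<le> f j z"
      using continuous_attains_inf[OF assms(2) False cont] by (elim bexE)
    obtain y where y: "y \<in> D" "\<forall>z\<in>D. f j z \<le> f j y"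
      using continuous_attains_sup[OF assms(2) False cont] by (elim bexE)
    have "0 < f j x" "0 < f j y" using insert.prems(2) x y by auto
    then show ?thesis using c x y
      by (intro exI[of _ "min c (f j x)"] conjI exI[of _ "max C (f j y)"]) (auto simp: min_le_iff_disj le_max_iff_disj)
  next
    case True
    show ?thesis unfolding True by (rule exI[of _ 1], intro conjI exI[of _ 1] zero_less_one) simp
  qed
qed

text \<open>Products of linear factors with nearby zeros differ by a function with small Lipschitz
  constant. The bounds on the difference itself and on a single product serve the induction,
  which multiplies by one more linear factor.\<close>

lemma prod_difference_lipschitz:
  fixes R :: real
  assumes "0 \<le> R"
  shows "\<exists>C\<ge>0. \<forall>(z :: nat \<Rightarrow> complex) w \<eta>. 0 \<le> \<eta> \<and> (\<forall>i<n. cmod (z i) \<le> R \<and> cmod (w i) \<le> R \<and> cmod (z i - w i) \<le> \<eta>) \<longrightarrow>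
    (\<forall>x y. cmod x \<le> R \<and> cmod y \<le> R \<longrightarrow>
      cmod ((\<Prod>i<n. x - z i) - (\<Prod>i<n. x - w i)) \<le> C * \<eta> \<and>
      cmod (((\<Prod>i<n. x - z i) - (\<Prod>i<n. x - w i)) - ((\<Prod>i<n. y - z i) - (\<Prod>i<n. y - w i))) \<le> C * \<eta> * cmod (x - y) \<and>
      cmod (\<Prod>i<n. x - w i) \<le> C \<and>
      cmod ((\<Prod>i<n. x - w i) - (\<Prod>i<n. y - w i)) \<le> C * cmod (x - y))"
proof (induction n)
  case 0
  show ?case by (intro exI[of _ 1]) auto
next
  case (Suc n)
  then obtain C where C0: "0 \<le> C" and C: "\<And>(z :: nat \<Rightarrow> complex) w \<eta> x y. 0 \<le> \<eta> \<Longrightarrow> (\<forall>i<n. cmod (z i) \<le> R \<and> cmod (w i) \<le> R \<and> cmod (z i - w i) \<le> \<eta>) \<Longrightarrow>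
      cmod x \<le> R \<Longrightarrow> cmod y \<le> R \<Longrightarrow>
      cmod ((\<Prod>i<n. x - z i) - (\<Prod>i<n. x - w i)) \<le> C * \<eta> \<and>
      cmod (((\<Prod>i<n. x - z i) - (\<Prod>i<n. x - w i)) - ((\<Prod>i<n. y - z i) - (\<Prod>i<n. y - w i))) \<le> C * \<eta> * cmod (x - y) \<and>
      cmod (\<Prod>i<n. x - w i) \<le> C \<and>
      cmod ((\<Prod>i<n. x - w i) - (\<Prod>i<n. y - w i)) \<le> C * cmod (x - y)"
    by blast
  show ?case
  proof (intro exI[of _ "(2 * R + 2) * C"] conjI allI impI)
    show "0 \<le> (2 * R + 2) * C" using C0 assms by simp
    fix z w :: "nat \<Rightarrow> complex" and \<eta> :: real and x y
    assume h: "0 \<le> \<eta> \<and> (\<forall>i<Suc n. cmod (z i) \<le> R \<and> cmod (w i) \<le> R \<and> cmod (z i - w i) \<le> \<eta>)" and xy: "cmod x \<le> R \<and> cmod y \<le> R"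
    define A B where "A x = (\<Prod>i<n. x - z i)" and "B x = (\<Prod>i<n. x - w i)" for x
    define Z W where "Z = z n" and "W = w n"
    have e: "0 \<le> \<eta>" "cmod (W - Z) \<le> \<eta>" using h by (auto simp: norm_minus_commute Z_def W_def)
    have ih: "cmod (A x - B x) \<le> C * \<eta>" "cmod ((A x - B x) - (A y - B y)) \<le> C * \<eta> * cmod (x - y)"
      "cmod (B x) \<le> C" "cmod (B x - B y) \<le> C * cmod (x - y)" "cmod (A y - B y) \<le> C * \<eta>" "cmod (B y) \<le> C"
      unfolding A_def B_def using C[of \<eta> z w x y] C[of \<eta> z w y y] h xy by auto
    have xz: "cmod (x - Z) \<le> 2 * R" "cmod (x - W) \<le> 2 * R"
    proof -
      have "cmod Z \<le> R" "cmod W \<le> R" using h by (auto simp: Z_def W_def)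
      then show "cmod (x - Z) \<le> 2 * R" "cmod (x - W) \<le> 2 * R"
        using norm_triangle_ineq4[of x Z] norm_triangle_ineq4[of x W] xy by linarith+
    qed
    have S: "(\<Prod>i<Suc n. x - z i) = (x - Z) * A x" "(\<Prod>i<Suc n. x - w i) = (x - W) * B x" for x
      by (simp_all add: A_def B_def Z_def W_def mult.commute)
    have pr: "cmod (p * q) \<le> P * Q" if "cmod p \<le> P" "cmod q \<le> Q" for p q P Q
      using that order_trans[OF norm_ge_zero that(1)] by (simp add: norm_mult mult_mono)
    have "(x - Z) * A x - (x - W) * B x = (x - Z) * (A x - B x) + (W - Z) * B x" by (simp add: algebra_simps)
    then have "cmod ((x - Z) * A x - (x - W) * B x) \<le> 2 * R * (C * \<eta>) + \<eta> * C"
      using norm_triangle_le[OF add_mono[OF pr[OF xz(1) ih(1)] pr[OF e(2) ih(3)]]] by simp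
    also have "\<dots> \<le> (2 * R + 2) * C * \<eta>" using mult_nonneg_nonneg[OF C0 e(1)] by (simp add: algebra_simps)
    finally show "cmod ((\<Prod>i<Suc n. x - z i) - (\<Prod>i<Suc n. x - w i)) \<le> (2 * R + 2) * C * \<eta>" unfolding S .
    have eq2: "((x - Z) * A x - (x - W) * B x) - ((y - Z) * A y - (y - W) * B y)
        = ((x - Z) * ((A x - B x) - (A y - B y)) + (x - y) * (A y - B y)) + (W - Z) * (B x - B y)" by (simp add: algebra_simps)
    have "cmod (((x - Z) * ((A x - B x) - (A y - B y)) + (x - y) * (A y - B y)) + (W - Z) * (B x - B y))
        \<le> (2 * R * (C * \<eta> * cmod (x - y)) + cmod (x - y) * (C * \<eta>)) + \<eta> * (C * cmod (x - y))"
      by (rule norm_triangle_le[OF add_mono[OF norm_triangle_le[OF add_mono[OF pr[OF xz(1) ih(2)] pr[OF order_refl ih(5)]]] pr[OF e(2) ih(4)]]])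
    also have "\<dots> = (2 * R + 2) * C * \<eta> * cmod (x - y)" by (simp add: algebra_simps)
    finally show "cmod (((\<Prod>i<Suc n. x - z i) - (\<Prod>i<Suc n. x - w i)) - ((\<Prod>i<Suc n. y - z i) - (\<Prod>i<Suc n. y - w i))) \<le> (2 * R + 2) * C * \<eta> * cmod (x - y)"
      unfolding S eq2 .
    have "cmod ((x - W) * B x) \<le> 2 * R * C" by (rule pr[OF xz(2) ih(3)])
    also have "\<dots> \<le> (2 * R + 2) * C" using C0 by (simp add: algebra_simps)
    finally show "cmod (\<Prod>i<Suc n. x - w i) \<le> (2 * R + 2) * C" unfolding S .
    have eq3: "(x - W) * B x - (y - W) * B y = (x - W) * (B x - B y) + (x - y) * B y" by (simp add: algebra_simps)
    have "cmod ((x - W) * (B x - B y) + (x - y) * B y) \<le> 2 * R * (C * cmod (x - y)) + cmod (x - y) * C"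
      by (rule norm_triangle_le[OF add_mono[OF pr[OF xz(2) ih(4)] pr[OF order_refl ih(6)]]])
    also have "\<dots> \<le> (2 * R + 2) * C * cmod (x - y)" using mult_nonneg_nonneg[OF C0 norm_ge_zero[of "x - y"]] by (simp add: algebra_simps)
    finally show "cmod ((\<Prod>i<Suc n. x - w i) - (\<Prod>i<Suc n. y - w i)) \<le> (2 * R + 2) * C * cmod (x - y)" unfolding S eq3 .
  qed
qed

lemma power_lipschitz:
  fixes x y :: complex
  assumes "cmod x \<le> R" "cmod y \<le> R"
  shows "cmod (x ^ n - y ^ n) \<le> real n * R ^ (n - 1) * cmod (x - y)"
proof -
  have "norm (x ^ n - y ^ n) \<le> real n * R ^ (n - 1) * norm (x - y)"
  proof (rule field_differentiable_bound[of "cball 0 R" "\<lambda>x. x ^ n" "\<lambda>x. of_nat n * x ^ (n - 1)"])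
    fix z :: complex assume z: "z \<in> cball 0 R"
    show "((\<lambda>x. x ^ n) has_field_derivative of_nat n * z ^ (n - 1)) (at z within cball 0 R)"
      by (auto intro!: derivative_eq_intros)
    show "norm (of_nat n * z ^ (n - 1)) \<le> real n * R ^ (n - 1)"
      using z by (simp add: norm_mult norm_power mult_left_mono power_mono)
  qed (use assms in auto)
  then show ?thesis .
qed

context banded_symbol
begin

text \<open>The constants come from compactness of the closed disc of radius \<open>2 * \<delta>\<close>. The factor \<open>2\<close>
  leaves room for \<open>\<mu> - E w\<close> when \<open>\<mu>\<close> lies in the disc of radius \<open>\<delta>\<close>.\<close>

lemma branches_uniform:
  assumes g: "branches (ball l0 \<delta>0) g" and \<delta>0: "0 < \<delta>0" and \<rho>: "0 < \<rho>l"
  obtains \<delta> L \<sigma> R1 R2 where "0 < \<delta>" "2 * \<delta> < \<delta>0" "0 < L" "0 < \<sigma>" "0 < R1" "R1 \<le> \<rho>l" "\<rho>h \<le> R2" "0 < R2"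
    "\<And>i \<mu> \<mu>'. i < N \<Longrightarrow> \<mu> \<in> cball l0 (2 * \<delta>) \<Longrightarrow> \<mu>' \<in> cball l0 (2 * \<delta>) \<Longrightarrow> cmod (g i \<mu> - g i \<mu>') \<le> L * cmod (\<mu> - \<mu>')"
    "\<And>i k \<mu>. i < N \<Longrightarrow> k < N \<Longrightarrow> i \<noteq> k \<Longrightarrow> \<mu> \<in> cball l0 (2 * \<delta>) \<Longrightarrow> \<sigma> \<le> cmod (g i \<mu> - g k \<mu>)"
    "\<And>i \<mu>. i < N \<Longrightarrow> \<mu> \<in> cball l0 (2 * \<delta>) \<Longrightarrow> g i \<mu> \<in> annulus R1 R2"
proof -
  define \<delta> where "\<delta> = \<delta>0 / 4"
  define D where "D = cball l0 (2 * \<delta>)"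
  have \<delta>: "0 < \<delta>" "2 * \<delta> < \<delta>0" using \<delta>0 by (auto simp: \<delta>_def)
  have D: "D \<subseteq> ball l0 \<delta>0" "compact D" using \<delta> by (auto simp: D_def)
  have hol: "g i holomorphic_on ball l0 \<delta>0" if "i < N" for i using g that by (auto simp: branches_def)
  have cont: "continuous_on D (g i)" if "i < N" for i
    using hol[OF that] D(1) holomorphic_on_imp_continuous_on holomorphic_on_subset by blast
  have prp: "inj_on (\<lambda>i. g i \<mu>) {..<N}" "\<And>i. i < N \<Longrightarrow> g i \<mu> \<noteq> 0" if "\<mu> \<in> D" for \<mu>
    using g D(1) that by (auto simp: branches_def)
  have dcont: "continuous_on D (deriv (g i))" if "i < N" for i
    using holomorphic_deriv[OF hol[OF that]] D(1) holomorphic_on_imp_continuous_on holomorphic_on_subset by blast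
  have "\<exists>c>0. \<exists>L>0. \<forall>i\<in>{..<N}. \<forall>\<mu>\<in>D. c \<le> 1 + cmod (deriv (g i) \<mu>) \<and> 1 + cmod (deriv (g i) \<mu>) \<le> L"
    by (rule compact_family_bounds) (use D dcont in \<open>auto intro!: continuous_intros add_pos_nonneg\<close>)
  then obtain L where L: "0 < L" "\<And>i \<mu>. i < N \<Longrightarrow> \<mu> \<in> D \<Longrightarrow> 1 + cmod (deriv (g i) \<mu>) \<le> L" by auto
  have "\<exists>c>0. \<exists>C>0. \<forall>i\<in>{..<N}. \<forall>\<mu>\<in>D. c \<le> cmod (g i \<mu>) \<and> cmod (g i \<mu>) \<le> C"
    by (rule compact_family_bounds) (use D cont prp in \<open>auto intro!: continuous_intros\<close>)
  then obtain c C where cC: "0 < c" "0 < C" "\<And>i \<mu>. i < N \<Longrightarrow> \<mu> \<in> D \<Longrightarrow> c \<le> cmod (g i \<mu>) \<and> cmod (g i \<mu>) \<le> C" by auto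
  have "\<exists>c>0. \<exists>C>0. \<forall>p\<in>{(i, k). i < N \<and> k < N \<and> i \<noteq> k}. \<forall>\<mu>\<in>D. c \<le> cmod (g (fst p) \<mu> - g (snd p) \<mu>) \<and> cmod (g (fst p) \<mu> - g (snd p) \<mu>) \<le> C"
  proof (rule compact_family_bounds)
    show "finite {(i, k). i < N \<and> k < N \<and> i \<noteq> k}"
      by (rule finite_subset[of _ "{..<N} \<times> {..<N}"]) auto
    show "0 < cmod (g (fst p) \<mu> - g (snd p) \<mu>)" if "p \<in> {(i, k). i < N \<and> k < N \<and> i \<noteq> k}" "\<mu> \<in> D" for p \<mu>
      using prp(1)[OF that(2)] that(1) by (auto simp: inj_on_def)
  qed (use D cont in \<open>auto intro!: continuous_intros\<close>)
  then obtain \<sigma> where \<sigma>: "0 < \<sigma>" "\<And>i k \<mu>. i < N \<Longrightarrow> k < N \<Longrightarrow> i \<noteq> k \<Longrightarrow> \<mu> \<in> D \<Longrightarrow> \<sigma> \<le> cmod (g i \<mu> - g k \<mu>)"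
    by fastforce
  have lip: "cmod (g i \<mu> - g i \<mu>') \<le> L * cmod (\<mu> - \<mu>')" if i: "i < N" and m: "\<mu> \<in> D" "\<mu>' \<in> D" for i \<mu> \<mu>'
  proof (rule field_differentiable_bound[of D "g i" "deriv (g i)"])
    show "(g i has_field_derivative deriv (g i) z) (at z within D)" if "z \<in> D" for z
      using holomorphic_derivI[OF hol[OF i] open_ball] D(1) that by (meson has_field_derivative_at_within subsetD)
    show "cmod (deriv (g i) z) \<le> L" if "z \<in> D" for z using L(2)[OF i that] by simp
  qed (use m in \<open>auto simp: D_def\<close>)
  show ?thesis
    by (rule that[of \<delta> L \<sigma> "min c \<rho>l" "max C \<rho>h"]) (use \<delta> L(1) \<sigma> cC \<rho> lip in \<open>auto simp: D_def[symmetric] annulus_def min_le_iff_disj le_max_iff_disj\<close>)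
qed

text \<open>The equation \<open>b(w) + E(w) = \<mu>\<close> is solved by fixed points of \<open>w \<mapsto> g\<^sub>i(\<mu> - E(w))\<close>, which
  maps the annulus to itself and contracts with factor \<open>L * \<kappa> \<le> 1 / 2\<close>.\<close>

lemma perturbed_roots:
  assumes g: "branches (ball l0 \<delta>0) g" and \<delta>: "0 < \<delta>" "2 * \<delta> < \<delta>0" and "0 < L" "0 < R1"
    and lip: "\<And>i \<mu> \<mu>'. i < N \<Longrightarrow> \<mu> \<in> cball l0 (2 * \<delta>) \<Longrightarrow> \<mu>' \<in> cball l0 (2 * \<delta>) \<Longrightarrow> cmod (g i \<mu> - g i \<mu>') \<le> L * cmod (\<mu> - \<mu>')"
    and R: "\<And>i \<mu>. i < N \<Longrightarrow> \<mu> \<in> cball l0 (2 * \<delta>) \<Longrightarrow> g i \<mu> \<in> annulus R1 R2"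
    and \<kappa>: "0 \<le> \<kappa>" "\<kappa> \<le> \<delta>" "L * \<kappa> \<le> 1 / 2" and E: "small_lipschitz (annulus R1 R2) \<kappa> E"
  obtains w where
    "\<And>i \<mu>. i < N \<Longrightarrow> \<mu> \<in> ball l0 \<delta> \<Longrightarrow> w i \<mu> \<in> annulus R1 R2"
    "\<And>i \<mu>. i < N \<Longrightarrow> \<mu> \<in> ball l0 \<delta> \<Longrightarrow> symb (w i \<mu>) + E (w i \<mu>) = \<mu>"
    "\<And>i \<mu>. i < N \<Longrightarrow> \<mu> \<in> ball l0 \<delta> \<Longrightarrow> cmod (g i \<mu> - w i \<mu>) \<le> L * \<kappa>"
    "\<And>i \<mu> \<mu>'. i < N \<Longrightarrow> \<mu> \<in> ball l0 \<delta> \<Longrightarrow> \<mu>' \<in> ball l0 \<delta> \<Longrightarrow> cmod (w i \<mu> - w i \<mu>') \<le> 2 * L * cmod (\<mu> - \<mu>')"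
proof -
  define S where "S = annulus R1 R2"
  note E1 = small_lipschitzD(1)[OF E, folded S_def] and E2 = small_lipschitzD(2)[OF E, folded S_def]
  have mem: "\<mu> - E w \<in> cball l0 (2 * \<delta>)" if "\<mu> \<in> ball l0 \<delta>" "w \<in> S" for \<mu> w
  proof -
    have eq: "l0 - (\<mu> - E w) = l0 - \<mu> + E w" by simp
    have "cmod (l0 - (\<mu> - E w)) \<le> cmod (l0 - \<mu>) + cmod (E w)" unfolding eq by (rule norm_triangle_ineq)
    moreover have "cmod (l0 - \<mu>) < \<delta>" using that(1) by (simp add: dist_norm)
    moreover have "cmod (E w) \<le> \<kappa>" using E1 that(2) by blast
    ultimately show ?thesis using \<kappa>(2) unfolding mem_cball dist_norm by linarith
  qed
  have ex: "\<exists>w\<in>S. g i (\<mu> - E w) = w" if i: "i < N" and \<mu>: "\<mu> \<in> ball l0 \<delta>" for i \<mu>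
  proof -
    have "\<exists>!w\<in>S. g i (\<mu> - E w) = w"
    proof (rule Banach_fix[where c = "1 / 2"])
      show "complete S" unfolding S_def by (intro compact_imp_complete compact_annulus)
      have "g i \<mu> \<in> S" using R[OF i, of \<mu>] \<mu> \<delta> by (auto simp: S_def)
      then show "S \<noteq> {}" by blast
      show "(\<lambda>w. g i (\<mu> - E w)) ` S \<subseteq> S" using R[OF i mem[OF \<mu>]] by (auto simp: S_def)
      fix x y assume xy: "x \<in> S" "y \<in> S"
      have "cmod (g i (\<mu> - E x) - g i (\<mu> - E y)) \<le> L * cmod ((\<mu> - E x) - (\<mu> - E y))"
        by (rule lip[OF i mem[OF \<mu> xy(1)] mem[OF \<mu> xy(2)]])
      also have "(\<mu> - E x) - (\<mu> - E y) = E y - E x" by simp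
      also have "L * cmod (E y - E x) \<le> L * (\<kappa> * cmod (y - x))"
        using E2 xy \<open>0 < L\<close> by (intro mult_left_mono) auto
      also have "\<dots> = (L * \<kappa>) * cmod (y - x)" by simp
      also have "\<dots> \<le> 1 / 2 * cmod (y - x)" using \<kappa>(3) by (intro mult_right_mono) auto
      finally show "dist (g i (\<mu> - E x)) (g i (\<mu> - E y)) \<le> 1 / 2 * dist x y" by (simp add: dist_norm norm_minus_commute)
    qed auto
    then show ?thesis by blast
  qed
  then obtain w where w: "\<And>i \<mu>. i < N \<Longrightarrow> \<mu> \<in> ball l0 \<delta> \<Longrightarrow> w i \<mu> \<in> S \<and> g i (\<mu> - E (w i \<mu>)) = w i \<mu>"
    by metis
  show ?thesis
  proof (rule that[of w])
    fix i \<mu> assume i: "i < N" and \<mu>: "\<mu> \<in> ball l0 \<delta>"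
    note W = w[OF i \<mu>]
    show "w i \<mu> \<in> annulus R1 R2" using W by (simp add: S_def)
    have m: "\<mu> - E (w i \<mu>) \<in> cball l0 (2 * \<delta>)" using mem[OF \<mu>] W by blast
    then have "\<mu> - E (w i \<mu>) \<in> ball l0 \<delta>0" using \<delta> by auto
    then have "symb (g i (\<mu> - E (w i \<mu>))) = \<mu> - E (w i \<mu>)" using g i by (auto simp: branches_def)
    then show "symb (w i \<mu>) + E (w i \<mu>) = \<mu>" using W by simp
    have "\<mu> \<in> cball l0 (2 * \<delta>)" using \<mu> \<delta> by auto
    then have "cmod (g i \<mu> - g i (\<mu> - E (w i \<mu>))) \<le> L * cmod (\<mu> - (\<mu> - E (w i \<mu>)))" by (rule lip[OF i _ m])
    also have "\<dots> \<le> L * \<kappa>" using E1 W \<open>0 < L\<close> by (auto intro!: mult_left_mono)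
    finally show "cmod (g i \<mu> - w i \<mu>) \<le> L * \<kappa>" using W by simp
    fix \<mu>' assume \<mu>': "\<mu>' \<in> ball l0 \<delta>"
    note W' = w[OF i \<mu>']
    define d where "d = cmod (w i \<mu> - w i \<mu>')"
    have "d = cmod (g i (\<mu> - E (w i \<mu>)) - g i (\<mu>' - E (w i \<mu>')))" using W W' by (simp add: d_def)
    also have "\<dots> \<le> L * cmod ((\<mu> - E (w i \<mu>)) - (\<mu>' - E (w i \<mu>')))"
      using mem[OF \<mu>] mem[OF \<mu>'] W W' by (intro lip[OF i]) auto
    also have "(\<mu> - E (w i \<mu>)) - (\<mu>' - E (w i \<mu>')) = (\<mu> - \<mu>') - (E (w i \<mu>) - E (w i \<mu>'))" by simp
    also have "L * cmod ((\<mu> - \<mu>') - (E (w i \<mu>) - E (w i \<mu>'))) \<le> L * (cmod (\<mu> - \<mu>') + \<kappa> * d)"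
      using norm_triangle_ineq4[of "\<mu> - \<mu>'" "E (w i \<mu>) - E (w i \<mu>')"] E2[of "w i \<mu>" "w i \<mu>'"] W W' \<open>0 < L\<close>
      by (intro mult_left_mono) (auto simp: d_def)
    also have "\<dots> = L * cmod (\<mu> - \<mu>') + (L * \<kappa>) * d" by (simp add: algebra_simps)
    also have "(L * \<kappa>) * d \<le> 1 / 2 * d" using \<kappa>(3) by (intro mult_right_mono) (auto simp: d_def)
    finally have "d \<le> 2 * L * cmod (\<mu> - \<mu>')" by simp
    then show "cmod (w i \<mu> - w i \<mu>') \<le> 2 * L * cmod (\<mu> - \<mu>')" by (simp add: d_def)
  qed
qed

end

lemma polygon_dilate:
  assumes "0 < \<rho>" "t \<in> circle"
  shows "polygon vs (dilate \<rho> (laurent_poly b r s)) t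
    = laurent_poly b r s (of_real \<rho> * t) + polygon_error b r s vs (of_real \<rho> * t)"
proof -
  have "cmod (of_real \<rho> * t) = \<rho>" "sgn (of_real \<rho> * t) = t"
    using assms by (auto simp: norm_mult sgn_mult sgn_eq)
  then show ?thesis by (simp add: polygon_error_def)
qed

lemma polygon_continuous:
  assumes \<rho>: "0 < \<rho>" and vs: "vs \<in> partitions 0 (2*pi) \<Delta>"
  shows "continuous_on circle (polygon vs (dilate \<rho> (laurent_poly b r s)))"
proof -
  have \<Delta>: "0 \<le> \<Delta>" by (rule partitions_nonneg[OF vs])
  obtain C where C0: "0 \<le> C" and C: "\<And>\<Delta> vs. vs \<in> partitions 0 (2*pi) \<Delta> \<Longrightarrow>
      small_lipschitz (annulus \<rho> \<rho>) (C * \<Delta>) (polygon_error b r s vs)"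
    using polygon_error_bound[OF \<rho>, of \<rho> b r s] by blast
  have "continuous_on circle (\<lambda>t. polygon_error b r s vs (of_real \<rho> * t))"
  proof (rule lipschitz_on_continuous_on[where L = "C * \<Delta> * \<rho>"], rule lipschitz_onI)
    fix t t' assume t: "t \<in> circle" "t' \<in> circle"
    have "cmod (polygon_error b r s vs (of_real \<rho> * t) - polygon_error b r s vs (of_real \<rho> * t')) \<le> C * \<Delta> * cmod (of_real \<rho> * t - of_real \<rho> * t')"
      by (rule small_lipschitzD(2)[OF C[OF vs]]) (use t \<rho> in \<open>auto simp: norm_mult annulus_def\<close>)
    also have "\<dots> = C * \<Delta> * \<rho> * cmod (t - t')"
      using \<rho> by (simp add: right_diff_distrib[symmetric] norm_mult)
    finally show "dist (polygon_error b r s vs (of_real \<rho> * t)) (polygon_error b r s vs (of_real \<rho> * t')) \<le> C * \<Delta> * \<rho> * dist t t'"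
      by (simp add: dist_norm)
  qed (use C0 \<Delta> \<rho> in simp)
  moreover have "continuous_on circle (\<lambda>t. laurent_poly b r s (of_real \<rho> * t))"
    unfolding laurent_poly_def using \<rho> by (intro continuous_intros) auto
  ultimately have "continuous_on circle (\<lambda>t. laurent_poly b r s (of_real \<rho> * t) + polygon_error b r s vs (of_real \<rho> * t))"
    by (intro continuous_intros)
  then show ?thesis by (rule continuous_on_eq) (simp add: polygon_dilate[OF \<rho>])
qed

lemma zeros_inside_prod_linear:
  fixes n :: nat
  assumes "c \<noteq> 0"
  shows "zeros_inside (smult c (\<Prod>i<n. [:- w i, 1:])) \<rho> = card {i. i < n \<and> cmod (w i) < \<rho>}"
proof -
  have "proots (\<Prod>i<n. [:- w i, 1:]) = (\<Sum>i<n. {#w i#})" by (subst proots_prod) auto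
  also have "\<dots> = image_mset w (mset_set {..<n})" by (simp add: sum_unfold_sum_mset)
  finally have "proots (\<Prod>i<n. [:- w i, 1:]) = image_mset w (mset_set {..<n})" .
  moreover have "filter_mset (\<lambda>i. cmod (w i) < \<rho>) (mset_set {..<n}) = mset_set {i \<in> {..<n}. cmod (w i) < \<rho>}"
    by (rule filter_mset_mset_set) simp
  ultimately show ?thesis using assms by (simp add: zeros_inside_def filter_mset_image_mset)
qed

context banded_symbol
begin

lemma chi_eq_prod_poly:
  assumes "branches D g" "\<mu> \<in> D"
  shows "chi \<mu> = smult (b (int s)) (\<Prod>i<N. [:- g i \<mu>, 1:])"
proof -
  define q where "q = smult (b (int s)) (\<Prod>i<N. [:- g i \<mu>, 1:])"
  have deg: "degree (\<Prod>i<N. [:- g i \<mu>, 1:]) = N" by (subst degree_prod_eq_sum_degree) auto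
  have "coeff (\<Prod>i<N. [:- g i \<mu>, 1:]) N = lead_coeff (\<Prod>i<N. [:- g i \<mu>, 1:])" by (simp only: deg)
  also have "\<dots> = 1" by (simp add: lead_coeff_prod)
  finally have lead: "coeff q N = b (int s)" by (simp add: q_def)
  have "chi \<mu> = q"
  proof (rule poly_eqI_degree_lead_coeff[where A = "(\<lambda>i. g i \<mu>) ` {..<N}" and n = N])
    show "coeff (chi \<mu>) N = coeff q N" using lead_coeff_chi[of \<mu>] lead by (simp only: degree_chi)
    show "N \<le> card ((\<lambda>i. g i \<mu>) ` {..<N})" using assms by (simp add: branches_def card_image)
    show "degree (chi \<mu>) \<le> N" by (simp add: degree_chi)
    show "degree q \<le> N" unfolding q_def using bs by (simp add: deg)
    fix z assume z: "z \<in> (\<lambda>i. g i \<mu>) ` {..<N}"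
    then have "poly (chi \<mu>) z = 0" using branches_roots[OF assms] by blast
    moreover have "poly q z = 0" using z by (auto simp: q_def poly_prod intro!: prod_zero)
    ultimately show "poly (chi \<mu>) z = poly q z" by simp
  qed
  then show ?thesis by (simp add: q_def)
qed

lemma chi_eq_prod:
  assumes "branches D g" "\<mu> \<in> D"
  shows "poly (chi \<mu>) x = b (int s) * (\<Prod>i<N. x - g i \<mu>)"
  unfolding chi_eq_prod_poly[OF assms] by (simp add: poly_prod)

lemma zeros_inside_branches:
  assumes "branches D g" "\<mu> \<in> D"
  shows "zeros_inside (chi \<mu>) \<rho> = card {i. i < N \<and> cmod (g i \<mu>) < \<rho>}"
  unfolding chi_eq_prod_poly[OF assms] using bs by (rule zeros_inside_prod_linear)

text \<open>Up to the factor \<open>x\<^sup>r\<close>, the perturbed symbol \<open>b + E - \<mu>\<close> is close to the polynomial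
  \<open>b\<^sub>s (x - w\<^sub>0) (x - w\<^sub>1) \<dots>\<close> whose zeros are its own zeros \<open>w\<^sub>i\<close>, and the relative error is at
  most one half even where both vanish. Their difference \<open>F\<close> vanishes at every \<open>w\<^sub>i\<close> and has
  Lipschitz constant \<open>A * \<kappa>\<close>, so \<open>\<bar>F(x)\<bar> \<le> A * \<kappa> * \<bar>x - w\<^sub>i\<bar>\<close> for the \<open>w\<^sub>i\<close> nearest to \<open>x\<close>. The
  product is at least \<open>\<bar>b\<^sub>s\<bar> * \<bar>x - w\<^sub>i\<bar> * (\<sigma> / 4)\<^sup>N\<^sup>-\<^sup>1\<close>, because the other zeros are not near
  \<open>x\<close>.\<close>

lemma perturbed_comparison:
  assumes R: "0 < R1" "R1 \<le> R2" and L: "0 < L" and \<sigma>: "0 < \<sigma>"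
  obtains \<kappa>0 where "0 < \<kappa>0" "\<And>\<kappa> E \<mu> z w x. 0 \<le> \<kappa> \<Longrightarrow> \<kappa> \<le> \<kappa>0 \<Longrightarrow> small_lipschitz (annulus R1 R2) \<kappa> E \<Longrightarrow>
    \<forall>i<N. w i \<in> annulus R1 R2 \<and> cmod (z i) \<le> R2 \<and> cmod (z i - w i) \<le> L * \<kappa> \<and> symb (w i) + E (w i) = \<mu> \<Longrightarrow>
    \<forall>i<N. \<forall>k<N. i \<noteq> k \<longrightarrow> \<sigma> \<le> cmod (z i - z k) \<Longrightarrow>
    \<forall>x. poly (chi \<mu>) x = b (int s) * (\<Prod>i<N. x - z i) \<Longrightarrow> x \<in> annulus R1 R2 \<Longrightarrow>
    cmod (x ^ r * (symb x + E x - \<mu>) - b (int s) * (\<Prod>i<N. x - w i)) \<le> cmod (b (int s) * (\<Prod>i<N. x - w i)) / 2"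
proof -
  have R2: "0 \<le> R2" using R by simp
  obtain C where C0: "0 \<le> C" and C: "\<And>(z :: nat \<Rightarrow> complex) w \<eta> x y. 0 \<le> \<eta> \<Longrightarrow> (\<forall>i<N. cmod (z i) \<le> R2 \<and> cmod (w i) \<le> R2 \<and> cmod (z i - w i) \<le> \<eta>) \<Longrightarrow>
      cmod x \<le> R2 \<Longrightarrow> cmod y \<le> R2 \<Longrightarrow>
      cmod (((\<Prod>i<N. x - z i) - (\<Prod>i<N. x - w i)) - ((\<Prod>i<N. y - z i) - (\<Prod>i<N. y - w i))) \<le> C * \<eta> * cmod (x - y)"
    using prod_difference_lipschitz[OF R2, of N] by blast
  define \<beta> where "\<beta> = cmod (b (int s))"
  have \<beta>: "0 < \<beta>" using bs by (simp add: \<beta>_def)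
  define A where "A = \<beta> * (C * L) + (R2 ^ r + real r * R2 ^ (r - 1)) + 1"
  have A: "0 < A" unfolding A_def using \<beta> C0 L R2 by (intro add_nonneg_pos add_nonneg_nonneg mult_nonneg_nonneg) auto
  \<comment> \<open>The first bound keeps the \<open>w\<^sub>i\<close> apart by \<open>3 * \<sigma> / 4\<close>, the second one makes the relative
    error at most \<open>1 / 2\<close>.\<close>
  define \<kappa>0 where "\<kappa>0 = min (\<sigma> / (8 * L)) (\<beta> * (\<sigma> / 4) ^ (N - 1) / (2 * A))"
  have \<kappa>0: "0 < \<kappa>0" unfolding \<kappa>0_def using \<sigma> L \<beta> A by simp
  have main: "cmod (x ^ r * (symb x + E x - \<mu>) - b (int s) * (\<Prod>i<N. x - w i)) \<le> cmod (b (int s) * (\<Prod>i<N. x - w i)) / 2"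
    if \<kappa>: "0 \<le> \<kappa>" "\<kappa> \<le> \<kappa>0" and E: "small_lipschitz (annulus R1 R2) \<kappa> E"
      and w': "\<forall>i<N. w i \<in> annulus R1 R2 \<and> cmod (z i) \<le> R2 \<and> cmod (z i - w i) \<le> L * \<kappa> \<and> symb (w i) + E (w i) = \<mu>"
      and z: "\<forall>i<N. \<forall>k<N. i \<noteq> k \<longrightarrow> \<sigma> \<le> cmod (z i - z k)"
      and chi: "\<forall>x. poly (chi \<mu>) x = b (int s) * (\<Prod>i<N. x - z i)"
      and x': "x \<in> annulus R1 R2"
    for \<kappa> E \<mu> z w x
  proof -
    have x: "R1 \<le> cmod x" "cmod x \<le> R2" using x' by (auto simp: annulus_def)
    have w: "\<forall>i<N. R1 \<le> cmod (w i) \<and> cmod (w i) \<le> R2 \<and> cmod (z i) \<le> R2 \<and> cmod (z i - w i) \<le> L * \<kappa> \<and> symb (w i) + E (w i) = \<mu>"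
      using w' by (simp add: annulus_def)
    have L\<kappa>: "L * \<kappa> \<le> \<sigma> / 8"
    proof -
      have "\<kappa> \<le> \<sigma> / (8 * L)" using \<kappa>(2) by (simp add: \<kappa>0_def)
      then show ?thesis using L by (simp add: field_simps)
    qed
    have A\<kappa>: "A * \<kappa> \<le> \<beta> * (\<sigma> / 4) ^ (N - 1) / 2"
    proof -
      have "\<kappa> \<le> \<beta> * (\<sigma> / 4) ^ (N - 1) / (2 * A)" using \<kappa>(2) by (simp add: \<kappa>0_def)
      then have "A * \<kappa> \<le> A * (\<beta> * (\<sigma> / 4) ^ (N - 1) / (2 * A))" using A by (intro mult_left_mono) auto
      then show ?thesis using A by simp
    qed
    define F where "F x = x ^ r * (symb x + E x - \<mu>) - b (int s) * (\<Prod>i<N. x - w i)" for x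
    have Feq: "F y = b (int s) * ((\<Prod>i<N. y - z i) - (\<Prod>i<N. y - w i)) + y ^ r * E y" if "R1 \<le> cmod y" for y
    proof -
      have "y \<noteq> 0" using that R by auto
      then have "y ^ r * (symb y - \<mu>) = b (int s) * (\<Prod>i<N. y - z i)" using poly_chi[of y \<mu>] chi by simp
      then show ?thesis by (simp add: F_def algebra_simps)
    qed
    have Flip: "cmod (F x - F y) \<le> A * \<kappa> * cmod (x - y)" if y: "R1 \<le> cmod y" "cmod y \<le> R2" for y
    proof -
      define P where "P x = (\<Prod>i<N. x - z i) - (\<Prod>i<N. x - w i)" for x
      have p1: "cmod (P x - P y) \<le> C * (L * \<kappa>) * cmod (x - y)"
        unfolding P_def by (rule C) (use w x y L \<kappa> in auto)
      have p2: "cmod (x ^ r) \<le> R2 ^ r" using x by (simp add: norm_power power_mono)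
      have y': "y \<in> annulus R1 R2" using y by (simp add: annulus_def)
      have p3: "cmod (E x - E y) \<le> \<kappa> * cmod (x - y)" by (rule small_lipschitzD(2)[OF E x' y'])
      have p4: "cmod (x ^ r - y ^ r) \<le> real r * R2 ^ (r - 1) * cmod (x - y)" by (rule power_lipschitz[OF x(2) y(2)])
      have p5: "cmod (E y) \<le> \<kappa>" by (rule small_lipschitzD(1)[OF E y' y'])
      have "F x - F y = b (int s) * (P x - P y) + (x ^ r * (E x - E y) + (x ^ r - y ^ r) * E y)"
        unfolding Feq[OF x(1)] Feq[OF y(1)] P_def by (simp add: algebra_simps)
      also have "cmod \<dots> \<le> cmod (b (int s) * (P x - P y)) + (cmod (x ^ r * (E x - E y)) + cmod ((x ^ r - y ^ r) * E y))"
        by (rule order_trans[OF norm_triangle_ineq add_left_mono[OF norm_triangle_ineq]])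
      also have "\<dots> \<le> \<beta> * (C * (L * \<kappa>) * cmod (x - y)) + (R2 ^ r * (\<kappa> * cmod (x - y)) + real r * R2 ^ (r - 1) * cmod (x - y) * \<kappa>)"
        unfolding norm_mult \<beta>_def[symmetric] using \<beta> R2 p1 p2 p3 p4 p5
        by (intro add_mono mult_mono) auto
      also have "\<dots> = (\<beta> * (C * L) + (R2 ^ r + real r * R2 ^ (r - 1))) * (\<kappa> * cmod (x - y))" by (simp add: algebra_simps)
      also have "\<dots> \<le> A * (\<kappa> * cmod (x - y))" using \<kappa>(1) by (intro mult_right_mono) (auto simp: A_def)
      finally show ?thesis by (simp add: mult.assoc)
    qed
    have "{..<N} \<noteq> {}" using r by auto
    then have "Min ((\<lambda>k. cmod (x - w k)) ` {..<N}) \<in> (\<lambda>k. cmod (x - w k)) ` {..<N}"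
      by (intro Min_in) auto
    then obtain i where "i \<in> {..<N}" and imin': "Min ((\<lambda>k. cmod (x - w k)) ` {..<N}) = cmod (x - w i)"
      by (elim imageE)
    then have i: "i < N" by simp
    have imin: "cmod (x - w i) \<le> cmod (x - w k)" if "k < N" for k
      unfolding imin'[symmetric] using that by (intro Min_le) auto
    have far: "\<sigma> / 4 \<le> cmod (x - w k)" if k: "k < N" "k \<noteq> i" for k
    proof -
      have "cmod (z i - z k) \<le> cmod (z i - w i) + cmod (w i - w k) + cmod (w k - z k)"
        using norm_triangle_ineq[of "z i - w i" "w i - w k"] norm_triangle_ineq[of "z i - w k" "w k - z k"] by simp
      moreover have "\<sigma> \<le> cmod (z i - z k)" using z i k by simp
      moreover have "cmod (z i - w i) \<le> L * \<kappa>" using w i by simp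
      moreover have "cmod (w k - z k) \<le> L * \<kappa>" using w k by (simp add: norm_minus_commute)
      ultimately have "\<sigma> \<le> \<sigma> / 8 + cmod (w i - w k) + \<sigma> / 8" using L\<kappa> by linarith
      moreover have "cmod (w i - w k) \<le> cmod (x - w i) + cmod (x - w k)"
        using norm_triangle_ineq4[of "x - w k" "x - w i"] by simp
      ultimately show ?thesis using imin[OF k(1)] \<sigma> by linarith
    qed
    have "cmod (F x) = cmod (F x - F (w i))" 
    proof -
      have "R1 \<le> cmod (w i)" "symb (w i) + E (w i) = \<mu>" using w i by auto
      moreover have "(\<Prod>k<N. w i - w k) = 0" using i by (intro prod_zero) auto
      ultimately have "F (w i) = 0" by (simp add: F_def)
      then show ?thesis by simp
    qed
    also have "\<dots> \<le> A * \<kappa> * cmod (x - w i)" using w i by (intro Flip) auto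
    also have "\<dots> \<le> \<beta> * (\<sigma> / 4) ^ (N - 1) / 2 * cmod (x - w i)" using A\<kappa> by (intro mult_right_mono) auto
    also have "\<dots> \<le> cmod (b (int s) * (\<Prod>k<N. x - w k)) / 2"
    proof -
      have "(\<Prod>k\<in>{..<N} - {i}. \<sigma> / 4) \<le> (\<Prod>k\<in>{..<N} - {i}. cmod (x - w k))"
        using far \<sigma> by (intro prod_mono) auto
      then have "(\<sigma> / 4) ^ (N - 1) \<le> (\<Prod>k\<in>{..<N} - {i}. cmod (x - w k))" using i by simp
      then have "cmod (x - w i) * (\<sigma> / 4) ^ (N - 1) \<le> cmod (x - w i) * (\<Prod>k\<in>{..<N} - {i}. cmod (x - w k))"
        by (intro mult_left_mono) auto
      also have "\<dots> = cmod (\<Prod>k<N. x - w k)" using i by (simp add: prod_norm[symmetric] norm_mult prod.remove[of "{..<N}" i])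
      finally have "\<beta> * (cmod (x - w i) * (\<sigma> / 4) ^ (N - 1)) \<le> \<beta> * cmod (\<Prod>k<N. x - w k)"
        using \<beta> by (intro mult_left_mono) auto
      then show ?thesis by (simp add: norm_mult \<beta>_def mult_ac)
    qed
    finally show ?thesis unfolding F_def .
  qed
  show ?thesis by (rule that[OF \<kappa>0]) (rule main; assumption)
qed

definition polygon_spectrum :: "real list \<Rightarrow> real \<Rightarrow> complex set" where
  "polygon_spectrum vs \<rho> = ell2_spectrum (toeplitz (polygon vs (dilate \<rho> symb)))"

text \<open>On the circle of radius \<open>\<rho>\<close>, rescaled to the unit circle, the product polynomial is a
  comparison function as required by the counting theorem.\<close>

lemma invertible_count:
  assumes \<rho>: "0 < \<rho>" "R1 \<le> \<rho>" "\<rho> \<le> R2" and vs: "vs \<in> partitions 0 (2*pi) \<Delta>"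
    and \<mu>: "\<mu> \<notin> polygon_spectrum vs \<rho>"
    and near: "\<And>x. x \<in> annulus R1 R2 \<Longrightarrow>
      cmod (x ^ r * (symb x + polygon_error b r s vs x - \<mu>) - b (int s) * (\<Prod>i<N. x - w i)) \<le> cmod (b (int s) * (\<Prod>i<N. x - w i)) / 2"
  shows "card {i. i < N \<and> cmod (w i) < \<rho>} = r" "\<And>i. i < N \<Longrightarrow> cmod (w i) \<noteq> \<rho>"
proof -
  define q where "q = smult (b (int s)) (\<Prod>i<N. [:- w i, 1:])"
  have q0: "q \<noteq> 0" using bs by (simp add: q_def)
  have pq: "poly q x = b (int s) * (\<Prod>i<N. x - w i)" for x by (simp add: q_def poly_prod)
  define Q where "Q = smult (1 / of_real \<rho> ^ r) (pcompose q [:0, of_real \<rho>:])"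
  define a where "a t = polygon vs (dilate \<rho> symb) t - \<mu>" for t
  have cont: "continuous_on circle (polygon vs (dilate \<rho> symb))" by (rule polygon_continuous[OF \<rho>(1) vs])
  have inv: "toeplitz_invertible a"
    using \<mu> toeplitz_spectrum_iff[OF cont] by (simp add: a_def[abs_def] polygon_spectrum_def)
  have conta: "continuous_on circle a" unfolding a_def by (intro continuous_intros cont)
  have QT: "poly Q t = poly q (of_real \<rho> * t) / of_real \<rho> ^ r" for t
    by (simp add: Q_def poly_pcompose mult.commute)
  have close: "cmod (a t - laurent_form Q r t) \<le> cmod (laurent_form Q r t) / 2" if t: "t \<in> circle" for t
  proof -
    define x where "x = of_real \<rho> * t"
    have x: "cmod x = \<rho>" "x \<noteq> 0" using t \<rho> by (auto simp: x_def norm_mult)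
    have lf: "laurent_form Q r t = poly q x / x ^ r"
      by (simp add: laurent_form_def QT x_def power_mult_distrib)
    have at: "a t = symb x + polygon_error b r s vs x - \<mu>"
      using polygon_dilate[OF \<rho>(1) t] by (simp add: a_def x_def)
    have "a t - laurent_form Q r t = (x ^ r * (symb x + polygon_error b r s vs x - \<mu>) - poly q x) / x ^ r"
      unfolding lf at using x(2) by (simp add: diff_divide_distrib)
    also have "cmod \<dots> = cmod (x ^ r * (symb x + polygon_error b r s vs x - \<mu>) - poly q x) / cmod (x ^ r)"
      by (simp only: norm_divide)
    also have "\<dots> \<le> (cmod (poly q x) / 2) / cmod (x ^ r)"
      unfolding pq using near[of x] x \<rho> by (intro divide_right_mono) (auto simp: annulus_def)
    also have "\<dots> = cmod (laurent_form Q r t) / 2" unfolding lf by (simp add: norm_divide)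
    finally show ?thesis .
  qed
  have count: "zeros_inside Q 1 = r" "\<And>t. t \<in> circle \<Longrightarrow> poly Q t \<noteq> 0"
    using toeplitz_invertible_count[OF conta inv, of Q r] close by blast+
  have "zeros_inside Q 1 = zeros_inside (pcompose q [:0, of_real \<rho>:]) 1"
    using \<rho>(1) by (simp add: zeros_inside_def Q_def)
  also have "\<dots> = zeros_inside q \<rho>" by (rule zeros_inside_scale[OF q0 \<rho>(1)])
  also have "\<dots> = card {i. i < N \<and> cmod (w i) < \<rho>}"
    unfolding q_def using bs by (rule zeros_inside_prod_linear)
  finally show "card {i. i < N \<and> cmod (w i) < \<rho>} = r" using count(1) by simp
  fix i assume i: "i < N"
  show "cmod (w i) \<noteq> \<rho>"
  proof
    assume wi: "cmod (w i) = \<rho>"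
    define t where "t = w i / of_real \<rho>"
    have t: "t \<in> circle" "of_real \<rho> * t = w i" using wi \<rho>(1) by (auto simp: t_def norm_divide)
    have "poly q (w i) = 0" using i by (auto simp: pq intro!: prod_zero)
    then have "poly Q t = 0" by (simp add: QT t(2))
    with count(2)[OF t(1)] show False by simp
  qed
qed

end

text \<open>Multiplication by nonzero numbers acts freely away from \<open>0\<close>, so orbits have \<open>card G\<close>
  elements. Remove them one by one.\<close>

lemma card_dvd_free_action:
  fixes G A :: "complex set"
  assumes G: "finite G" "1 \<in> G" "0 \<notin> G" "\<And>x y. x \<in> G \<Longrightarrow> y \<in> G \<Longrightarrow> x * y \<in> G" "\<And>x. x \<in> G \<Longrightarrow> inverse x \<in> G"
    and "finite A" "0 \<notin> A" "\<And>x a. x \<in> G \<Longrightarrow> a \<in> A \<Longrightarrow> x * a \<in> A"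
  shows "card G dvd card A"
  using assms(6-8)
proof (induction "card A" arbitrary: A rule: less_induct)
  case less
  show ?case
  proof (cases "A = {}")
    case False
    then obtain a where a: "a \<in> A" by blast
    then have a0: "a \<noteq> 0" using less.prems(2) by blast
    define B where "B = (\<lambda>x. x * a) ` G"
    have B: "B \<subseteq> A" using less.prems(3) a by (auto simp: B_def)
    have cardB: "card B = card G" unfolding B_def using a0 by (intro card_image inj_onI) simp
    have "B \<noteq> {}" using G(2) by (auto simp: B_def)
    have dvd: "card G dvd card (A - B)"
    proof (rule less.hyps)
      show "card (A - B) < card A"
        using less.prems(1) B \<open>B \<noteq> {}\<close> by (intro psubset_card_mono) auto
      show "finite (A - B)" "0 \<notin> A - B" using less.prems by auto
      fix x c assume x: "x \<in> G" and c: "c \<in> A - B"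
      have "x * c \<notin> B"
      proof
        assume "x * c \<in> B"
        then obtain y where y: "y \<in> G" "x * c = y * a" by (auto simp: B_def)
        have "x \<noteq> 0" using x G(3) by blast
        then have "c = (inverse x * y) * a" using y(2) by (simp add: field_simps)
        moreover have "inverse x * y \<in> G" using G(4,5) x y(1) by blast
        ultimately have "c \<in> B" unfolding B_def by blast
        then show False using c by blast
      qed
      then show "x * c \<in> A - B" using less.prems(3) x c by blast
    qed
    have "card A = card B + card (A - B)"
      using card_mono[OF less.prems(1) B] by (simp add: card_Diff_subset[OF finite_subset[OF B less.prems(1)] B])
    then show ?thesis using dvd cardB by simp
  qed simp
qed

context banded_symbol
begin

text \<open>The slack \<open>\<eta>\<close> pays for passing from perturbed zeros back to the branches.\<close>

definition dominates :: "complex set \<Rightarrow> (nat \<Rightarrow> complex \<Rightarrow> complex) \<Rightarrow> nat set \<Rightarrow> real \<Rightarrow> bool" where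
  "dominates D g I \<eta> \<longleftrightarrow> (\<forall>\<mu>\<in>D. \<forall>i\<in>I. \<forall>k\<in>{..<N} - I. cmod (g i \<mu>) \<le> cmod (g k \<mu>) + \<eta>)"

text \<open>If every \<open>\<mu>\<close> in the disc is missed by some polygon spectrum, the counting theorem
  separates \<open>r\<close> of the perturbed zeros from the others by a circle, whose radius may depend on
  \<open>\<mu>\<close>. The separated index set is nevertheless unique, and it is locally constant because the
  perturbed zeros depend continuously on \<open>\<mu>\<close>. The disc does not depend on \<open>\<eta>\<close>, which permits the
  limit \<open>\<eta> \<longlongrightarrow> 0\<close> later on.\<close>

lemma branches_separate:
  assumes g: "branches (ball l0 \<delta>0) g" and \<delta>0: "0 < \<delta>0" and \<rho>l: "0 < \<rho>l"
  obtains \<delta> where "0 < \<delta>" "\<delta> < \<delta>0"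
    "\<And>\<eta>. 0 < \<eta> \<Longrightarrow> \<exists>\<Delta>0>0. \<forall>vs\<in>partitions 0 (2*pi) \<Delta>0. \<forall>P\<subseteq>{\<rho>l..\<rho>h}.
      (\<forall>\<mu>\<in>ball l0 \<delta>. \<exists>\<rho>\<in>P. \<mu> \<notin> polygon_spectrum vs \<rho>) \<longrightarrow>
      (\<exists>I\<subseteq>{..<N}. card I = r \<and> dominates (ball l0 \<delta>) g I \<eta>)"
proof -
  obtain \<delta> L \<sigma> R1 R2 where \<delta>: "0 < \<delta>" "2 * \<delta> < \<delta>0" and L: "0 < L" and \<sigma>: "0 < \<sigma>"
    and R: "0 < R1" "R1 \<le> \<rho>l" "\<rho>h \<le> R2" "0 < R2"
    and lip: "\<And>i \<mu> \<mu>'. i < N \<Longrightarrow> \<mu> \<in> cball l0 (2 * \<delta>) \<Longrightarrow> \<mu>' \<in> cball l0 (2 * \<delta>) \<Longrightarrow> cmod (g i \<mu> - g i \<mu>') \<le> L * cmod (\<mu> - \<mu>')"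
    and gap: "\<And>i k \<mu>. i < N \<Longrightarrow> k < N \<Longrightarrow> i \<noteq> k \<Longrightarrow> \<mu> \<in> cball l0 (2 * \<delta>) \<Longrightarrow> \<sigma> \<le> cmod (g i \<mu> - g k \<mu>)"
    and gR: "\<And>i \<mu>. i < N \<Longrightarrow> \<mu> \<in> cball l0 (2 * \<delta>) \<Longrightarrow> g i \<mu> \<in> annulus R1 R2"
    apply (rule branches_uniform[OF g \<delta>0 \<rho>l, of \<rho>h])
    subgoal premises p by (rule p(1)[OF p(2-9)]) (rule p(10-12); assumption)+
    done
  have in2: "\<mu> \<in> cball l0 (2 * \<delta>)" "\<mu> \<in> ball l0 \<delta>0" if "\<mu> \<in> ball l0 \<delta>" for \<mu> using that \<delta> by auto
  have "R1 \<le> R2" using gR[of 0 l0] r \<delta> by (force simp: annulus_def)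
  obtain \<kappa>0 where \<kappa>0: "0 < \<kappa>0" and comp: "\<And>\<kappa> E \<mu> z w x. 0 \<le> \<kappa> \<Longrightarrow> \<kappa> \<le> \<kappa>0 \<Longrightarrow> small_lipschitz (annulus R1 R2) \<kappa> E \<Longrightarrow>
    \<forall>i<N. w i \<in> annulus R1 R2 \<and> cmod (z i) \<le> R2 \<and> cmod (z i - w i) \<le> L * \<kappa> \<and> symb (w i) + E (w i) = \<mu> \<Longrightarrow>
    \<forall>i<N. \<forall>k<N. i \<noteq> k \<longrightarrow> \<sigma> \<le> cmod (z i - z k) \<Longrightarrow>
    \<forall>x. poly (chi \<mu>) x = b (int s) * (\<Prod>i<N. x - z i) \<Longrightarrow> x \<in> annulus R1 R2 \<Longrightarrow>
    cmod (x ^ r * (symb x + E x - \<mu>) - b (int s) * (\<Prod>i<N. x - w i)) \<le> cmod (b (int s) * (\<Prod>i<N. x - w i)) / 2"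
    apply (rule perturbed_comparison[OF R(1) \<open>R1 \<le> R2\<close> L \<sigma>])
    subgoal premises p by (rule p(1)[OF p(2)]) (rule p(3); assumption)
    done
  obtain C where C0: "0 \<le> C" and C: "\<And>\<Delta> vs. vs \<in> partitions 0 (2*pi) \<Delta> \<Longrightarrow>
      small_lipschitz (annulus R1 R2) (C * \<Delta>) (polygon_error b r s vs)"
    using polygon_error_bound[OF R(1), of R2 b r s] by blast
  show ?thesis
  proof (rule that[of \<delta>])
    show "0 < \<delta>" "\<delta> < \<delta>0" using \<delta> by auto
    fix \<eta> :: real assume \<eta>: "0 < \<eta>"
    define \<kappa> where "\<kappa> = min (min \<kappa>0 \<delta>) (min (1 / (2 * L)) (\<eta> / (2 * L)))"
    have \<kappa>: "0 < \<kappa>" "\<kappa> \<le> \<kappa>0" "\<kappa> \<le> \<delta>" "\<kappa> \<le> 1 / (2 * L)" "\<kappa> \<le> \<eta> / (2 * L)"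
      using \<kappa>0 \<delta> L \<eta> by (auto simp: \<kappa>_def)
    have L\<kappa>: "L * \<kappa> \<le> 1 / 2" "2 * (L * \<kappa>) \<le> \<eta>" using \<kappa>(4,5) L by (simp_all add: field_simps)
    define \<Delta>0 where "\<Delta>0 = \<kappa> / (C + 1)"
    have \<Delta>0: "0 < \<Delta>0" using \<kappa>(1) C0 by (simp add: \<Delta>0_def)
    have C\<Delta>: "C * \<Delta>0 \<le> \<kappa>"
    proof -
      have "C * \<Delta>0 \<le> (C + 1) * \<Delta>0" using \<Delta>0 by (intro mult_right_mono) auto
      also have "\<dots> = \<kappa>" using C0 by (simp add: \<Delta>0_def)
      finally show ?thesis .
    qed
    show "\<exists>\<Delta>0>0. \<forall>vs\<in>partitions 0 (2*pi) \<Delta>0. \<forall>P\<subseteq>{\<rho>l..\<rho>h}.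
      (\<forall>\<mu>\<in>ball l0 \<delta>. \<exists>\<rho>\<in>P. \<mu> \<notin> polygon_spectrum vs \<rho>) \<longrightarrow>
      (\<exists>I\<subseteq>{..<N}. card I = r \<and> dominates (ball l0 \<delta>) g I \<eta>)"
    proof (intro exI[of _ \<Delta>0] conjI \<Delta>0 ballI allI impI)
      fix vs P assume vs: "vs \<in> partitions 0 (2*pi) \<Delta>0" and P: "P \<subseteq> {\<rho>l..\<rho>h}"
        and inv: "\<forall>\<mu>\<in>ball l0 \<delta>. \<exists>\<rho>\<in>P. \<mu> \<notin> polygon_spectrum vs \<rho>"
      define E where "E = polygon_error b r s vs"
      have E: "small_lipschitz (annulus R1 R2) \<kappa> E"
        unfolding E_def by (rule small_lipschitz_mono[OF C[OF vs] C\<Delta>])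
      obtain w where w: "\<And>i \<mu>. i < N \<Longrightarrow> \<mu> \<in> ball l0 \<delta> \<Longrightarrow> w i \<mu> \<in> annulus R1 R2"
        "\<And>i \<mu>. i < N \<Longrightarrow> \<mu> \<in> ball l0 \<delta> \<Longrightarrow> symb (w i \<mu>) + E (w i \<mu>) = \<mu>"
        "\<And>i \<mu>. i < N \<Longrightarrow> \<mu> \<in> ball l0 \<delta> \<Longrightarrow> cmod (g i \<mu> - w i \<mu>) \<le> L * \<kappa>"
        "\<And>i \<mu> \<mu>'. i < N \<Longrightarrow> \<mu> \<in> ball l0 \<delta> \<Longrightarrow> \<mu>' \<in> ball l0 \<delta> \<Longrightarrow> cmod (w i \<mu> - w i \<mu>') \<le> 2 * L * cmod (\<mu> - \<mu>')"
        using perturbed_roots[OF g \<delta> L R(1) lip gR less_imp_le[OF \<kappa>(1)] \<kappa>(3) L\<kappa>(1) E] by blast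
      define sep where "sep \<mu> I \<longleftrightarrow> I \<subseteq> {..<N} \<and> card I = r \<and>
        (\<exists>\<rho>. (\<forall>i\<in>I. cmod (w i \<mu>) < \<rho>) \<and> (\<forall>k\<in>{..<N} - I. \<rho> < cmod (w k \<mu>)))" for \<mu> I
      have ex: "\<exists>I. sep \<mu> I" if \<mu>: "\<mu> \<in> ball l0 \<delta>" for \<mu>
      proof -
        obtain \<rho> where \<rho>: "\<rho> \<in> P" "\<mu> \<notin> polygon_spectrum vs \<rho>" using inv \<mu> by blast
        then have \<rho>R: "0 < \<rho>" "R1 \<le> \<rho>" "\<rho> \<le> R2" using P R \<rho>l by force+
        have near: "cmod (x ^ r * (symb x + polygon_error b r s vs x - \<mu>) - b (int s) * (\<Prod>i<N. x - w i \<mu>)) \<le> cmod (b (int s) * (\<Prod>i<N. x - w i \<mu>)) / 2"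
          if x: "x \<in> annulus R1 R2" for x
          unfolding E_def[symmetric]
        proof (rule comp[of \<kappa> E "\<lambda>i. w i \<mu>" "\<lambda>i. g i \<mu>" \<mu>])
          show "\<forall>i<N. w i \<mu> \<in> annulus R1 R2 \<and> cmod (g i \<mu>) \<le> R2 \<and> cmod (g i \<mu> - w i \<mu>) \<le> L * \<kappa> \<and> symb (w i \<mu>) + E (w i \<mu>) = \<mu>"
            using w(1-3) \<mu> gR[OF _ in2(1)[OF \<mu>]] by (simp add: annulus_def)
          show "\<forall>i<N. \<forall>k<N. i \<noteq> k \<longrightarrow> \<sigma> \<le> cmod (g i \<mu> - g k \<mu>)" using gap in2(1)[OF \<mu>] by blast
          show "\<forall>x. poly (chi \<mu>) x = b (int s) * (\<Prod>i<N. x - g i \<mu>)" using chi_eq_prod[OF g in2(2)[OF \<mu>]] by blast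
        qed (use \<kappa> E x in auto)
        note cnt = invertible_count[OF \<rho>R vs \<rho>(2) near]
        have "sep \<mu> {i. i < N \<and> cmod (w i \<mu>) < \<rho>}"
          unfolding sep_def
        proof (intro conjI exI[of _ \<rho>] ballI)
          show "card {i. i < N \<and> cmod (w i \<mu>) < \<rho>} = r" by (rule cnt(1))
          fix k assume "k \<in> {..<N} - {i. i < N \<and> cmod (w i \<mu>) < \<rho>}"
          then have "k < N" "\<not> cmod (w k \<mu>) < \<rho>" by auto
          then show "\<rho> < cmod (w k \<mu>)" using cnt(2)[of k] by linarith
        qed auto
        then show ?thesis by blast
      qed
      \<comment> \<open>two sets cut off by circles are nested, and equal if they have the same size\<close>
      have sub: "I \<subseteq> J" if "\<rho> \<le> \<rho>'" "\<forall>i\<in>I. cmod (w i \<mu>) < \<rho>" "\<forall>k\<in>{..<N} - J. \<rho>' < cmod (w k \<mu>)" "I \<subseteq> {..<N}" for \<mu> I J \<rho> \<rho>'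
        using that by (meson DiffI less_asym less_le_trans subset_iff)
      have uniq: "I = J" if I: "sep \<mu> I" and J: "sep \<mu> J" for \<mu> I J
      proof -
        obtain \<rho> where \<rho>: "\<forall>i\<in>I. cmod (w i \<mu>) < \<rho>" "\<forall>k\<in>{..<N} - I. \<rho> < cmod (w k \<mu>)" using I by (auto simp: sep_def)
        obtain \<rho>' where \<rho>': "\<forall>i\<in>J. cmod (w i \<mu>) < \<rho>'" "\<forall>k\<in>{..<N} - J. \<rho>' < cmod (w k \<mu>)" using J by (auto simp: sep_def)
        have s: "I \<subseteq> {..<N}" "J \<subseteq> {..<N}" "card I = card J" using I J by (auto simp: sep_def)
        then have fin: "finite I" "finite J" using finite_subset by blast+
        show ?thesis
        proof (cases "\<rho> \<le> \<rho>'")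
          case True
          then have "I \<subseteq> J" using sub \<rho>(1) \<rho>'(2) s(1) by blast
          then show ?thesis using card_subset_eq[OF fin(2)] s(3) by blast
        next
          case False
          then have "\<rho>' \<le> \<rho>" by simp
          then have "J \<subseteq> I" using sub \<rho>'(1) \<rho>(2) s(2) by blast
          then show ?thesis using card_subset_eq[OF fin(1)] s(3) by metis
        qed
      qed
      define f where "f \<mu> = (SOME I. sep \<mu> I)" for \<mu>
      have f: "sep \<mu> (f \<mu>)" if "\<mu> \<in> ball l0 \<delta>" for \<mu> unfolding f_def using ex[OF that] by (rule someI_ex)
      have "f constant_on ball l0 \<delta>"
      proof (rule locally_constant_imp_constant)
        fix \<mu> assume \<mu>: "\<mu> \<in> ball l0 \<delta>"
        obtain \<rho> where \<rho>: "\<forall>i\<in>f \<mu>. cmod (w i \<mu>) < \<rho>" "\<forall>k\<in>{..<N} - f \<mu>. \<rho> < cmod (w k \<mu>)"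
          using f[OF \<mu>] by (auto simp: sep_def)
        \<comment> \<open>The circle chosen for \<open>\<mu>\<close> also separates the zeros for nearby \<open>\<mu>'\<close>: no zero moves as
          far as \<open>m\<close>, the least distance to the circle.\<close>
        define m where "m = Min ((\<lambda>i. \<bar>cmod (w i \<mu>) - \<rho>\<bar>) ` {..<N})"
        have ne: "{..<N} \<noteq> {}" using r by auto
        have "0 < m"
          unfolding m_def
        proof (subst Min_gr_iff)
          show "\<forall>a\<in>(\<lambda>i. \<bar>cmod (w i \<mu>) - \<rho>\<bar>) ` {..<N}. 0 < a"
          proof (intro ballI, elim imageE)
            fix a i assume a: "a = \<bar>cmod (w i \<mu>) - \<rho>\<bar>" "i \<in> {..<N}"
            have "cmod (w i \<mu>) < \<rho> \<or> \<rho> < cmod (w i \<mu>)" using \<rho> a(2) by blast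
            then show "0 < a" using a(1) by auto
          qed
        qed (use ne in auto)
        have mle: "m \<le> \<bar>cmod (w i \<mu>) - \<rho>\<bar>" if "i < N" for i unfolding m_def using that by (intro Min_le) auto
        define e where "e = m / (2 * L)"
        have e: "0 < e" using \<open>0 < m\<close> L by (simp add: e_def)
        have "f \<mu>' = f \<mu>" if \<mu>': "\<mu>' \<in> ball l0 \<delta> \<inter> ball \<mu> e" for \<mu>'
        proof -
          have move: "\<bar>cmod (w i \<mu>') - cmod (w i \<mu>)\<bar> < m" if i: "i < N" for i
          proof -
            have "\<bar>cmod (w i \<mu>') - cmod (w i \<mu>)\<bar> \<le> cmod (w i \<mu>' - w i \<mu>)" by (rule norm_triangle_ineq3)
            also have "\<dots> \<le> 2 * L * cmod (\<mu>' - \<mu>)" using w(4)[OF i] \<mu> \<mu>' by blast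
            also have "\<dots> < 2 * L * e" using \<mu>' L by (intro mult_strict_left_mono) (auto simp: dist_norm norm_minus_commute)
            also have "\<dots> = m" using L by (simp add: e_def)
            finally show ?thesis .
          qed
          have fN: "f \<mu> \<subseteq> {..<N}" "card (f \<mu>) = r" using f[OF \<mu>] by (auto simp: sep_def)
          have "sep \<mu>' (f \<mu>)"
            unfolding sep_def
          proof (intro conjI exI[of _ \<rho>] ballI fN)
            fix i assume i: "i \<in> f \<mu>"
            then have "i < N" using fN by auto
            then show "cmod (w i \<mu>') < \<rho>" using move[of i] mle[of i] bspec[OF \<rho>(1) i] by linarith
          next
            fix k assume k: "k \<in> {..<N} - f \<mu>"
            then have "k < N" by auto
            then show "\<rho> < cmod (w k \<mu>')" using move[of k] mle[of k] bspec[OF \<rho>(2) k] by linarith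
          qed
          then show ?thesis using uniq f \<mu>' by blast
        qed
        moreover have "openin (top_of_set (ball l0 \<delta>)) (ball l0 \<delta> \<inter> ball \<mu> e)" by (simp add: openin_open_Int)
        moreover have "\<mu> \<in> ball l0 \<delta> \<inter> ball \<mu> e" using \<mu> e by simp
        ultimately show "\<exists>T. openin (top_of_set (ball l0 \<delta>)) T \<and> \<mu> \<in> T \<and> (\<forall>x\<in>T. f x = f \<mu>)" by blast
      qed simp
      then obtain I where I: "\<And>\<mu>. \<mu> \<in> ball l0 \<delta> \<Longrightarrow> f \<mu> = I" by (auto simp: constant_on_def)
      have sepI: "sep \<mu> I" if "\<mu> \<in> ball l0 \<delta>" for \<mu> using f[OF that] I[OF that] by simp
      have l0: "l0 \<in> ball l0 \<delta>" using \<delta> by simp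
      show "\<exists>I\<subseteq>{..<N}. card I = r \<and> dominates (ball l0 \<delta>) g I \<eta>"
        unfolding dominates_def
      proof (intro exI[of _ I] conjI ballI)
        show IN: "I \<subseteq> {..<N}" "card I = r" using sepI[OF l0] by (auto simp: sep_def)
        fix \<mu> i k assume \<mu>: "\<mu> \<in> ball l0 \<delta>" and i: "i \<in> I" and k: "k \<in> {..<N} - I"
        obtain \<rho> where \<rho>: "\<forall>i\<in>I. cmod (w i \<mu>) < \<rho>" "\<forall>k\<in>{..<N} - I. \<rho> < cmod (w k \<mu>)" using sepI[OF \<mu>] by (auto simp: sep_def)
        have iN: "i < N" "k < N" using i k IN by auto
        have "cmod (g i \<mu>) \<le> cmod (w i \<mu>) + L * \<kappa>"
          using norm_triangle_ineq2[of "g i \<mu>" "w i \<mu>"] w(3)[OF iN(1) \<mu>] by linarith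
        moreover have "cmod (w k \<mu>) \<le> cmod (g k \<mu>) + L * \<kappa>"
          using norm_triangle_ineq2[of "w k \<mu>" "g k \<mu>"] w(3)[OF iN(2) \<mu>] by (simp add: norm_minus_commute)
        ultimately show "cmod (g i \<mu>) \<le> cmod (g k \<mu>) + \<eta>"
          using bspec[OF \<rho>(1) i] bspec[OF \<rho>(2) k] L\<kappa>(2) by linarith
      qed
    qed
  qed
qed

end

section \<open>Symmetries of the symbol\<close>

context banded_symbol
begin

definition symmetries :: "complex set" where
  "symmetries = {\<omega>. \<omega> \<noteq> 0 \<and> (\<forall>z. z \<noteq> 0 \<longrightarrow> symb (\<omega> * z) = symb z)}"

lemma chi_0_scaled:
  assumes "infinite {z. z \<noteq> 0 \<and> symb (\<omega> * z) = symb z}" "\<omega> \<noteq> 0"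
  shows "pcompose (chi 0) [:0, \<omega>:] = smult (\<omega> ^ r) (chi 0)"
proof (rule ccontr)
  assume "pcompose (chi 0) [:0, \<omega>:] \<noteq> smult (\<omega> ^ r) (chi 0)"
  then have "finite {z. poly (pcompose (chi 0) [:0, \<omega>:] - smult (\<omega> ^ r) (chi 0)) z = 0}"
    by (intro poly_roots_finite) simp
  moreover have "{z. z \<noteq> 0 \<and> symb (\<omega> * z) = symb z} \<subseteq> {z. poly (pcompose (chi 0) [:0, \<omega>:] - smult (\<omega> ^ r) (chi 0)) z = 0}"
  proof
    fix z assume "z \<in> {z. z \<noteq> 0 \<and> symb (\<omega> * z) = symb z}"
    then have z: "z \<noteq> 0" "symb (\<omega> * z) = symb z" by auto
    have "poly (pcompose (chi 0) [:0, \<omega>:]) z = poly (chi 0) (\<omega> * z)" by (simp add: poly_pcompose mult.commute)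
    also have "\<dots> = (\<omega> * z) ^ r * symb z" using poly_chi[of "\<omega> * z" 0] z assms(2) by simp
    also have "\<dots> = \<omega> ^ r * poly (chi 0) z" using poly_chi[of z 0] z by (simp add: power_mult_distrib)
    finally show "z \<in> {z. poly (pcompose (chi 0) [:0, \<omega>:] - smult (\<omega> ^ r) (chi 0)) z = 0}" by simp
  qed
  ultimately show False using assms(1) finite_subset by blast
qed

text \<open>Two polynomials of bounded degree that agree at infinitely many points are equal, so
  infinitely many coincidences suffice.\<close>

lemma symmetriesI:
  assumes "infinite {z. z \<noteq> 0 \<and> symb (\<omega> * z) = symb z}" "\<omega> \<noteq> 0"
  shows "\<omega> \<in> symmetries"
  unfolding symmetries_def
proof (intro CollectI conjI allI impI assms)
  fix z :: complex assume z: "z \<noteq> 0"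
  have "poly (chi 0) (\<omega> * z) = poly (pcompose (chi 0) [:0, \<omega>:]) z" by (simp add: poly_pcompose mult.commute)
  also have "\<dots> = \<omega> ^ r * poly (chi 0) z" by (simp add: chi_0_scaled[OF assms])
  finally have "(\<omega> * z) ^ r * symb (\<omega> * z) = \<omega> ^ r * (z ^ r * symb z)"
    using poly_chi[of z 0] poly_chi[of "\<omega> * z" 0] z assms(2) by simp
  then show "symb (\<omega> * z) = symb z" using z assms(2) by (simp add: power_mult_distrib)
qed

text \<open>Compare the coefficients \<open>b\<^sub>-\<^sub>r \<noteq> 0\<close> of \<open>b(\<omega>z)\<close> and \<open>b(z)\<close>.\<close>

lemma symmetries_root_of_unity:
  assumes "\<omega> \<in> symmetries"
  shows "\<omega> ^ r = 1"
proof -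
  have \<omega>: "\<omega> \<noteq> 0" "\<And>z. z \<noteq> 0 \<Longrightarrow> symb (\<omega> * z) = symb z" using assms by (auto simp: symmetries_def)
  then have eq: "{z. z \<noteq> 0 \<and> symb (\<omega> * z) = symb z} = UNIV - {0}" by auto
  have "infinite {z. z \<noteq> 0 \<and> symb (\<omega> * z) = symb z}" unfolding eq by (simp add: infinite_UNIV_char_0)
  then have "pcompose (chi 0) [:0, \<omega>:] = smult (\<omega> ^ r) (chi 0)" using \<omega>(1) by (rule chi_0_scaled)
  then have "poly (pcompose (chi 0) [:0, \<omega>:]) 0 = poly (smult (\<omega> ^ r) (chi 0)) 0" by simp
  then have "poly (chi 0) 0 = \<omega> ^ r * poly (chi 0) 0" by (simp add: poly_pcompose)
  then show ?thesis using poly_chi_0[of 0] by simp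
qed

lemma symmetries_group:
  "finite symmetries" "1 \<in> symmetries" "0 \<notin> symmetries"
  "\<And>x y. x \<in> symmetries \<Longrightarrow> y \<in> symmetries \<Longrightarrow> x * y \<in> symmetries"
  "\<And>x. x \<in> symmetries \<Longrightarrow> inverse x \<in> symmetries"
proof -
  have "symmetries \<subseteq> {\<omega>. \<omega> ^ r = 1}" using symmetries_root_of_unity by blast
  moreover have "finite {\<omega> :: complex. \<omega> ^ r = 1}" using r by (intro finite_roots_unity) simp
  ultimately show "finite symmetries" by (rule finite_subset)
  show "1 \<in> symmetries" "0 \<notin> symmetries" by (auto simp: symmetries_def)
  show "x * y \<in> symmetries" if "x \<in> symmetries" "y \<in> symmetries" for x y
    using that by (auto simp: symmetries_def mult.assoc)
  show "inverse x \<in> symmetries" if x: "x \<in> symmetries" for x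
    unfolding symmetries_def
  proof (intro CollectI conjI allI impI)
    have x0: "x \<noteq> 0" using x by (auto simp: symmetries_def)
    then show "inverse x \<noteq> 0" by simp
    fix z :: complex assume "z \<noteq> 0"
    then have "symb (x * (inverse x * z)) = symb (inverse x * z)" using x x0 by (simp add: symmetries_def)
    then show "symb (inverse x * z) = symb z" using x0 by (simp add: mult.assoc[symmetric])
  qed
qed

text \<open>The symmetries act freely on the \<open>r\<close>-th roots of unity.\<close>

lemma card_symmetries_dvd: "card symmetries dvd r"
proof -
  have "card symmetries dvd card {\<omega> :: complex. \<omega> ^ r = 1}"
  proof (rule card_dvd_free_action[OF symmetries_group])
    show "finite {\<omega> :: complex. \<omega> ^ r = 1}" using r by (intro finite_roots_unity) simp
    show "0 \<notin> {\<omega> :: complex. \<omega> ^ r = 1}" using r by (simp add: power_0_left)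
    show "x * a \<in> {\<omega>. \<omega> ^ r = 1}" if "x \<in> symmetries" "a \<in> {\<omega>. \<omega> ^ r = 1}" for x a
      using that symmetries_root_of_unity by (simp add: power_mult_distrib)
  qed
  then show ?thesis using r by (simp add: card_roots_unity_eq)
qed

text \<open>Suppose that \<open>l0\<close> is in the limit set. Then \<open>\<bar>g\<^sub>i\<bar> = \<bar>g\<^sub>k\<bar>\<close> at \<open>l0\<close> for some \<open>i \<in> I\<close> and
  \<open>k \<notin> I\<close>, and all such pairs share one modulus \<open>m\<close>. For each of them \<open>g\<^sub>i / g\<^sub>k\<close> attains its
  maximal modulus \<open>1\<close> at \<open>l0\<close>, so it is a constant, and this constant is a symmetry. Hence the
  zeros of modulus \<open>m\<close> form one orbit of the group \<open>G\<close> of symmetries, and some but not all of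
  them have index in \<open>I\<close>. On the other hand \<open>I\<close> consists of these and of all zeros of smaller
  modulus, and \<open>card G\<close> divides both \<open>r\<close> and the number of the latter, hence the number of the
  former, which is impossible.\<close>

lemma dominated_branches_not_limit:
  assumes g: "branches (ball l0 \<delta>) g" and \<delta>: "0 < \<delta>" and I: "I \<subseteq> {..<N}" "card I = r"
    and dom: "\<And>\<mu> i k. \<mu> \<in> ball l0 \<delta> \<Longrightarrow> i \<in> I \<Longrightarrow> k \<in> {..<N} - I \<Longrightarrow> cmod (g i \<mu>) \<le> cmod (g k \<mu>)"
  shows "l0 \<notin> limit_set b r s"
proof
  assume lim: "l0 \<in> limit_set b r s"
  define J where "J = {..<N} - I"
  have l0: "l0 \<in> ball l0 \<delta>" using \<delta> by simp
  have finI: "finite I" using I(1) finite_subset by blast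
  have ne: "I \<noteq> {}" "J \<noteq> {}"
  proof -
    show "I \<noteq> {}" using I(2) r by auto
    have "card J = s" using I by (simp add: J_def card_Diff_subset finI)
    then show "J \<noteq> {}" using s by auto
  qed
  have finJ: "finite J" by (simp add: J_def)
  have gn: "g i \<mu> \<noteq> 0" "symb (g i \<mu>) = \<mu>" if "i < N" "\<mu> \<in> ball l0 \<delta>" for i \<mu>
    using g that by (auto simp: branches_def)
  have hol: "g i holomorphic_on ball l0 \<delta>" if "i < N" for i using g that by (auto simp: branches_def)
  have roots: "{z. poly (chi l0) z = 0} = (\<lambda>i. g i l0) ` {..<N}" by (rule branches_roots[OF g l0])
  \<comment> \<open>otherwise a circle between the moduli on \<open>I\<close> and those on \<open>J\<close> would have exactly \<open>r\<close> zeros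
    inside\<close>
  have "\<exists>i\<in>I. \<exists>k\<in>J. cmod (g i l0) = cmod (g k l0)"
  proof (rule ccontr)
    assume c: "\<not> ?thesis"
    define p where "p = Max ((\<lambda>i. cmod (g i l0)) ` I)"
    define q where "q = Min ((\<lambda>i. cmod (g i l0)) ` J)"
    have "p \<in> (\<lambda>i. cmod (g i l0)) ` I" unfolding p_def using finI ne by (intro Max_in) auto
    then obtain i where i: "i \<in> I" "p = cmod (g i l0)" by blast
    have "q \<in> (\<lambda>i. cmod (g i l0)) ` J" unfolding q_def using finJ ne by (intro Min_in) auto
    then obtain k where k: "k \<in> J" "q = cmod (g k l0)" by blast
    have "p < q" using dom[OF l0 i(1)] k i c by (metis J_def less_eq_real_def)
    define \<rho> where "\<rho> = (p + q) / 2"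
    have lo: "cmod (g i l0) < \<rho>" if "i \<in> I" for i
    proof -
      have "cmod (g i l0) \<le> p" unfolding p_def using that finI by (intro Max_ge) auto
      then show ?thesis using \<open>p < q\<close> by (simp add: \<rho>_def)
    qed
    have hi: "\<rho> < cmod (g i l0)" if "i \<in> J" for i
    proof -
      have "q \<le> cmod (g i l0)" unfolding q_def using that finJ by (intro Min_le) auto
      then show ?thesis using \<open>p < q\<close> by (simp add: \<rho>_def)
    qed
    have "{i. i < N \<and> cmod (g i l0) < \<rho>} = I"
    proof (intro set_eqI iffI)
      fix i assume "i \<in> {i. i < N \<and> cmod (g i l0) < \<rho>}"
      then show "i \<in> I" using hi[of i] by (cases "i \<in> I") (auto simp: J_def)
    qed (use lo I in auto)
    then have "zeros_inside (chi l0) \<rho> = r" using I(2) by (simp add: zeros_inside_branches[OF g l0])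
    moreover have "cmod z \<noteq> \<rho>" if "poly (chi l0) z = 0" for z
    proof -
      have "z \<in> (\<lambda>i. g i l0) ` {..<N}" using that roots by blast
      then obtain i where i: "i < N" "z = g i l0" by blast
      then show ?thesis using lo[of i] hi[of i] by (cases "i \<in> I") (auto simp: J_def)
    qed
    ultimately show False using lim unfolding limit_set_iff by blast
  qed
  then obtain i0 k0 where i0: "i0 \<in> I" and k0: "k0 \<in> J" and eq0: "cmod (g i0 l0) = cmod (g k0 l0)" by blast
  define m where "m = cmod (g k0 l0)"
  have sym: "g i l0 / g k l0 \<in> symmetries" if i: "i \<in> I" and k: "k \<in> J" and eq: "cmod (g i l0) = cmod (g k l0)" for i k
  proof -
    have iN: "i < N" "k < N" using i k I by (auto simp: J_def)
    define f where "f \<mu> = g i \<mu> / g k \<mu>" for \<mu>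
    have "f holomorphic_on ball l0 \<delta>"
      unfolding f_def using gn(1)[OF iN(2)] by (intro holomorphic_on_divide hol iN) auto
    then have "f constant_on ball l0 \<delta>"
    proof (rule maximum_modulus_principle[where U = "ball l0 \<delta>" and \<xi> = l0])
      fix \<mu> assume \<mu>: "\<mu> \<in> ball l0 \<delta>"
      have "cmod (f \<mu>) \<le> 1"
        using dom[OF \<mu> i k[unfolded J_def]] gn(1)[OF iN(2) \<mu>] by (simp add: f_def norm_divide)
      also have "1 = cmod (f l0)" using eq gn(1)[OF iN(2) l0] by (simp add: f_def norm_divide)
      finally show "cmod (f \<mu>) \<le> cmod (f l0)" .
    qed (use \<delta> in auto)
    then obtain \<omega> where \<omega>: "\<And>\<mu>. \<mu> \<in> ball l0 \<delta> \<Longrightarrow> f \<mu> = \<omega>" by (auto simp: constant_on_def)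
    have \<omega>0: "\<omega> \<noteq> 0" using \<omega>[OF l0] gn(1)[OF iN(1) l0] gn(1)[OF iN(2) l0] by (auto simp: f_def)
    have "inj_on (g k) (ball l0 \<delta>)" by (rule inj_on_inverseI[of _ symb]) (rule gn(2)[OF iN(2)])
    moreover have "infinite (ball l0 \<delta>)" using uncountable_ball[OF \<delta>, of l0] countable_finite by blast
    ultimately have "infinite (g k ` ball l0 \<delta>)" using finite_imageD by blast
    moreover have "g k ` ball l0 \<delta> \<subseteq> {z. z \<noteq> 0 \<and> symb (\<omega> * z) = symb z}"
    proof
      fix z assume "z \<in> g k ` ball l0 \<delta>"
      then obtain \<mu> where \<mu>: "\<mu> \<in> ball l0 \<delta>" "z = g k \<mu>" by blast
      have "\<omega> * g k \<mu> = g i \<mu>" using \<omega>[OF \<mu>(1)] gn(1)[OF iN(2) \<mu>(1)] by (simp add: f_def field_simps)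
      then show "z \<in> {z. z \<noteq> 0 \<and> symb (\<omega> * z) = symb z}"
        using gn[OF iN(1) \<mu>(1)] gn[OF iN(2) \<mu>(1)] \<mu>(2) by simp
    qed
    ultimately have "infinite {z. z \<noteq> 0 \<and> symb (\<omega> * z) = symb z}" using finite_subset by blast
    then have "\<omega> \<in> symmetries" using \<omega>0 by (rule symmetriesI)
    then show ?thesis using \<omega>[OF l0] by (simp add: f_def)
  qed
  define G where "G = symmetries"
  define \<zeta> where "\<zeta> = g k0 l0"
  have k0N: "k0 < N" "i0 < N" using k0 i0 I by (auto simp: J_def)
  have \<zeta>0: "\<zeta> \<noteq> 0" using gn(1)[OF k0N(1) l0] by (simp add: \<zeta>_def)
  have inj: "inj_on (\<lambda>i. g i l0) {..<N}" using g l0 by (auto simp: branches_def)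
  have unit: "cmod \<omega> = 1" if "\<omega> \<in> G" for \<omega>
  proof -
    have "cmod \<omega> ^ r = 1" using symmetries_root_of_unity that by (metis G_def norm_one norm_power)
    then show ?thesis using power_eq_imp_eq_base[of "cmod \<omega>" r 1] r by simp
  qed
  have root_closed: "\<omega> * z \<in> {z. poly (chi l0) z = 0}" if "\<omega> \<in> G" "z \<in> {z. poly (chi l0) z = 0}" for \<omega> z
    using that by (auto simp: root_chi_iff G_def symmetries_def)
  have Zeq: "(\<lambda>i. g i l0) ` {i. i < N \<and> cmod (g i l0) = m} = (\<lambda>\<omega>. \<omega> * \<zeta>) ` G"
  proof (intro equalityI subsetI)
    fix z assume "z \<in> (\<lambda>i. g i l0) ` {i. i < N \<and> cmod (g i l0) = m}"
    then obtain i where i: "i < N" "cmod (g i l0) = m" "z = g i l0" by blast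
    \<comment> \<open>a zero with index in \<open>J\<close> is compared with \<open>\<zeta>\<close> through the zero \<open>g i0 l0\<close> with index in
      \<open>I\<close>\<close>
    have "z / \<zeta> \<in> G"
    proof (cases "i \<in> I")
      case True
      then show ?thesis using sym[OF True k0] i by (simp add: \<zeta>_def m_def G_def)
    next
      case False
      then have "i \<in> J" using i by (simp add: J_def)
      then have "g i0 l0 / g i l0 \<in> G" using sym[OF i0] i eq0 by (simp add: m_def G_def)
      then have "inverse (g i0 l0 / g i l0) \<in> G" unfolding G_def by (rule symmetries_group(5))
      moreover have "g i0 l0 / g k0 l0 \<in> G" using sym[OF i0 k0 eq0] by (simp add: G_def)
      ultimately have "inverse (g i0 l0 / g i l0) * (g i0 l0 / g k0 l0) \<in> G"
        unfolding G_def by (rule symmetries_group(4))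
      moreover have "inverse (g i0 l0 / g i l0) * (g i0 l0 / g k0 l0) = z / \<zeta>"
        using gn(1)[OF k0N(2) l0] i(3) by (simp add: \<zeta>_def field_simps)
      ultimately show ?thesis by simp
    qed
    moreover have "z = z / \<zeta> * \<zeta>" using \<zeta>0 by simp
    ultimately show "z \<in> (\<lambda>\<omega>. \<omega> * \<zeta>) ` G" by blast
  next
    fix z assume "z \<in> (\<lambda>\<omega>. \<omega> * \<zeta>) ` G"
    then obtain \<omega> where \<omega>: "\<omega> \<in> G" "z = \<omega> * \<zeta>" by blast
    have "\<zeta> \<in> {z. poly (chi l0) z = 0}" using roots k0N by (auto simp: \<zeta>_def)
    then have "z \<in> (\<lambda>i. g i l0) ` {..<N}" using root_closed[OF \<omega>(1)] \<omega>(2) roots by blast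
    then obtain i where i: "i < N" "z = g i l0" by blast
    moreover have "cmod z = m" using unit[OF \<omega>(1)] \<omega>(2) by (simp add: norm_mult m_def \<zeta>_def)
    ultimately show "z \<in> (\<lambda>i. g i l0) ` {i. i < N \<and> cmod (g i l0) = m}" by blast
  qed
  have "card {i. i < N \<and> cmod (g i l0) = m} = card ((\<lambda>i. g i l0) ` {i. i < N \<and> cmod (g i l0) = m})"
    by (rule card_image[symmetric], rule inj_on_subset[OF inj]) auto
  also have "\<dots> = card G" unfolding Zeq using \<zeta>0 by (intro card_image inj_onI) simp
  finally have cardeq: "card {i. i < N \<and> cmod (g i l0) = m} = card G" .
  \<comment> \<open>the group acts on the zeros of smaller modulus\<close>
  have "card G dvd card ((\<lambda>i. g i l0) ` {i. i < N \<and> cmod (g i l0) < m})"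
    unfolding G_def
  proof (rule card_dvd_free_action[OF symmetries_group])
    show "finite ((\<lambda>i. g i l0) ` {i. i < N \<and> cmod (g i l0) < m})" by simp
    show "0 \<notin> (\<lambda>i. g i l0) ` {i. i < N \<and> cmod (g i l0) < m}" using gn(1)[OF _ l0] by force
    fix x z assume x: "x \<in> symmetries" and "z \<in> (\<lambda>i. g i l0) ` {i. i < N \<and> cmod (g i l0) < m}"
    then obtain i where i: "i < N" "cmod (g i l0) < m" "z = g i l0" by blast
    have "z \<in> {z. poly (chi l0) z = 0}" using roots i by blast
    then have "x * z \<in> (\<lambda>i. g i l0) ` {..<N}" using root_closed[of x z] x roots by (simp add: G_def)
    then obtain j where j: "j < N" "x * z = g j l0" by blast
    have "cmod (x * z) < m" using unit[of x] x i by (simp add: norm_mult G_def)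
    then show "x * z \<in> (\<lambda>i. g i l0) ` {i. i < N \<and> cmod (g i l0) < m}" using j by auto
  qed
  also have "card ((\<lambda>i. g i l0) ` {i. i < N \<and> cmod (g i l0) < m}) = card {i. i < N \<and> cmod (g i l0) < m}"
    by (rule card_image, rule inj_on_subset[OF inj]) auto
  finally have dvdlt: "card G dvd card {i. i < N \<and> cmod (g i l0) < m}" .
  define X where "X = {i \<in> I. cmod (g i l0) = m}"
  have ltI: "{i. i < N \<and> cmod (g i l0) < m} \<subseteq> I"
  proof
    fix i assume i: "i \<in> {i. i < N \<and> cmod (g i l0) < m}"
    show "i \<in> I"
    proof (rule ccontr)
      assume "i \<notin> I"
      then have "m \<le> cmod (g i l0)" using dom[OF l0 i0, of i] i eq0 by (simp add: m_def)
      then show False using i by simp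
    qed
  qed
  have "I = {i. i < N \<and> cmod (g i l0) < m} \<union> X"
  proof (intro equalityI subsetI)
    fix i assume i: "i \<in> I"
    have "cmod (g i l0) \<le> m" using dom[OF l0 i] k0 by (simp add: m_def J_def)
    then show "i \<in> {i. i < N \<and> cmod (g i l0) < m} \<union> X" using i I by (auto simp: X_def)
  qed (use ltI in \<open>auto simp: X_def\<close>)
  moreover have "card ({i. i < N \<and> cmod (g i l0) < m} \<union> X) = card {i. i < N \<and> cmod (g i l0) < m} + card X"
    by (rule card_Un_disjoint) (use finI in \<open>auto simp: X_def\<close>)
  ultimately have "r = card {i. i < N \<and> cmod (g i l0) < m} + card X" using I(2) by simp
  then have "card G dvd card X" using dvdlt card_symmetries_dvd by (metis G_def dvd_add_right_iff)
  moreover have "card X < card G"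
    unfolding cardeq[symmetric]
  proof (rule psubset_card_mono)
    show "X \<subset> {i. i < N \<and> cmod (g i l0) = m}"
      using k0 I k0N by (auto simp: X_def J_def m_def)
  qed simp
  moreover have "0 < card X" using finI i0 eq0 by (auto simp: X_def m_def card_gt_0_iff)
  ultimately show False by (simp add: nat_dvd_not_less)
qed

end

section \<open>The limit set has no isolated points\<close>

lemma continuous_on_Max_finite:
  fixes f :: "'j \<Rightarrow> 'a::topological_space \<Rightarrow> real"
  assumes "finite J" "J \<noteq> {}" "\<And>j. j \<in> J \<Longrightarrow> continuous_on A (f j)"
  shows "continuous_on A (\<lambda>x. Max ((\<lambda>j. f j x) ` J))"
  using assms
proof (induction J rule: finite_ne_induct)
  case (insert j J)
  have "Max ((\<lambda>j. f j x) ` insert j J) = max (f j x) (Max ((\<lambda>j. f j x) ` J))" for x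
    using insert.hyps by simp
  then show ?case using insert by (simp add: continuous_on_max)
qed simp

context banded_symbol
begin

abbreviation roots_of :: "complex \<Rightarrow> complex set" where
  "roots_of \<mu> \<equiv> {z. poly (chi \<mu>) z = 0}"

lemma finite_roots_of: "finite (roots_of \<mu>)"
  using poly_roots_finite[OF chi_neq_0] .

lemma zeros_inside_chi_locally_constant:
  assumes \<rho>: "0 < \<rho>" and nz: "\<And>z. z \<in> roots_of l \<Longrightarrow> cmod z \<noteq> \<rho>"
  obtains \<epsilon> where "0 < \<epsilon>" "\<And>\<mu>. \<mu> \<in> ball l \<epsilon> \<Longrightarrow> zeros_inside (chi \<mu>) \<rho> = zeros_inside (chi l) \<rho>"
    "\<And>\<mu> z. \<mu> \<in> ball l \<epsilon> \<Longrightarrow> z \<in> roots_of \<mu> \<Longrightarrow> cmod z \<noteq> \<rho>"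
proof -
  have ne: "sphere 0 \<rho> \<noteq> ({} :: complex set)" using \<rho> by simp
  have "continuous_on (sphere 0 \<rho>) (\<lambda>t. cmod (poly (chi l) t))" by (intro continuous_intros)
  then obtain t0 where t0: "t0 \<in> sphere 0 \<rho>" "\<forall>t\<in>sphere 0 \<rho>. cmod (poly (chi l) t0) \<le> cmod (poly (chi l) t)"
    using continuous_attains_inf[OF compact_sphere ne] by blast
  define c where "c = cmod (poly (chi l) t0)"
  have c: "0 < c" using nz[of t0] t0(1) by (auto simp: c_def)
  define \<epsilon> where "\<epsilon> = c / \<rho> ^ r"
  have \<epsilon>: "0 < \<epsilon>" using c \<rho> by (simp add: \<epsilon>_def)
  have less: "cmod (poly (chi \<mu>) t - poly (chi l) t) < cmod (poly (chi l) t)" if \<mu>: "\<mu> \<in> ball l \<epsilon>" and t: "cmod t = \<rho>" for \<mu> t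
  proof -
    have "poly (chi \<mu>) t - poly (chi l) t = (l - \<mu>) * t ^ r"
      by (simp add: eigenvalue_poly_def poly_monom algebra_simps)
    then have "cmod (poly (chi \<mu>) t - poly (chi l) t) = cmod (l - \<mu>) * \<rho> ^ r" using t by (simp add: norm_mult norm_power)
    also have "\<dots> < \<epsilon> * \<rho> ^ r" using \<mu> \<rho> by (intro mult_strict_right_mono) (auto simp: dist_norm)
    also have "\<dots> = c" using \<rho> by (simp add: \<epsilon>_def)
    also have "\<dots> \<le> cmod (poly (chi l) t)" using t0(2) t by (simp add: c_def)
    finally show ?thesis .
  qed
  show ?thesis
  proof (rule that[OF \<epsilon>])
    fix \<mu> assume \<mu>: "\<mu> \<in> ball l \<epsilon>"
    show "zeros_inside (chi \<mu>) \<rho> = zeros_inside (chi l) \<rho>" by (rule zeros_inside_rouche[OF \<rho> less[OF \<mu>]])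
    fix z assume z: "z \<in> roots_of \<mu>"
    show "cmod z \<noteq> \<rho>" using less[OF \<mu>, of z] z by auto
  qed
qed

lemma zeros_inside_chi_mono: "\<rho> \<le> \<rho>' \<Longrightarrow> zeros_inside (chi \<mu>) \<rho> \<le> zeros_inside (chi \<mu>) \<rho>'"
  unfolding zeros_inside_alt[OF chi_neq_0] by (rule sum_mono2) (use finite_roots_of[of \<mu>] in auto)

text \<open>Here \<open>m\<close> is the common modulus of the \<open>r\<close>-th and the next zero.\<close>

lemma limit_set_tie:
  assumes "l \<in> limit_set b r s"
  obtains m where "0 < m" "zeros_inside (chi l) m < r" "\<And>\<rho>. m < \<rho> \<Longrightarrow> r < zeros_inside (chi l) \<rho>"
proof -
  obtain zs where zs: "mset zs = proots (chi l)" "sorted (map cmod zs)" "cmod (zs ! (r - 1)) = cmod (zs ! r)"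
    using assms by (auto simp: limit_set_def)
  note len = sorted_zeros(1)[OF zs(1,2)] and set = sorted_zeros(2)[OF zs(1,2)]
    and mono = sorted_zeros(3)[OF zs(1,2)] and zi = sorted_zeros(4)[OF zs(1,2)]
  define m where "m = cmod (zs ! r)"
  show ?thesis
  proof (rule that[of m])
    have "zs ! r \<in> roots_of l" using s len set by (metis less_add_same_cancel1 nth_mem)
    then show "0 < m" using poly_chi_0[of l] by (auto simp: m_def)
    have "{i. i < N \<and> cmod (zs ! i) < m} \<subseteq> {..<r - 1}"
    proof
      fix i assume i: "i \<in> {i. i < N \<and> cmod (zs ! i) < m}"
      show "i \<in> {..<r - 1}"
      proof (rule ccontr)
        assume "i \<notin> {..<r - 1}"
        then have "cmod (zs ! (r - 1)) \<le> cmod (zs ! i)" using i by (intro mono) auto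
        then show False using i zs(3) by (simp add: m_def)
      qed
    qed
    from card_mono[OF _ this] have "zeros_inside (chi l) m \<le> r - 1" by (simp add: zi)
    then show "zeros_inside (chi l) m < r" using r by linarith
    fix \<rho> assume \<rho>: "m < \<rho>"
    have "{..r} \<subseteq> {i. i < N \<and> cmod (zs ! i) < \<rho>}"
    proof
      fix i assume i: "i \<in> {..r}"
      then have "cmod (zs ! i) \<le> m" unfolding m_def using s by (intro mono) auto
      then show "i \<in> {i. i < N \<and> cmod (zs ! i) < \<rho>}" using i s \<rho> by auto
    qed
    from card_mono[OF _ this] show "r < zeros_inside (chi l) \<rho>" by (simp add: zi)
  qed
qed

definition separating :: "complex \<Rightarrow> real \<Rightarrow> bool" where
  "separating \<mu> \<rho> \<longleftrightarrow> 0 < \<rho> \<and> zeros_inside (chi \<mu>) \<rho> = r \<and> (\<forall>z\<in>roots_of \<mu>. cmod z \<noteq> \<rho>)"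

text \<open>The choice of the radius does not matter when the zeros are simple (\<open>inner_roots_eq\<close>).\<close>

definition inner_roots :: "complex \<Rightarrow> complex set" where
  "inner_roots \<mu> = {z \<in> roots_of \<mu>. cmod z < (SOME \<rho>. separating \<mu> \<rho>)}"

lemma separating_exists:
  assumes "\<mu> \<notin> limit_set b r s"
  shows "\<exists>\<rho>. separating \<mu> \<rho>"
proof -
  obtain \<rho> where \<rho>: "zeros_inside (chi \<mu>) \<rho> = r" "\<forall>z\<in>roots_of \<mu>. cmod z \<noteq> \<rho>"
    using assms unfolding limit_set_iff by auto
  have "0 < \<rho>"
  proof (rule ccontr)
    assume "\<not> 0 < \<rho>"
    then have "{z. poly (chi \<mu>) z = 0 \<and> cmod z < \<rho>} = {}" by (auto simp: not_less) (meson norm_ge_zero not_le order_trans)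
    then have "zeros_inside (chi \<mu>) \<rho> = 0" unfolding zeros_inside_alt[OF chi_neq_0] by (simp only: sum.empty)
    then show False using \<rho>(1) r by simp
  qed
  then show ?thesis using \<rho> unfolding separating_def by blast
qed

lemma card_inside_simple:
  assumes "rsquarefree (chi \<mu>)"
  shows "zeros_inside (chi \<mu>) \<rho> = card {z \<in> roots_of \<mu>. cmod z < \<rho>}"
proof -
  have "zeros_inside (chi \<mu>) \<rho> = (\<Sum>z | poly (chi \<mu>) z = 0 \<and> cmod z < \<rho>. order z (chi \<mu>))"
    by (rule zeros_inside_alt[OF chi_neq_0])
  also have "\<dots> = (\<Sum>z | poly (chi \<mu>) z = 0 \<and> cmod z < \<rho>. 1)"
    by (rule sum.cong) (use rsquarefree_root_order[OF assms _ chi_neq_0] in auto)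
  finally show ?thesis by simp
qed

lemma inner_roots_eq:
  assumes sq: "rsquarefree (chi \<mu>)" and sep: "separating \<mu> \<rho>"
  shows "inner_roots \<mu> = {z \<in> roots_of \<mu>. cmod z < \<rho>}"
proof -
  define \<rho>' where "\<rho>' = (SOME \<rho>. separating \<mu> \<rho>)"
  have sep': "separating \<mu> \<rho>'" unfolding \<rho>'_def using sep by (rule someI)
  have c: "card {z \<in> roots_of \<mu>. cmod z < \<rho>} = r" "card {z \<in> roots_of \<mu>. cmod z < \<rho>'} = r"
    using sep sep' by (simp_all add: separating_def card_inside_simple[OF sq])
  have fin: "finite {z \<in> roots_of \<mu>. cmod z < x}" for x using finite_roots_of[of \<mu>] by simp
  have "{z \<in> roots_of \<mu>. cmod z < \<rho>'} = {z \<in> roots_of \<mu>. cmod z < \<rho>}"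
  proof (cases "\<rho> \<le> \<rho>'")
    case True
    then have "{z \<in> roots_of \<mu>. cmod z < \<rho>} \<subseteq> {z \<in> roots_of \<mu>. cmod z < \<rho>'}" by auto
    from card_subset_eq[OF fin this] c show ?thesis by simp
  next
    case False
    then have "{z \<in> roots_of \<mu>. cmod z < \<rho>'} \<subseteq> {z \<in> roots_of \<mu>. cmod z < \<rho>}" by auto
    from card_subset_eq[OF fin this] c show ?thesis by simp
  qed
  then show ?thesis by (simp add: inner_roots_def \<rho>'_def)
qed

text \<open>Below \<open>1\<close> outside the limit set, and near \<open>1\<close> close to it. Locally it is a maximum of
  moduli of holomorphic functions, so that it obeys a maximum principle.\<close>

definition spread :: "complex \<Rightarrow> real" where
  "spread \<mu> = Max ((\<lambda>(z, w). cmod z / cmod w) ` (inner_roots \<mu> \<times> (roots_of \<mu> - inner_roots \<mu>)))"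

text \<open>Near a regular point outside the limit set, a circle that separates the inner from the
  outer zeros does so for all nearby \<open>\<mu>\<close>, and the inner zeros are the values of a fixed set of
  branches.\<close>

lemma spread_local:
  assumes sq: "rsquarefree (chi \<mu>0)" and nl: "\<mu>0 \<notin> limit_set b r s"
  obtains \<epsilon> g I where "0 < \<epsilon>" "branches (ball \<mu>0 \<epsilon>) g" "I \<subseteq> {..<N}" "I \<noteq> {}" "{..<N} - I \<noteq> {}"
    "\<And>\<mu>. \<mu> \<in> ball \<mu>0 \<epsilon> \<Longrightarrow> rsquarefree (chi \<mu>) \<Longrightarrow>
       inner_roots \<mu> = (\<lambda>i. g i \<mu>) ` I \<and>
       spread \<mu> = Max ((\<lambda>p. cmod (g (fst p) \<mu>) / cmod (g (snd p) \<mu>)) ` (I \<times> ({..<N} - I)))"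
    "\<And>\<mu> i k. \<mu> \<in> ball \<mu>0 \<epsilon> \<Longrightarrow> i \<in> I \<Longrightarrow> k \<in> {..<N} - I \<Longrightarrow> cmod (g i \<mu>) < cmod (g k \<mu>)"
proof -
  obtain \<delta> g where \<delta>: "0 < \<delta>" and g: "branches (ball \<mu>0 \<delta>) g" using branches_exist[OF sq] .
  obtain \<rho> where sep: "separating \<mu>0 \<rho>" using separating_exists[OF nl] by blast
  then have \<rho>: "0 < \<rho>" "\<And>z. z \<in> roots_of \<mu>0 \<Longrightarrow> cmod z \<noteq> \<rho>" by (auto simp: separating_def)
  obtain \<epsilon>1 where \<epsilon>1: "0 < \<epsilon>1" "\<And>\<mu>. \<mu> \<in> ball \<mu>0 \<epsilon>1 \<Longrightarrow> zeros_inside (chi \<mu>) \<rho> = zeros_inside (chi \<mu>0) \<rho>"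
    "\<And>\<mu> z. \<mu> \<in> ball \<mu>0 \<epsilon>1 \<Longrightarrow> z \<in> roots_of \<mu> \<Longrightarrow> cmod z \<noteq> \<rho>"
    using zeros_inside_chi_locally_constant[OF \<rho>] by metis
  define \<epsilon> where "\<epsilon> = min \<delta> \<epsilon>1"
  have \<epsilon>: "0 < \<epsilon>" "ball \<mu>0 \<epsilon> \<subseteq> ball \<mu>0 \<delta>" "ball \<mu>0 \<epsilon> \<subseteq> ball \<mu>0 \<epsilon>1" using \<delta> \<epsilon>1 by (auto simp: \<epsilon>_def)
  have g': "branches (ball \<mu>0 \<epsilon>) g" by (rule branches_subset[OF g \<epsilon>(2)])
  have sep': "separating \<mu> \<rho>" if "\<mu> \<in> ball \<mu>0 \<epsilon>" for \<mu>
  proof -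
    have m: "\<mu> \<in> ball \<mu>0 \<epsilon>1" using that \<epsilon>(3) by blast
    show ?thesis unfolding separating_def using \<epsilon>1(2)[OF m] \<epsilon>1(3)[OF m] sep \<rho>(1) by (auto simp: separating_def)
  qed
  have rts: "roots_of \<mu> = (\<lambda>i. g i \<mu>) ` {..<N}" if "\<mu> \<in> ball \<mu>0 \<epsilon>" for \<mu> by (rule branches_roots[OF g' that])
  define I where "I = {i. i < N \<and> cmod (g i \<mu>0) < \<rho>}"
  have m0: "\<mu>0 \<in> ball \<mu>0 \<epsilon>" using \<epsilon> by simp
  have ns: "cmod (g i \<mu>) \<noteq> \<rho>" if "\<mu> \<in> ball \<mu>0 \<epsilon>" "i < N" for i \<mu>
    using sep'[OF that(1)] rts[OF that(1)] that(2) unfolding separating_def by blast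
  have side: "(cmod (g i \<mu>) < \<rho>) = (cmod (g i \<mu>0) < \<rho>)" if \<mu>: "\<mu> \<in> ball \<mu>0 \<epsilon>" and i: "i < N" for i \<mu>
  proof -
    have "continuous_on (ball \<mu>0 \<epsilon>) (\<lambda>\<mu>. cmod (g i \<mu>))"
      using g' i by (intro continuous_intros holomorphic_on_imp_continuous_on) (auto simp: branches_def)
    then have "connected ((\<lambda>\<mu>. cmod (g i \<mu>)) ` ball \<mu>0 \<epsilon>)" by (intro connected_continuous_image) auto
    moreover have "\<rho> \<notin> (\<lambda>\<mu>. cmod (g i \<mu>)) ` ball \<mu>0 \<epsilon>" using ns i by force
    ultimately have "\<not> (x < \<rho> \<and> \<rho> < y)" if "x \<in> (\<lambda>\<mu>. cmod (g i \<mu>)) ` ball \<mu>0 \<epsilon>" "y \<in> (\<lambda>\<mu>. cmod (g i \<mu>)) ` ball \<mu>0 \<epsilon>" for x y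
      using that by (meson connected_contains_Icc atLeastAtMost_iff less_imp_le subsetD)
    then show ?thesis using \<mu> m0 ns[OF \<mu> i] ns[OF m0 i] by (metis image_eqI linorder_neqE_linordered_idom)
  qed
  have lt: "cmod (g i \<mu>) < cmod (g k \<mu>)" if "\<mu> \<in> ball \<mu>0 \<epsilon>" "i \<in> I" "k \<in> {..<N} - I" for \<mu> i k
  proof -
    have "cmod (g i \<mu>) < \<rho>" using side[OF that(1)] that(2) by (auto simp: I_def)
    moreover have "\<not> cmod (g k \<mu>) < \<rho>" using side[OF that(1)] that(3) by (auto simp: I_def)
    ultimately show ?thesis by linarith
  qed
  have "card I = r" using sep by (simp add: separating_def I_def zeros_inside_branches[OF g' m0])
  then have ne: "I \<noteq> {}" "{..<N} - I \<noteq> {}"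
  proof -
    show "I \<noteq> {}" using \<open>card I = r\<close> r by auto
    have "I \<subseteq> {..<N}" by (auto simp: I_def)
    then have "card ({..<N} - I) = s" using \<open>card I = r\<close> by (simp add: card_Diff_subset finite_subset)
    then show "{..<N} - I \<noteq> {}" using s by (metis card.empty less_irrefl)
  qed
  show ?thesis
  proof (rule that[OF \<epsilon>(1) g' _ ne])
    show "I \<subseteq> {..<N}" by (auto simp: I_def)
    fix \<mu> assume \<mu>: "\<mu> \<in> ball \<mu>0 \<epsilon>" and sq: "rsquarefree (chi \<mu>)"
    have inj: "inj_on (\<lambda>i. g i \<mu>) {..<N}" using g' \<mu> by (auto simp: branches_def)
    have inn: "inner_roots \<mu> = (\<lambda>i. g i \<mu>) ` I"
      unfolding inner_roots_eq[OF sq sep'[OF \<mu>]] rts[OF \<mu>] using side[OF \<mu>] by (auto simp: I_def)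
    have out: "roots_of \<mu> - inner_roots \<mu> = (\<lambda>i. g i \<mu>) ` ({..<N} - I)"
      unfolding rts[OF \<mu>] inn using inj by (intro inj_on_image_set_diff[symmetric, of _ "{..<N}"]) (auto simp: I_def)
    have "(\<lambda>(z, w). cmod z / cmod w) ` (inner_roots \<mu> \<times> (roots_of \<mu> - inner_roots \<mu>))
        = (\<lambda>p. cmod (g (fst p) \<mu>) / cmod (g (snd p) \<mu>)) ` (I \<times> ({..<N} - I))"
      unfolding out unfolding inn image_paired_Times[symmetric] image_image by (simp add: case_prod_unfold)
    then show "inner_roots \<mu> = (\<lambda>i. g i \<mu>) ` I \<and>
       spread \<mu> = Max ((\<lambda>p. cmod (g (fst p) \<mu>) / cmod (g (snd p) \<mu>)) ` (I \<times> ({..<N} - I)))"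
      using inn by (simp add: spread_def)
  qed (rule lt)
qed

end

context banded_symbol
begin

text \<open>Otherwise, since critical values are isolated, a punctured disc around \<open>l0\<close> contains
  neither points of the limit set nor critical values, and the spread \<open>M\<close> is defined there. The
  inner zeros need not extend to single-valued functions around \<open>l0\<close>, but \<open>M(\<mu>)\<^sup>n \<bar>\<mu> - l0\<bar>\<close>
  still obeys the maximum principle and tends to \<open>0\<close> at \<open>l0\<close>. Hence it is at most \<open>q\<^sup>n d\<close>, where
  \<open>q < 1\<close> is the maximum of \<open>M\<close> on a circle of radius \<open>d\<close>. Taking \<open>n\<close>-th roots as \<open>n\<close> tends to
  infinity gives \<open>M \<le> q\<close> in the punctured disc. But near \<open>l0\<close> some inner and some outer zero
  have moduli close to the common modulus of the tie at \<open>l0\<close>, which makes \<open>M\<close> close to \<open>1\<close>.\<close>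

lemma limit_set_not_isolated:
  assumes l0: "l0 \<in> limit_set b r s" and e: "0 < e"
  shows "\<exists>l\<in>limit_set b r s \<inter> ball l0 e. rsquarefree (chi l)"
proof (rule ccontr)
  assume nex: "\<not> ?thesis"
  define crit where "crit = {l. \<not> rsquarefree (chi l)}"
  have fin: "finite crit" unfolding crit_def by (rule critical_values_finite)
  obtain d0 where d0: "0 < d0" "\<forall>x\<in>crit. x \<noteq> l0 \<longrightarrow> d0 \<le> dist l0 x"
    using finite_set_avoid[OF fin, of l0] by blast
  define d where "d = min d0 e / 2"
  have d: "0 < d" "d < d0" "d < e" using d0 e by (auto simp: d_def)
  define U where "U = ball l0 (2 * d) - {l0}"
  have openU: "open U" by (auto simp: U_def)
  have sq: "rsquarefree (chi \<mu>)" if "\<mu> \<in> U" for \<mu>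
    using that d0(2) d by (force simp: U_def crit_def d_def)
  have nl: "\<mu> \<notin> limit_set b r s" if "\<mu> \<in> U" for \<mu>
  proof
    assume "\<mu> \<in> limit_set b r s"
    moreover have "\<mu> \<in> ball l0 e" using that by (auto simp: U_def d_def)
    ultimately show False using nex sq[OF that] by blast
  qed
  have loc: "\<exists>\<epsilon>>0. \<exists>g I. ball \<mu>0 \<epsilon> \<subseteq> U \<and> branches (ball \<mu>0 \<epsilon>) g \<and> I \<subseteq> {..<N} \<and> I \<noteq> {} \<and> {..<N} - I \<noteq> {} \<and>
     (\<forall>\<mu>\<in>ball \<mu>0 \<epsilon>. spread \<mu> = Max ((\<lambda>p. cmod (g (fst p) \<mu>) / cmod (g (snd p) \<mu>)) ` (I \<times> ({..<N} - I)))) \<and>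
     (\<forall>\<mu>\<in>ball \<mu>0 \<epsilon>. \<forall>i\<in>I. \<forall>k\<in>{..<N} - I. cmod (g i \<mu>) < cmod (g k \<mu>))"
    if \<mu>0: "\<mu>0 \<in> U" for \<mu>0
  proof (rule spread_local[OF sq[OF \<mu>0] nl[OF \<mu>0]])
    fix \<epsilon> g I
    assume h: "0 < \<epsilon>" "branches (ball \<mu>0 \<epsilon>) g" "I \<subseteq> {..<N}" "I \<noteq> {}" "{..<N} - I \<noteq> {}"
      and h2: "\<And>\<mu>. \<mu> \<in> ball \<mu>0 \<epsilon> \<Longrightarrow> rsquarefree (chi \<mu>) \<Longrightarrow>
       inner_roots \<mu> = (\<lambda>i. g i \<mu>) ` I \<and>
       spread \<mu> = Max ((\<lambda>p. cmod (g (fst p) \<mu>) / cmod (g (snd p) \<mu>)) ` (I \<times> ({..<N} - I)))"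
      and h3: "\<And>\<mu> i k. \<mu> \<in> ball \<mu>0 \<epsilon> \<Longrightarrow> i \<in> I \<Longrightarrow> k \<in> {..<N} - I \<Longrightarrow> cmod (g i \<mu>) < cmod (g k \<mu>)"
    obtain \<epsilon>' where \<epsilon>': "0 < \<epsilon>'" "ball \<mu>0 \<epsilon>' \<subseteq> U" using openU \<mu>0 open_contains_ball by blast
    have sub: "ball \<mu>0 (min \<epsilon> \<epsilon>') \<subseteq> ball \<mu>0 \<epsilon>" "ball \<mu>0 (min \<epsilon> \<epsilon>') \<subseteq> U" using \<epsilon>' by auto
    show ?thesis
    proof (intro exI conjI ballI)
      show "0 < min \<epsilon> \<epsilon>'" using h(1) \<epsilon>'(1) by simp
      show "ball \<mu>0 (min \<epsilon> \<epsilon>') \<subseteq> U" by (rule sub(2))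
      show "branches (ball \<mu>0 (min \<epsilon> \<epsilon>')) g" by (rule branches_subset[OF h(2) sub(1)])
      show "I \<subseteq> {..<N}" "I \<noteq> {}" "{..<N} - I \<noteq> {}" by fact+
      fix \<mu> assume \<mu>: "\<mu> \<in> ball \<mu>0 (min \<epsilon> \<epsilon>')"
      then have \<mu>': "\<mu> \<in> ball \<mu>0 \<epsilon>" "\<mu> \<in> U" using sub by blast+
      show "spread \<mu> = Max ((\<lambda>p. cmod (g (fst p) \<mu>) / cmod (g (snd p) \<mu>)) ` (I \<times> ({..<N} - I)))"
        using h2[OF \<mu>'(1) sq[OF \<mu>'(2)]] by (rule conjunct2)
      fix i k assume "i \<in> I" "k \<in> {..<N} - I"
      then show "cmod (g i \<mu>) < cmod (g k \<mu>)" by (rule h3[OF \<mu>'(1)])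
    qed
  qed
  have pairs: "finite (I \<times> ({..<N} - I))" if "I \<subseteq> {..<N}" for I
    using that finite_subset by blast
  \<comment> \<open>\<open>f\<close> is the quotient of branches that attains the maximum at \<open>\<mu>0\<close>\<close>
  have max_at: "\<exists>\<epsilon>>0. \<exists>f. ball \<mu>0 \<epsilon> \<subseteq> U \<and> f holomorphic_on ball \<mu>0 \<epsilon> \<and> cmod (f \<mu>0) = spread \<mu>0 \<and> (\<forall>\<mu>\<in>ball \<mu>0 \<epsilon>. cmod (f \<mu>) \<le> spread \<mu>)"
    and spread_bounds: "0 < spread \<mu>0 \<and> spread \<mu>0 < 1"
    and spread_cont: "isCont spread \<mu>0" if \<mu>0: "\<mu>0 \<in> U" for \<mu>0
  proof -
    obtain \<epsilon> g I where \<epsilon>: "0 < \<epsilon>" "ball \<mu>0 \<epsilon> \<subseteq> U" and g: "branches (ball \<mu>0 \<epsilon>) g"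
      and I: "I \<subseteq> {..<N}" "I \<noteq> {}" "{..<N} - I \<noteq> {}"
      and sp: "\<forall>\<mu>\<in>ball \<mu>0 \<epsilon>. spread \<mu> = Max ((\<lambda>p. cmod (g (fst p) \<mu>) / cmod (g (snd p) \<mu>)) ` (I \<times> ({..<N} - I)))"
      and lt: "\<forall>\<mu>\<in>ball \<mu>0 \<epsilon>. \<forall>i\<in>I. \<forall>k\<in>{..<N} - I. cmod (g i \<mu>) < cmod (g k \<mu>)"
      using loc[OF \<mu>0] by (elim exE conjE)
    have m0: "\<mu>0 \<in> ball \<mu>0 \<epsilon>" using \<epsilon> by simp
    define P where "P = I \<times> ({..<N} - I)"
    have P: "finite P" "P \<noteq> {}" using pairs[OF I(1)] I by (auto simp: P_def)
    define F where "F p \<mu> = g (fst p) \<mu> / g (snd p) \<mu>" for p \<mu>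
    have PN: "fst p < N" "snd p < N" if "p \<in> P" for p using that I by (auto simp: P_def)
    have holF: "F p holomorphic_on ball \<mu>0 \<epsilon>" if "p \<in> P" for p
      unfolding F_def using g PN[OF that] by (intro holomorphic_on_divide) (auto simp: branches_def)
    have sp': "spread \<mu> = Max ((\<lambda>p. cmod (F p \<mu>)) ` P)" if "\<mu> \<in> ball \<mu>0 \<epsilon>" for \<mu>
      using bspec[OF sp that] by (simp add: F_def P_def norm_divide)
    have "spread \<mu>0 \<in> (\<lambda>p. cmod (F p \<mu>0)) ` P" unfolding sp'[OF m0] using P by (intro Max_in) auto
    then obtain p where p: "p \<in> P" "spread \<mu>0 = cmod (F p \<mu>0)" by blast
    have Fle: "cmod (F p \<mu>) \<le> spread \<mu>" if "\<mu> \<in> ball \<mu>0 \<epsilon>" for \<mu>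
      unfolding sp'[OF that] using P p(1) by (intro Max_ge) auto
    show "\<exists>\<epsilon>>0. \<exists>f. ball \<mu>0 \<epsilon> \<subseteq> U \<and> f holomorphic_on ball \<mu>0 \<epsilon> \<and> cmod (f \<mu>0) = spread \<mu>0 \<and> (\<forall>\<mu>\<in>ball \<mu>0 \<epsilon>. cmod (f \<mu>) \<le> spread \<mu>)"
      using \<epsilon> holF[OF p(1)] p(2) Fle by (intro exI[of _ \<epsilon>] exI[of _ "F p"] conjI) auto
    have gn: "g (fst p) \<mu>0 \<noteq> 0" "g (snd p) \<mu>0 \<noteq> 0" using g m0 PN[OF p(1)] by (auto simp: branches_def)
    have "cmod (g (fst p) \<mu>0) < cmod (g (snd p) \<mu>0)" using lt m0 p(1) by (auto simp: P_def)
    then show "0 < spread \<mu>0 \<and> spread \<mu>0 < 1" unfolding p(2) F_def using gn by (simp add: norm_divide)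
    have "continuous_on (ball \<mu>0 \<epsilon>) (\<lambda>\<mu>. Max ((\<lambda>p. cmod (F p \<mu>)) ` P))"
      using holF by (intro continuous_on_Max_finite P continuous_on_norm holomorphic_on_imp_continuous_on)
    then have "continuous_on (ball \<mu>0 \<epsilon>) spread" by (rule continuous_on_eq) (simp add: sp')
    then show "isCont spread \<mu>0" using m0 by (simp add: continuous_on_eq_continuous_at)
  qed
  have sphU: "sphere l0 d \<subseteq> U" using d by (auto simp: U_def)
  have "continuous_on (sphere l0 d) spread"
    using spread_cont sphU by (intro continuous_at_imp_continuous_on) blast
  moreover have "sphere l0 d \<noteq> {}" using d by simp
  ultimately obtain \<mu>q where \<mu>q: "\<mu>q \<in> sphere l0 d" "\<forall>\<mu>\<in>sphere l0 d. spread \<mu> \<le> spread \<mu>q"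
    using continuous_attains_sup[OF compact_sphere] by blast
  define q where "q = spread \<mu>q"
  have q: "0 < q" "q < 1" using spread_bounds \<mu>q(1) sphU by (auto simp: q_def)
  have power_bound: "spread \<mu>1 ^ n * cmod (\<mu>1 - l0) \<le> q ^ n * d" if \<mu>1: "\<mu>1 \<in> ball l0 d" "\<mu>1 \<noteq> l0" and n: "0 < n" for \<mu>1 n
  proof (rule ccontr)
    assume gt: "\<not> ?thesis"
    define \<psi> where "\<psi> \<mu> = (if \<mu> = l0 then 0 else spread \<mu> ^ n * cmod (\<mu> - l0))" for \<mu>
    have cb: "\<mu> \<in> U" if "\<mu> \<in> cball l0 d" "\<mu> \<noteq> l0" for \<mu> using that d by (auto simp: U_def)
    have contU: "isCont \<psi> \<mu>" if \<mu>: "\<mu> \<in> U" for \<mu>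
    proof -
      have c: "isCont (\<lambda>\<mu>. spread \<mu> ^ n * cmod (\<mu> - l0)) \<mu>" by (intro continuous_intros spread_cont[OF \<mu>])
      have ev: "eventually (\<lambda>x. \<psi> x = spread x ^ n * cmod (x - l0)) (nhds \<mu>)"
        using eventually_nhds_in_open[OF openU \<mu>] by eventually_elim (auto simp: \<psi>_def U_def)
      show ?thesis by (subst isCont_cong[OF ev]) (rule c)
    qed
    have small: "\<psi> \<mu> \<le> cmod (\<mu> - l0)" "0 \<le> \<psi> \<mu>" if "\<mu> \<in> U \<or> \<mu> = l0" for \<mu>
    proof -
      have "\<psi> \<mu> \<le> cmod (\<mu> - l0) \<and> 0 \<le> \<psi> \<mu>"
      proof (cases "\<mu> = l0")
        case False
        then have "\<mu> \<in> U" using that by blast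
        then have "0 < spread \<mu>" "spread \<mu> < 1" using spread_bounds by blast+
        then have "spread \<mu> ^ n \<le> 1" "0 \<le> spread \<mu> ^ n" by (simp_all add: power_le_one)
        then show ?thesis using False by (simp add: \<psi>_def mult_left_le_one_le)
      qed (simp add: \<psi>_def)
      then show "\<psi> \<mu> \<le> cmod (\<mu> - l0)" "0 \<le> \<psi> \<mu>" by auto
    qed
    have cont0: "isCont \<psi> l0"
      unfolding isCont_def
    proof (rule Lim_null_comparison[where g = "\<lambda>\<mu>. cmod (\<mu> - l0)", THEN tendsto_eq_rhs])
      have "eventually (\<lambda>\<mu>. \<mu> \<in> ball l0 (2 * d)) (nhds l0)" using d by (intro eventually_nhds_in_open) auto
      then have "eventually (\<lambda>\<mu>. \<mu> \<in> ball l0 (2 * d)) (at l0)" unfolding eventually_at_filter by eventually_elim auto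
      then show "eventually (\<lambda>\<mu>. norm (\<psi> \<mu>) \<le> cmod (\<mu> - l0)) (at l0)"
        by eventually_elim (use small in \<open>auto simp: U_def\<close>)
      show "((\<lambda>\<mu>. cmod (\<mu> - l0)) \<longlongrightarrow> 0) (at l0)" by (rule tendsto_eq_intros refl | simp)+
    qed (simp add: \<psi>_def)
    have cont: "continuous_on (cball l0 d) \<psi>"
      using contU cont0 cb by (intro continuous_at_imp_continuous_on ballI) (metis)
    obtain \<mu>m where \<mu>m: "\<mu>m \<in> cball l0 d" "\<forall>\<mu>\<in>cball l0 d. \<psi> \<mu> \<le> \<psi> \<mu>m"
      using continuous_attains_sup[OF compact_cball _ cont] d by auto
    define v where "v = \<psi> \<mu>m"
    have "\<psi> \<mu>1 \<le> v" using \<mu>m(2) \<mu>1 by (simp add: v_def)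
    then have v: "q ^ n * d < v" using gt \<mu>1 by (simp add: \<psi>_def)
    then have v0: "0 < v" using q d by (meson less_trans mult_pos_pos zero_less_power)
    have notsph: "\<psi> \<mu> < v" if "\<mu> \<in> sphere l0 d" for \<mu>
    proof -
      have "\<mu> \<in> U" using that sphU by blast
      then have "0 < spread \<mu>" "spread \<mu> \<le> q" using spread_bounds \<mu>q(2) that by (auto simp: q_def)
      then have "spread \<mu> ^ n \<le> q ^ n" by (intro power_mono) auto
      then have "\<psi> \<mu> \<le> q ^ n * d" using that d
        by (auto simp: \<psi>_def dist_norm norm_minus_commute intro!: mult_right_mono)
      then show ?thesis using v by linarith
    qed
    \<comment> \<open>If \<open>\<psi>\<close> attains its maximum \<open>v\<close> at \<open>a\<close>, then \<open>f\<^sup>n (\<mu> - l0)\<close> has maximal modulus at \<open>a\<close> and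
      is constant, so \<open>\<psi> = v\<close> around \<open>a\<close>. By connectedness \<open>\<psi> = v\<close> everywhere, but \<open>\<psi> l0 = 0\<close>.\<close>
    have "(\<lambda>\<mu>. \<psi> \<mu> = v) constant_on ball l0 d"
    proof (rule locally_constant_imp_constant)
      fix a assume a: "a \<in> ball l0 d"
      show "\<exists>T. openin (top_of_set (ball l0 d)) T \<and> a \<in> T \<and> (\<forall>x\<in>T. (\<psi> x = v) = (\<psi> a = v))"
      proof (cases "\<psi> a = v")
        case False
        have c: "continuous_on (ball l0 d) \<psi>" using cont by (rule continuous_on_subset) auto
        have "open (- {v})" by (intro open_Compl closed_singleton)
        with c have "openin (top_of_set (ball l0 d)) (ball l0 d \<inter> \<psi> -` (- {v}))"
          by (rule continuous_openin_preimage_gen)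
        then show ?thesis using a False by (intro exI[of _ "ball l0 d \<inter> \<psi> -` (- {v})"]) auto
      next
        case True
        then have "a \<noteq> l0" using v0 by (auto simp: \<psi>_def)
        then have aU: "a \<in> U" using cb a by auto
        obtain \<epsilon> f where \<epsilon>: "0 < \<epsilon>" "ball a \<epsilon> \<subseteq> U" and f: "f holomorphic_on ball a \<epsilon>"
          and fa: "cmod (f a) = spread a" and fle: "\<forall>\<mu>\<in>ball a \<epsilon>. cmod (f \<mu>) \<le> spread \<mu>"
          using max_at[OF aU] by (elim exE conjE)
        define V where "V = ball a \<epsilon> \<inter> ball l0 d"
        define h where "h \<mu> = f \<mu> ^ n * (\<mu> - l0)" for \<mu>
        have hle: "cmod (h \<mu>) \<le> \<psi> \<mu>" if "\<mu> \<in> ball a \<epsilon>" for \<mu>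
        proof -
          have "\<mu> \<noteq> l0" using that \<epsilon>(2) by (auto simp: U_def)
          moreover have "cmod (f \<mu>) ^ n \<le> spread \<mu> ^ n" using fle that by (intro power_mono) auto
          ultimately show ?thesis by (simp add: h_def \<psi>_def norm_mult norm_power mult_right_mono)
        qed
        have ha: "cmod (h a) = v" using True \<open>a \<noteq> l0\<close> fa by (simp add: h_def \<psi>_def norm_mult norm_power)
        have le_v: "\<psi> \<mu> \<le> v" if "\<mu> \<in> ball l0 d" for \<mu> using \<mu>m(2) that by (simp add: v_def)
        have "h constant_on ball a \<epsilon>"
        proof (rule maximum_modulus_principle[where U = V and \<xi> = a])
          show "h holomorphic_on ball a \<epsilon>" unfolding h_def by (intro holomorphic_intros f)
          show "open V" "V \<subseteq> ball a \<epsilon>" "a \<in> V" using a \<epsilon>(1) by (auto simp: V_def)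
          show "cmod (h z) \<le> cmod (h a)" if "z \<in> V" for z
            using hle[of z] le_v[of z] that ha by (auto simp: V_def)
        qed auto
        then obtain c where c: "\<And>\<mu>. \<mu> \<in> ball a \<epsilon> \<Longrightarrow> h \<mu> = c" by (auto simp: constant_on_def)
        have "\<psi> \<mu> = v" if \<mu>: "\<mu> \<in> V" for \<mu>
        proof -
          have "h \<mu> = h a" using c[of \<mu>] c[of a] \<mu> \<epsilon>(1) by (auto simp: V_def)
          then show ?thesis using hle[of \<mu>] le_v[of \<mu>] \<mu> ha by (auto simp: V_def)
        qed
        moreover have "openin (top_of_set (ball l0 d)) V" unfolding V_def by (subst Int_commute) (simp add: openin_open_Int)
        ultimately show ?thesis using True a \<epsilon>(1) by (intro exI[of _ V]) (auto simp: V_def)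
      qed
    qed simp
    then obtain c where c: "\<And>\<mu>. \<mu> \<in> ball l0 d \<Longrightarrow> (\<psi> \<mu> = v) = c" unfolding constant_on_def by blast
    have "\<mu>m \<notin> sphere l0 d" using notsph[of \<mu>m] by (auto simp: v_def)
    then have "\<mu>m \<in> ball l0 d" using \<mu>m(1) by (auto simp: less_le)
    then have "c" using c[of \<mu>m] by (simp add: v_def)
    moreover have "l0 \<in> ball l0 d" using d by simp
    ultimately have "\<psi> l0 = v" using c by blast
    then show False using v0 by (simp add: \<psi>_def)
  qed
  have spread_le: "spread \<mu> \<le> q" if \<mu>: "\<mu> \<in> ball l0 d" "\<mu> \<noteq> l0" for \<mu>
  proof (rule ccontr)
    assume "\<not> spread \<mu> \<le> q"
    then have "1 < spread \<mu> / q" using q by simp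
    then obtain n where n: "d / cmod (\<mu> - l0) < (spread \<mu> / q) ^ n" using real_arch_pow by blast
    have "1 \<le> (spread \<mu> / q)" using \<open>1 < spread \<mu> / q\<close> by simp
    from power_increasing[OF _ this, of n "Suc n"] have "(spread \<mu> / q) ^ n \<le> (spread \<mu> / q) ^ Suc n"
      by (simp only: le_SucI order_refl)
    then have n': "d / cmod (\<mu> - l0) < (spread \<mu> / q) ^ Suc n" using n by linarith
    have "0 < cmod (\<mu> - l0)" using \<mu> by simp
    then have "d < (spread \<mu> / q) ^ Suc n * cmod (\<mu> - l0)" using n' by (simp only: pos_divide_less_eq)
    then have "q ^ Suc n * d < q ^ Suc n * ((spread \<mu> / q) ^ Suc n * cmod (\<mu> - l0))"
      using q by (intro mult_strict_left_mono) auto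
    also have "\<dots> = spread \<mu> ^ Suc n * cmod (\<mu> - l0)" using q by (simp add: power_divide)
    finally show False using power_bound[OF \<mu>, of "Suc n"] by simp
  qed
  obtain m where m: "0 < m" "zeros_inside (chi l0) m < r" "\<And>\<rho>. m < \<rho> \<Longrightarrow> r < zeros_inside (chi l0) \<rho>"
    using limit_set_tie[OF l0] by blast
  \<comment> \<open>For \<open>\<eta> < h\<close> the quotient \<open>(m - \<eta>) / (m + \<eta>)\<close> exceeds \<open>q\<close>. Near \<open>l0\<close> fewer than \<open>r\<close> zeros
    have modulus below \<open>m - \<eta>\<close> and more than \<open>r\<close> have modulus below \<open>m + \<eta>\<close>, once \<open>\<eta>\<close> is chosen
    such that no zero at \<open>l0\<close> lies on either circle.\<close>
  define h where "h = m * (1 - q) / 4"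
  have "0 < m * (1 - q)" using m(1) q by simp
  moreover have "m * (1 - q) \<le> m * 1" using m(1) q by (intro mult_left_mono) auto
  ultimately have h: "0 < h" "h < m" using m(1) unfolding h_def by linarith+
  have "infinite {0<..<h}" using h by (simp add: infinite_Ioo)
  moreover have "finite ((\<lambda>z. \<bar>cmod z - m\<bar>) ` roots_of l0)" using finite_roots_of by simp
  ultimately obtain \<eta> where \<eta>: "\<eta> \<in> {0<..<h}" "\<eta> \<notin> (\<lambda>z. \<bar>cmod z - m\<bar>) ` roots_of l0"
    by (meson finite_subset subsetI)
  have nz: "cmod z \<noteq> m + \<eta>" "cmod z \<noteq> m - \<eta>" if "z \<in> roots_of l0" for z
    using \<eta> that by (auto simp: image_iff)
  have pos: "0 < m + \<eta>" "0 < m - \<eta>" using m(1) \<eta> h by auto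
  obtain \<epsilon>1 where \<epsilon>1: "0 < \<epsilon>1" "\<And>\<mu>. \<mu> \<in> ball l0 \<epsilon>1 \<Longrightarrow> zeros_inside (chi \<mu>) (m + \<eta>) = zeros_inside (chi l0) (m + \<eta>)"
    using zeros_inside_chi_locally_constant[OF pos(1) nz(1)] by metis
  obtain \<epsilon>2 where \<epsilon>2: "0 < \<epsilon>2" "\<And>\<mu>. \<mu> \<in> ball l0 \<epsilon>2 \<Longrightarrow> zeros_inside (chi \<mu>) (m - \<eta>) = zeros_inside (chi l0) (m - \<eta>)"
    using zeros_inside_chi_locally_constant[OF pos(2) nz(2)] by metis
  define \<mu> where "\<mu> = l0 + of_real (min (min \<epsilon>1 \<epsilon>2) d / 2)"
  have "dist l0 \<mu> = min (min \<epsilon>1 \<epsilon>2) d / 2" using \<epsilon>1(1) \<epsilon>2(1) d(1) by (simp add: \<mu>_def dist_norm)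
  then have \<mu>: "\<mu> \<in> ball l0 \<epsilon>1" "\<mu> \<in> ball l0 \<epsilon>2" "\<mu> \<in> ball l0 d" "\<mu> \<noteq> l0"
    using \<epsilon>1(1) \<epsilon>2(1) d(1) by auto
  have \<mu>U: "\<mu> \<in> U" using \<mu> d by (auto simp: U_def)
  obtain \<rho> where sep: "separating \<mu> \<rho>" using separating_exists[OF nl[OF \<mu>U]] by blast
  have inn: "inner_roots \<mu> = {z \<in> roots_of \<mu>. cmod z < \<rho>}" by (rule inner_roots_eq[OF sq[OF \<mu>U] sep])
  have cardinn: "card (inner_roots \<mu>) = r"
    using sep by (simp add: inn separating_def card_inside_simple[OF sq[OF \<mu>U]])
  have fininn: "finite (inner_roots \<mu>)" unfolding inn using finite_roots_of[of \<mu>] by simp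
  have c1: "card {z \<in> roots_of \<mu>. cmod z < m - \<eta>} < r"
  proof -
    have "zeros_inside (chi l0) (m - \<eta>) \<le> zeros_inside (chi l0) m" using \<eta> by (intro zeros_inside_chi_mono) auto
    then show ?thesis using m(2) \<epsilon>2(2)[OF \<mu>(2)] by (simp add: card_inside_simple[OF sq[OF \<mu>U]])
  qed
  have c2: "r < card {z \<in> roots_of \<mu>. cmod z < m + \<eta>}"
    using m(3)[of "m + \<eta>"] \<eta> \<epsilon>1(2)[OF \<mu>(1)] by (simp add: card_inside_simple[OF sq[OF \<mu>U]])
  have "\<exists>z\<in>inner_roots \<mu>. m - \<eta> \<le> cmod z"
  proof (rule ccontr)
    assume "\<not> ?thesis"
    then have "inner_roots \<mu> \<subseteq> {z \<in> roots_of \<mu>. cmod z < m - \<eta>}" by (auto simp: inn)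
    from card_mono[OF _ this] c1 cardinn finite_roots_of[of \<mu>] show False by simp
  qed
  then obtain z where z: "z \<in> inner_roots \<mu>" "m - \<eta> \<le> cmod z" by blast
  have "\<exists>w\<in>roots_of \<mu> - inner_roots \<mu>. cmod w < m + \<eta>"
  proof (rule ccontr)
    assume "\<not> ?thesis"
    then have "{z \<in> roots_of \<mu>. cmod z < m + \<eta>} \<subseteq> inner_roots \<mu>" by auto
    from card_mono[OF fininn this] c2 cardinn show False by simp
  qed
  then obtain w where w: "w \<in> roots_of \<mu> - inner_roots \<mu>" "cmod w < m + \<eta>" by blast
  have w0: "0 < cmod w" using w(1) poly_chi_0[of \<mu>] by auto
  have "cmod z / cmod w \<le> spread \<mu>"
    unfolding spread_def
  proof (rule Max_ge)
    show "finite ((\<lambda>(z, w). cmod z / cmod w) ` (inner_roots \<mu> \<times> (roots_of \<mu> - inner_roots \<mu>)))"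
      using fininn finite_roots_of[of \<mu>] by simp
    show "cmod z / cmod w \<in> (\<lambda>(z, w). cmod z / cmod w) ` (inner_roots \<mu> \<times> (roots_of \<mu> - inner_roots \<mu>))"
      using z(1) w(1) by (intro image_eqI[of _ _ "(z, w)"]) auto
  qed
  also have "\<dots> \<le> q" by (rule spread_le[OF \<mu>(3,4)])
  finally have "cmod z \<le> q * cmod w" using w0 by (simp add: pos_divide_le_eq)
  also have "\<dots> \<le> q * (m + \<eta>)" using w(2) q by (intro mult_left_mono) auto
  finally have "m - \<eta> \<le> q * (m + \<eta>)" using z(2) by linarith
  moreover have "q * \<eta> \<le> \<eta>" using q \<eta> by simp
  ultimately have "m * (1 - q) \<le> 2 * \<eta>" by (simp add: algebra_simps)
  moreover have "2 * \<eta> < m * (1 - q) / 2" using \<eta> by (simp add: h_def)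
  moreover have "0 < m * (1 - q)" using m(1) q by simp
  ultimately show False by linarith
qed

end

section \<open>Convergence of the polygon spectra\<close>

text \<open>\<open>T(a) - l\<close> is a perturbation of the multiplication by \<open>-l\<close>.\<close>

lemma toeplitz_spectrum_bounded:
  assumes a: "continuous_on circle a" and M: "\<And>t. t \<in> circle \<Longrightarrow> cmod (a t) \<le> M" and l: "M < cmod l"
  shows "l \<notin> ell2_spectrum (toeplitz a)"
proof -
  have M0: "0 \<le> M" using M[of 1] order_trans[OF norm_ge_zero[of "a 1"]] by simp
  then have l0: "0 < cmod l" using l by linarith
  define S where "S x = (\<lambda>n. (- 1 / l) * x n)" for x :: "nat \<Rightarrow> complex"
  have Sb: "ell2_norm (S x) \<le> (1 / cmod l) * ell2_norm x" if "x \<in> ell2" for x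
    using ell2_scale(2)[OF that, of "- 1 / l"] by (simp add: S_def norm_divide)
  have "bounded_ell2_operator S"
    unfolding bounded_ell2_operator_def
  proof (intro conjI ballI allI exI[of _ "1 / cmod l"])
    show "S x \<in> ell2" if "x \<in> ell2" for x unfolding S_def by (rule ell2_scale(1)[OF that])
    show "S (\<lambda>n. x n + y n) = (\<lambda>n. S x n + S y n)" for x y by (simp add: S_def algebra_simps)
    show "S (\<lambda>n. c * x n) = (\<lambda>n. c * S x n)" for c x by (simp add: S_def algebra_simps)
  qed (rule Sb)
  then have inv: "ell2_inverse (toeplitz (\<lambda>t. - l)) S"
    using l0 by (auto simp: ell2_inverse_def toeplitz_const S_def)
  have cl: "continuous_on circle (\<lambda>t. - l)" and cal: "continuous_on circle (\<lambda>t. a t - l)"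
    by (intro continuous_intros a)+
  have "\<exists>S'. ell2_inverse (toeplitz (\<lambda>t. a t - l)) S'"
  proof (rule ell2_inverse_perturb[where \<epsilon> = M, OF inv toeplitz_linear[OF cl] toeplitz_linear[OF cal] Sb])
    fix x :: "nat \<Rightarrow> complex" assume x: "x \<in> ell2"
    have "(\<lambda>n. toeplitz (\<lambda>t. a t - l) x n - toeplitz (\<lambda>t. - l) x n) = toeplitz (\<lambda>t. (a t - l) - (- l)) x"
      by (rule toeplitz_diff[OF cal cl x, symmetric])
    also have "\<dots> = toeplitz a x" by simp
    finally show "ell2_norm (\<lambda>n. toeplitz (\<lambda>t. a t - l) x n - toeplitz (\<lambda>t. - l) x n) \<le> M * ell2_norm x"
      using toeplitz_bounded(2)[OF a M x] by simp
  next
    show "1 / cmod l * M < 1" using l l0 by simp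
  qed (use M0 in auto)
  then show ?thesis using toeplitz_spectrum_iff[OF a] by (simp add: toeplitz_invertible_def)
qed

lemma toeplitz_spectrum_closed:
  assumes a: "continuous_on circle a"
  shows "closed (ell2_spectrum (toeplitz a))"
  unfolding closed_def open_dist
proof (intro ballI)
  fix l assume "l \<in> - ell2_spectrum (toeplitz a)"
  then have inv: "toeplitz_invertible (\<lambda>t. a t - l)" using toeplitz_spectrum_iff[OF a] by simp
  have cal: "continuous_on circle (\<lambda>t. a t - l)" for l by (intro continuous_intros a)
  obtain \<delta> where \<delta>: "0 < \<delta>" "\<And>a'. continuous_on circle a' \<Longrightarrow> (\<And>t. t \<in> circle \<Longrightarrow> cmod (a' t - (a t - l)) \<le> \<delta>) \<Longrightarrow> toeplitz_invertible a'"
    using toeplitz_invertible_perturb[OF cal inv] by blast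
  have "l' \<notin> ell2_spectrum (toeplitz a)" if "dist l' l < \<delta>" for l'
  proof -
    have "toeplitz_invertible (\<lambda>t. a t - l')"
      by (rule \<delta>(2)[OF cal]) (use that in \<open>simp add: dist_norm norm_minus_commute\<close>)
    then show ?thesis using toeplitz_spectrum_iff[OF a] by simp
  qed
  then show "\<exists>e>0. \<forall>y. dist y l < e \<longrightarrow> y \<in> - ell2_spectrum (toeplitz a)" using \<delta>(1) by blast
qed

context banded_symbol
begin

lemma dilate_continuous: "0 < \<rho> \<Longrightarrow> continuous_on circle (dilate \<rho> symb)"
  unfolding dilate_def laurent_poly_def by (intro continuous_intros) auto

text \<open>The three sources of change, namely the radius, the interpolation error and the spectral
  parameter, each contribute at most a third of the permitted change of the symbol.\<close>

lemma polygon_spectrum_stable: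
  assumes \<rho>l: "0 < \<rho>l" and \<rho>: "\<rho> \<in> {\<rho>l..\<rho>h}" and \<mu>: "\<mu> \<notin> ell2_spectrum (toeplitz (dilate \<rho> symb))"
  shows "\<exists>\<delta>>0. \<forall>\<rho>'\<in>{\<rho>l..\<rho>h}. \<forall>\<mu>'. \<forall>vs\<in>partitions 0 (2*pi) \<delta>.
    \<bar>\<rho> - \<rho>'\<bar> \<le> \<delta> \<longrightarrow> dist \<mu> \<mu>' < \<delta> \<longrightarrow> \<mu>' \<notin> polygon_spectrum vs \<rho>'"
proof -
  have \<rho>0: "0 < \<rho>" using \<rho> \<rho>l by auto
  have inv: "toeplitz_invertible (\<lambda>t. dilate \<rho> symb t - \<mu>)" using \<mu> toeplitz_spectrum_iff[OF dilate_continuous[OF \<rho>0]] by simp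
  have c0: "continuous_on circle (\<lambda>t. dilate \<rho> symb t - \<mu>)" by (intro continuous_intros dilate_continuous \<rho>0)
  obtain \<delta>1 where \<delta>1: "0 < \<delta>1" "\<And>a'. continuous_on circle a' \<Longrightarrow> (\<And>t. t \<in> circle \<Longrightarrow> cmod (a' t - (dilate \<rho> symb t - \<mu>)) \<le> \<delta>1) \<Longrightarrow> toeplitz_invertible a'"
    using toeplitz_invertible_perturb[OF c0 inv] by blast
  define A where "A = annulus \<rho>l \<rho>h"
  obtain C where C0: "0 \<le> C" and C: "\<And>\<Delta> vs. vs \<in> partitions 0 (2*pi) \<Delta> \<Longrightarrow>
      small_lipschitz A (C * \<Delta>) (polygon_error b r s vs)"
    using polygon_error_bound[OF \<rho>l, of \<rho>h b r s] unfolding A_def by blast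
  have "compact A" unfolding A_def by (rule compact_annulus)
  moreover have "continuous_on A symb" using \<rho>l by (intro symb_continuous) (auto simp: A_def annulus_def)
  ultimately have "uniformly_continuous_on A symb" by (intro compact_uniformly_continuous)
  then obtain \<eta> where \<eta>: "0 < \<eta>" "\<And>z w. z \<in> A \<Longrightarrow> w \<in> A \<Longrightarrow> dist w z < \<eta> \<Longrightarrow> dist (symb w) (symb z) < \<delta>1 / 3"
    using \<delta>1(1) unfolding uniformly_continuous_on_def by (metis zero_less_divide_iff zero_less_numeral)
  define \<delta> where "\<delta> = min (\<eta> / 2) (min (\<delta>1 / 3) (\<delta>1 / (3 * (C + 1))))"
  have \<delta>: "0 < \<delta>" "\<delta> < \<eta>" "\<delta> \<le> \<delta>1 / 3" "\<delta> \<le> \<delta>1 / (3 * (C + 1))"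
  proof -
    have "0 < \<delta>1 / (3 * (C + 1))" using \<delta>1(1) C0 by simp
    then show "0 < \<delta>" "\<delta> < \<eta>" "\<delta> \<le> \<delta>1 / 3" "\<delta> \<le> \<delta>1 / (3 * (C + 1))"
      using \<eta>(1) \<delta>1(1) unfolding \<delta>_def by linarith+
  qed
  have C\<delta>: "C * \<delta> \<le> \<delta>1 / 3"
  proof -
    have "C * \<delta> \<le> (C + 1) * \<delta>" using \<delta>(1) by (intro mult_right_mono) auto
    also have "\<dots> \<le> \<delta>1 / 3" using \<delta>(4) C0 by (simp add: field_simps)
    finally show ?thesis .
  qed
  show ?thesis
  proof (intro exI[of _ \<delta>] conjI \<delta>(1) ballI allI impI)
    fix \<rho>' \<mu>' vs
    assume \<rho>': "\<rho>' \<in> {\<rho>l..\<rho>h}" and vs: "vs \<in> partitions 0 (2*pi) \<delta>" and d: "\<bar>\<rho> - \<rho>'\<bar> \<le> \<delta>" "dist \<mu> \<mu>' < \<delta>"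
    have \<rho>'0: "0 < \<rho>'" using \<rho>' \<rho>l by auto
    have cp: "continuous_on circle (polygon vs (dilate \<rho>' symb))" by (rule polygon_continuous[OF \<rho>'0 vs])
    have "toeplitz_invertible (\<lambda>t. polygon vs (dilate \<rho>' symb) t - \<mu>')"
    proof (rule \<delta>1(2))
      show "continuous_on circle (\<lambda>t. polygon vs (dilate \<rho>' symb) t - \<mu>')" by (intro continuous_intros cp)
      fix t assume t: "t \<in> circle"
      define w w' where "w = of_real \<rho> * t" and "w' = of_real \<rho>' * t"
      have n: "cmod w = \<rho>" "cmod w' = \<rho>'" using t \<rho>0 \<rho>'0 by (auto simp: w_def w'_def norm_mult)
      have A: "w \<in> A" "w' \<in> A" using \<rho> \<rho>' by (auto simp: A_def annulus_def n)
      have "w' - w = of_real (\<rho>' - \<rho>) * t" by (simp add: w_def w'_def algebra_simps)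
      then have "dist w' w = \<bar>\<rho>' - \<rho>\<bar>" using t by (simp add: dist_norm norm_mult del: of_real_diff)
      then have 1: "cmod (symb w' - symb w) < \<delta>1 / 3" using \<eta>(2)[OF A(1,2)] d \<delta>(2) by (simp add: dist_norm)
      have 2: "cmod (polygon_error b r s vs w') \<le> \<delta>1 / 3"
        using small_lipschitzD(1)[OF C[OF vs] A(2) A(2)] C\<delta> by linarith
      have 3: "cmod (\<mu> - \<mu>') \<le> \<delta>1 / 3" using d(2) \<delta>(3) by (simp add: dist_norm)
      have "polygon vs (dilate \<rho>' symb) t - \<mu>' - (dilate \<rho> symb t - \<mu>) = (symb w' - symb w) + polygon_error b r s vs w' + (\<mu> - \<mu>')"
        using polygon_dilate[OF \<rho>'0 t, of vs b r s] by (simp add: dilate_def w_def w'_def)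
      also have "cmod \<dots> \<le> cmod (symb w' - symb w) + cmod (polygon_error b r s vs w') + cmod (\<mu> - \<mu>')"
        by (rule order_trans[OF norm_triangle_ineq add_right_mono[OF norm_triangle_ineq]])
      finally show "cmod (polygon vs (dilate \<rho>' symb) t - \<mu>' - (dilate \<rho> symb t - \<mu>)) \<le> \<delta>1" using 1 2 3 by linarith
    qed
    then show "\<mu>' \<notin> polygon_spectrum vs \<rho>'" unfolding polygon_spectrum_def using toeplitz_spectrum_iff[OF cp] by simp
  qed
qed

lemma polygon_spectrum_bounded:
  assumes \<rho>l: "0 < \<rho>l"
  obtains M where "\<And>vs \<rho>. vs \<in> partitions 0 (2*pi) 1 \<Longrightarrow> \<rho> \<in> {\<rho>l..\<rho>h} \<Longrightarrow> polygon_spectrum vs \<rho> \<subseteq> cball 0 M"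
proof -
  define A where "A = annulus \<rho>l \<rho>h"
  obtain C where C0: "0 \<le> C" and C: "\<And>\<Delta> vs. vs \<in> partitions 0 (2*pi) \<Delta> \<Longrightarrow>
      small_lipschitz A (C * \<Delta>) (polygon_error b r s vs)"
    using polygon_error_bound[OF \<rho>l, of \<rho>h b r s] unfolding A_def by blast
  have "compact A" unfolding A_def by (rule compact_annulus)
  moreover have "continuous_on A symb" using \<rho>l by (intro symb_continuous) (auto simp: A_def annulus_def)
  ultimately have "bounded (symb ` A)" by (intro compact_imp_bounded compact_continuous_image)
  then obtain B where B: "\<forall>w\<in>A. cmod (symb w) \<le> B" unfolding bounded_iff by blast
  show ?thesis
  proof (rule that[of "B + C"])
    fix vs \<rho> assume vs: "vs \<in> partitions 0 (2*pi) 1" and \<rho>: "\<rho> \<in> {\<rho>l..\<rho>h}"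
    have \<rho>0: "0 < \<rho>" using \<rho> \<rho>l by auto
    have "cmod (polygon vs (dilate \<rho> symb) t) \<le> B + C" if t: "t \<in> circle" for t
    proof -
      have n: "cmod (of_real \<rho> * t) = \<rho>" using t \<rho>0 by (simp add: norm_mult)
      have A: "of_real \<rho> * t \<in> A" using \<rho> n by (simp add: A_def annulus_def)
      then have "cmod (symb (of_real \<rho> * t)) \<le> B" using B by blast
      moreover have "cmod (polygon_error b r s vs (of_real \<rho> * t)) \<le> C * 1"
        by (rule small_lipschitzD(1)[OF C[OF vs] A A])
      ultimately show ?thesis
        unfolding polygon_dilate[OF \<rho>0 t] using norm_triangle_ineq[of "symb (of_real \<rho> * t)" "polygon_error b r s vs (of_real \<rho> * t)"] by linarith
    qed
    then show "polygon_spectrum vs \<rho> \<subseteq> cball 0 (B + C)"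
      using toeplitz_spectrum_bounded[OF polygon_continuous[OF \<rho>0 vs], where M = "B + C"]
      unfolding polygon_spectrum_def by (force simp: not_le[symmetric])
  qed
qed

text \<open>Cover the points at distance at least \<open>e\<close> from the limit set, within a ball that contains
  all polygon spectra, by finitely many of the neighbourhoods from the stability lemma. A fine
  partition has a node near each of the finitely many radii that belong to them.\<close>

lemma polygon_spectra_near_limit_set:
  assumes \<rho>l: "0 < \<rho>l" and e: "0 < e"
    and lim: "limit_set b r s = (\<Inter>\<rho>\<in>{\<rho>l..\<rho>h}. ell2_spectrum (toeplitz (dilate \<rho> symb)))"
  shows "\<exists>\<delta>>0. \<forall>vs\<in>partitions 0 (2*pi) \<delta>. \<forall>\<rho>s\<in>partitions \<rho>l \<rho>h \<delta>.
    (\<Inter>\<rho>\<in>set \<rho>s. polygon_spectrum vs \<rho>) \<subseteq> nbhd (limit_set b r s) e"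
proof -
  obtain M where M: "\<And>vs \<rho>. vs \<in> partitions 0 (2*pi) 1 \<Longrightarrow> \<rho> \<in> {\<rho>l..\<rho>h} \<Longrightarrow> polygon_spectrum vs \<rho> \<subseteq> cball 0 M"
    using polygon_spectrum_bounded[OF \<rho>l, of \<rho>h] by blast
  define K where "K = cball 0 M - (\<Union>x\<in>limit_set b r s. ball x e)"
  have K: "compact K" unfolding K_def by (intro compact_diff) auto
  have "\<exists>\<delta> \<rho>. 0 < \<delta> \<and> \<rho> \<in> {\<rho>l..\<rho>h} \<and> (\<forall>\<rho>'\<in>{\<rho>l..\<rho>h}. \<forall>\<mu>'. \<forall>vs\<in>partitions 0 (2*pi) \<delta>.
    \<bar>\<rho> - \<rho>'\<bar> \<le> \<delta> \<longrightarrow> dist \<mu> \<mu>' < \<delta> \<longrightarrow> \<mu>' \<notin> polygon_spectrum vs \<rho>')" if "\<mu> \<in> K" for \<mu>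
  proof -
    have "\<mu> \<notin> limit_set b r s" using that e by (auto simp: K_def)
    then obtain \<rho> where \<rho>: "\<rho> \<in> {\<rho>l..\<rho>h}" "\<mu> \<notin> ell2_spectrum (toeplitz (dilate \<rho> symb))" unfolding lim by blast
    from polygon_spectrum_stable[OF \<rho>l \<rho>] show ?thesis using \<rho>(1) by blast
  qed
  then obtain D R where D: "\<And>\<mu>. \<mu> \<in> K \<Longrightarrow> 0 < D \<mu>" and R: "\<And>\<mu>. \<mu> \<in> K \<Longrightarrow> R \<mu> \<in> {\<rho>l..\<rho>h}"
    and DR: "\<And>\<mu> \<rho>' \<mu>' vs. \<mu> \<in> K \<Longrightarrow> \<rho>' \<in> {\<rho>l..\<rho>h} \<Longrightarrow> vs \<in> partitions 0 (2*pi) (D \<mu>) \<Longrightarrow>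
      \<bar>R \<mu> - \<rho>'\<bar> \<le> D \<mu> \<Longrightarrow> dist \<mu> \<mu>' < D \<mu> \<Longrightarrow> \<mu>' \<notin> polygon_spectrum vs \<rho>'"
    by metis
  have "K \<subseteq> (\<Union>\<mu>\<in>K. ball \<mu> (D \<mu>))" using D by force
  then obtain F where F: "F \<subseteq> K" "finite F" "K \<subseteq> (\<Union>\<mu>\<in>F. ball \<mu> (D \<mu>))"
    using compactE_image[OF K, of K "\<lambda>\<mu>. ball \<mu> (D \<mu>)"] by auto
  define \<delta> where "\<delta> = Min (insert 1 (D ` F))"
  have \<delta>: "0 < \<delta>" "\<delta> \<le> 1" "\<And>\<mu>. \<mu> \<in> F \<Longrightarrow> \<delta> \<le> D \<mu>"
    unfolding \<delta>_def using F D by (auto simp: Min_gr_iff)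
  show ?thesis
  proof (intro exI[of _ \<delta>] conjI \<delta>(1) ballI subsetI)
    fix vs \<rho>s x assume vs: "vs \<in> partitions 0 (2*pi) \<delta>" and \<rho>s: "\<rho>s \<in> partitions \<rho>l \<rho>h \<delta>"
      and x: "x \<in> (\<Inter>\<rho>\<in>set \<rho>s. polygon_spectrum vs \<rho>)"
    have ne: "\<rho>s \<noteq> []" using \<rho>s by (simp add: partitions_def)
    then have "hd \<rho>s \<in> set \<rho>s" by simp
    then have "x \<in> cball 0 M" using x M[of vs "hd \<rho>s"] vs partitions_mono[OF \<delta>(2)] partition_subset[OF \<rho>s] by blast
    show "x \<in> nbhd (limit_set b r s) e"
    proof (rule ccontr)
      assume "x \<notin> nbhd (limit_set b r s) e"
      then have "x \<in> K" using \<open>x \<in> cball 0 M\<close> by (auto simp: K_def nbhd_def)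
      then obtain \<mu> where \<mu>: "\<mu> \<in> F" "x \<in> ball \<mu> (D \<mu>)" using F(3) by blast
      then have \<mu>K: "\<mu> \<in> K" using F(1) by blast
      obtain \<rho>' where \<rho>': "\<rho>' \<in> set \<rho>s" "\<bar>R \<mu> - \<rho>'\<bar> \<le> \<delta>"
        using partition_near[OF \<rho>s, of "R \<mu>"] R[OF \<mu>K] \<delta>(1) by auto
      have "x \<notin> polygon_spectrum vs \<rho>'"
        using \<mu> \<rho>' \<delta>(3)[OF \<mu>(1)] partition_subset[OF \<rho>s] vs partitions_mono[OF \<delta>(3)[OF \<mu>(1)]]
        by (intro DR[OF \<mu>K]) auto
      then show False using x \<rho>'(1) by blast
    qed
  qed
qed

text \<open>Move from \<open>l\<close> to a nearby point \<open>l'\<close> of the limit set with simple zeros. If the polygon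
  spectra over some arbitrarily fine partitions have no common point near \<open>l\<close>, then for every
  \<open>\<eta>\<close> some index set dominates up to \<open>\<eta>\<close> on a disc around \<open>l'\<close>. There are finitely many index
  sets, so one of them does so for all \<open>\<eta>\<close>, hence exactly, which is impossible at a point of the
  limit set.\<close>

lemma limit_set_approximated:
  assumes \<rho>l: "0 < \<rho>l" and e: "0 < e" and l: "l \<in> limit_set b r s"
  shows "\<exists>\<delta>>0. \<forall>vs\<in>partitions 0 (2*pi) \<delta>. \<forall>P\<subseteq>{\<rho>l..\<rho>h}. ball l e \<inter> (\<Inter>\<rho>\<in>P. polygon_spectrum vs \<rho>) \<noteq> {}"
proof (rule ccontr)
  assume "\<not> ?thesis"
  then have bad: "\<exists>vs\<in>partitions 0 (2*pi) \<delta>. \<exists>P\<subseteq>{\<rho>l..\<rho>h}. ball l e \<inter> (\<Inter>\<rho>\<in>P. polygon_spectrum vs \<rho>) = {}" if "0 < \<delta>" for \<delta>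
    using that by (meson)
  obtain l' where l': "l' \<in> limit_set b r s" "l' \<in> ball l (e / 2)" "rsquarefree (chi l')"
    using limit_set_not_isolated[OF l, of "e / 2"] e by auto
  obtain \<delta>1 g where \<delta>1: "0 < \<delta>1" and g1: "branches (ball l' \<delta>1) g" using branches_exist[OF l'(3)] .
  define \<delta>0 where "\<delta>0 = min \<delta>1 (e / 2)"
  have \<delta>0: "0 < \<delta>0" "\<delta>0 \<le> \<delta>1" "\<delta>0 \<le> e / 2" using \<delta>1 e by (auto simp: \<delta>0_def)
  have g: "branches (ball l' \<delta>0) g" by (rule branches_subset[OF g1 subset_ball[OF \<delta>0(2)]])
  obtain \<delta> where \<delta>: "0 < \<delta>" "\<delta> < \<delta>0" and sep: "\<And>\<eta>. 0 < \<eta> \<Longrightarrow> \<exists>\<Delta>0>0. \<forall>vs\<in>partitions 0 (2*pi) \<Delta>0. \<forall>P\<subseteq>{\<rho>l..\<rho>h}.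
      (\<forall>\<mu>\<in>ball l' \<delta>. \<exists>\<rho>\<in>P. \<mu> \<notin> polygon_spectrum vs \<rho>) \<longrightarrow>
      (\<exists>I\<subseteq>{..<N}. card I = r \<and> dominates (ball l' \<delta>) g I \<eta>)"
    apply (rule branches_separate[OF g \<delta>0(1) \<rho>l, of \<rho>h])
    subgoal premises p by (rule p(1)[OF p(2,3)]) (rule p(4); assumption)
    done
  have sub: "ball l' \<delta> \<subseteq> ball l e"
  proof
    fix x assume "x \<in> ball l' \<delta>"
    then show "x \<in> ball l e" using dist_triangle[of l x l'] l'(2) \<delta>(2) \<delta>0(3) by simp
  qed
  define dom where "dom = dominates (ball l' \<delta>) g"
  have ex: "\<exists>I\<in>Pow {..<N}. card I = r \<and> dom I \<eta>" if \<eta>: "0 < \<eta>" for \<eta>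
  proof -
    obtain \<Delta>0 where \<Delta>0: "0 < \<Delta>0" "\<forall>vs\<in>partitions 0 (2*pi) \<Delta>0. \<forall>P\<subseteq>{\<rho>l..\<rho>h}.
      (\<forall>\<mu>\<in>ball l' \<delta>. \<exists>\<rho>\<in>P. \<mu> \<notin> polygon_spectrum vs \<rho>) \<longrightarrow>
      (\<exists>I\<subseteq>{..<N}. card I = r \<and> dom I \<eta>)"
      using sep[OF \<eta>] unfolding dom_def by (elim exE conjE)
    obtain vs P where vs: "vs \<in> partitions 0 (2*pi) \<Delta>0" and P: "P \<subseteq> {\<rho>l..\<rho>h}"
      and em: "ball l e \<inter> (\<Inter>\<rho>\<in>P. polygon_spectrum vs \<rho>) = {}"
      using bad[OF \<Delta>0(1)] by blast
    have "\<forall>\<mu>\<in>ball l' \<delta>. \<exists>\<rho>\<in>P. \<mu> \<notin> polygon_spectrum vs \<rho>" using em sub by blast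
    then have "\<exists>I\<subseteq>{..<N}. card I = r \<and> dom I \<eta>" using \<Delta>0(2) vs P by blast
    then show ?thesis by blast
  qed
  have "\<exists>I\<in>Pow {..<N}. card I = r \<and> (\<forall>\<eta>>0. dom I \<eta>)"
  proof (rule ccontr)
    assume "\<not> ?thesis"
    then have "\<forall>I. \<exists>\<eta>>0. I \<in> Pow {..<N} \<longrightarrow> card I = r \<longrightarrow> \<not> dom I \<eta>" by (metis zero_less_one)
    then obtain H where H: "\<And>I. 0 < H I" "\<And>I. I \<in> Pow {..<N} \<Longrightarrow> card I = r \<Longrightarrow> \<not> dom I (H I)" by metis
    define \<eta> where "\<eta> = Min (H ` Pow {..<N})"
    have "0 < \<eta>" unfolding \<eta>_def using H(1) by (subst Min_gr_iff) auto
    then obtain I where I: "I \<in> Pow {..<N}" "card I = r" "dom I \<eta>" using ex by blast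
    have "\<eta> \<le> H I" unfolding \<eta>_def using I(1) by (intro Min_le) auto
    then have "dom I (H I)" using I(3) unfolding dom_def dominates_def by (meson add_left_mono order_trans)
    then show False using H(2)[OF I(1,2)] by blast
  qed
  then obtain I where I: "I \<subseteq> {..<N}" "card I = r" and all: "\<And>\<eta>. 0 < \<eta> \<Longrightarrow> dom I \<eta>" by blast
  have "l' \<notin> limit_set b r s"
  proof (rule dominated_branches_not_limit[OF branches_subset[OF g] \<delta>(1) I])
    show "ball l' \<delta> \<subseteq> ball l' \<delta>0" using \<delta>(2) by auto
    fix \<mu> i k assume h: "\<mu> \<in> ball l' \<delta>" "i \<in> I" "k \<in> {..<N} - I"
    show "cmod (g i \<mu>) \<le> cmod (g k \<mu>)"
    proof (rule field_le_epsilon)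
      fix \<eta> :: real assume "0 < \<eta>"
      then show "cmod (g i \<mu>) \<le> cmod (g k \<mu>) + \<eta>" using all h unfolding dom_def dominates_def by blast
    qed
  qed
  then show False using l'(1) by blast
qed

text \<open>The limit set is compact, so one granularity suffices for all its points.\<close>

lemma limit_set_near_polygon_spectra:
  assumes \<rho>l: "0 < \<rho>l" and e: "0 < e" and comp: "compact (limit_set b r s)"
  shows "\<exists>\<delta>>0. \<forall>vs\<in>partitions 0 (2*pi) \<delta>. \<forall>P\<subseteq>{\<rho>l..\<rho>h}.
    limit_set b r s \<subseteq> nbhd (\<Inter>\<rho>\<in>P. polygon_spectrum vs \<rho>) e"
proof -
  define K where "K = limit_set b r s"
  have "\<forall>l. \<exists>\<delta>>0. l \<in> K \<longrightarrow> (\<forall>vs\<in>partitions 0 (2*pi) \<delta>. \<forall>P\<subseteq>{\<rho>l..\<rho>h}. ball l (e / 2) \<inter> (\<Inter>\<rho>\<in>P. polygon_spectrum vs \<rho>) \<noteq> {})"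
  proof
    fix l
    show "\<exists>\<delta>>0. l \<in> K \<longrightarrow> (\<forall>vs\<in>partitions 0 (2*pi) \<delta>. \<forall>P\<subseteq>{\<rho>l..\<rho>h}. ball l (e / 2) \<inter> (\<Inter>\<rho>\<in>P. polygon_spectrum vs \<rho>) \<noteq> {})"
    proof (cases "l \<in> K")
      case True
      then show ?thesis using limit_set_approximated[OF \<rho>l half_gt_zero[OF e], of l \<rho>h] by (simp add: K_def)
    qed (auto intro: exI[of _ 1])
  qed
  from choice[OF this] obtain D where
    D0: "\<forall>l. 0 < D l \<and> (l \<in> K \<longrightarrow> (\<forall>vs\<in>partitions 0 (2*pi) (D l). \<forall>P\<subseteq>{\<rho>l..\<rho>h}. ball l (e / 2) \<inter> (\<Inter>\<rho>\<in>P. polygon_spectrum vs \<rho>) \<noteq> {}))" ..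
  have D: "0 < D l" for l using D0 by simp
  have "K \<subseteq> (\<Union>l\<in>K. ball l (e / 2))" using e by force
  then obtain F where F: "F \<subseteq> K" "finite F" "K \<subseteq> (\<Union>l\<in>F. ball l (e / 2))"
    using compactE_image[OF comp[folded K_def], of K "\<lambda>l. ball l (e / 2)"] by auto
  define \<delta> where "\<delta> = Min (insert 1 (D ` F))"
  have \<delta>: "0 < \<delta>" "\<And>l. l \<in> F \<Longrightarrow> \<delta> \<le> D l" unfolding \<delta>_def using F D by (auto simp: Min_gr_iff)
  show ?thesis
    unfolding K_def[symmetric]
  proof (intro exI[of _ \<delta>] conjI \<delta>(1) ballI allI impI subsetI)
    fix vs P x assume vs: "vs \<in> partitions 0 (2*pi) \<delta>" and P: "P \<subseteq> {\<rho>l..\<rho>h}" and x: "x \<in> K"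
    obtain l where l: "l \<in> F" "x \<in> ball l (e / 2)" using F(3) x by blast
    have "l \<in> K" using F(1) l(1) by blast
    moreover have "vs \<in> partitions 0 (2*pi) (D l)" using vs partitions_mono[OF \<delta>(2)[OF l(1)]] by blast
    ultimately have "ball l (e / 2) \<inter> (\<Inter>\<rho>\<in>P. polygon_spectrum vs \<rho>) \<noteq> {}" using D0 P by simp
    then obtain y where y: "y \<in> ball l (e / 2)" "y \<in> (\<Inter>\<rho>\<in>P. polygon_spectrum vs \<rho>)" by blast
    have "dist y x \<le> e" using dist_triangle3[of y x l] y(1) l(2) by simp
    then have "x \<in> cball y e" by simp
    then show "x \<in> nbhd (\<Inter>\<rho>\<in>P. polygon_spectrum vs \<rho>) e" unfolding nbhd_def using y(2) by blast
  qed
qed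

end

theorem theorem2p7:
  fixes b :: "int \<Rightarrow> complex" and r s :: nat and \<rho>l \<rho>h :: real
  assumes "r > 0" and "s > 0"
    and "b (- int r) \<noteq> 0" and "b (int s) \<noteq> 0"
    and "0 < \<rho>l" and "\<rho>l \<le> \<rho>h"
    and "limit_set b r s =
      (\<Inter>\<rho>\<in>{\<rho>l..\<rho>h}. ell2_spectrum (toeplitz (dilate \<rho> (laurent_poly b r s))))"
  shows "((\<lambda>(\<Delta>\<rho>, \<Delta>v).
      SUP (\<rho>s, vs) \<in> partitions \<rho>l \<rho>h \<Delta>\<rho> \<times> partitions 0 (2*pi) \<Delta>v.
        hausdorff_dist
          (\<Inter>\<rho>\<in>set \<rho>s. ell2_spectrum (toeplitz (polygon vs (dilate \<rho> (laurent_poly b r s)))))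
          (limit_set b r s))
      \<longlongrightarrow> 0) (at_right 0 \<times>\<^sub>F at_right 0)"
proof -
  interpret banded_symbol b r s by unfold_locales fact+
  have cont: "continuous_on circle (dilate \<rho> symb)" if "\<rho> \<in> {\<rho>l..\<rho>h}" for \<rho>
    using that assms(5) by (intro dilate_continuous) auto
  have "closed (limit_set b r s)"
    unfolding assms(7) by (intro closed_INT ballI toeplitz_spectrum_closed cont)
  moreover have "bounded (limit_set b r s)"
  proof -
    have \<rho>l: "\<rho>l \<in> {\<rho>l..\<rho>h}" using assms(6) by simp
    obtain M where M: "\<And>t. t \<in> circle \<Longrightarrow> cmod (dilate \<rho>l symb t) \<le> M" using circle_bounded[OF cont[OF \<rho>l]] by blast
    have "ell2_spectrum (toeplitz (dilate \<rho>l symb)) \<subseteq> cball 0 M"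
      using toeplitz_spectrum_bounded[OF cont[OF \<rho>l] M] by (force simp: not_le[symmetric])
    moreover have "limit_set b r s \<subseteq> ell2_spectrum (toeplitz (dilate \<rho>l symb))" unfolding assms(7) using \<rho>l by blast
    ultimately show ?thesis using bounded_subset[OF bounded_cball] by blast
  qed
  ultimately have comp: "compact (limit_set b r s)" by (simp add: compact_eq_bounded_closed)
  have key: "\<exists>\<delta>>0. \<forall>\<rho>s vs. \<rho>s \<in> partitions \<rho>l \<rho>h \<delta> \<longrightarrow> vs \<in> partitions 0 (2*pi) \<delta> \<longrightarrow>
    hausdorff_dist (\<Inter>\<rho>\<in>set \<rho>s. polygon_spectrum vs \<rho>) (limit_set b r s) \<le> ennreal e" if e: "0 < e" for e
  proof -
    obtain \<delta>1 where \<delta>1: "0 < \<delta>1" "\<forall>vs\<in>partitions 0 (2*pi) \<delta>1. \<forall>\<rho>s\<in>partitions \<rho>l \<rho>h \<delta>1.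
      (\<Inter>\<rho>\<in>set \<rho>s. polygon_spectrum vs \<rho>) \<subseteq> nbhd (limit_set b r s) e"
      using polygon_spectra_near_limit_set[OF assms(5) e assms(7)] by blast
    obtain \<delta>2 where \<delta>2: "0 < \<delta>2" "\<forall>vs\<in>partitions 0 (2*pi) \<delta>2. \<forall>P\<subseteq>{\<rho>l..\<rho>h}.
      limit_set b r s \<subseteq> nbhd (\<Inter>\<rho>\<in>P. polygon_spectrum vs \<rho>) e"
      using limit_set_near_polygon_spectra[OF assms(5) e comp] by blast
    show ?thesis
    proof (intro exI[of _ "min \<delta>1 \<delta>2"] conjI allI impI)
      show "0 < min \<delta>1 \<delta>2" using \<delta>1(1) \<delta>2(1) by simp
      fix \<rho>s vs assume \<rho>s: "\<rho>s \<in> partitions \<rho>l \<rho>h (min \<delta>1 \<delta>2)" and vs: "vs \<in> partitions 0 (2*pi) (min \<delta>1 \<delta>2)"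
      have m: "vs \<in> partitions 0 (2*pi) \<delta>1" "vs \<in> partitions 0 (2*pi) \<delta>2" "\<rho>s \<in> partitions \<rho>l \<rho>h \<delta>1"
        using \<rho>s vs partitions_mono[of "min \<delta>1 \<delta>2" \<delta>1] partitions_mono[of "min \<delta>1 \<delta>2" \<delta>2]
        by (meson min.cobounded1 min.cobounded2 subsetD)+
      have "(\<Inter>\<rho>\<in>set \<rho>s. polygon_spectrum vs \<rho>) \<subseteq> nbhd (limit_set b r s) e" using \<delta>1(2) m(1,3) by blast
      moreover have "limit_set b r s \<subseteq> nbhd (\<Inter>\<rho>\<in>set \<rho>s. polygon_spectrum vs \<rho>) e"
        using \<delta>2(2) m(2) partition_subset[OF \<rho>s] by blast
      ultimately show "hausdorff_dist (\<Inter>\<rho>\<in>set \<rho>s. polygon_spectrum vs \<rho>) (limit_set b r s) \<le> ennreal e"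
        unfolding hausdorff_dist_def by (intro Inf_lower) blast
    qed
  qed
  show ?thesis
    unfolding polygon_spectrum_def[symmetric]
  proof (rule order_tendstoI)
    fix a :: ennreal assume a: "0 < a"
    obtain c where c: "0 < c" "c < a" using dense[OF a] by blast
    then have "c \<noteq> top" by auto
    then obtain e where e: "c = ennreal e" "0 \<le> e" by (metis ennreal_cases)
    have e0: "0 < e" using c(1) e by (simp add: ennreal_less_zero_iff)
    obtain \<delta> where \<delta>: "0 < \<delta>" "\<forall>\<rho>s vs. \<rho>s \<in> partitions \<rho>l \<rho>h \<delta> \<longrightarrow> vs \<in> partitions 0 (2*pi) \<delta> \<longrightarrow>
      hausdorff_dist (\<Inter>\<rho>\<in>set \<rho>s. polygon_spectrum vs \<rho>) (limit_set b r s) \<le> ennreal e"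
      using key[OF e0] by blast
    have ev: "eventually (\<lambda>x::real. x < \<delta>) (at_right 0)" using \<delta>(1) by (auto simp: eventually_at_right_field)
    show "\<forall>\<^sub>F x in at_right 0 \<times>\<^sub>F at_right 0. (case x of (\<Delta>\<rho>, \<Delta>v) \<Rightarrow>
      SUP (\<rho>s, vs) \<in> partitions \<rho>l \<rho>h \<Delta>\<rho> \<times> partitions 0 (2*pi) \<Delta>v.
        hausdorff_dist (\<Inter>\<rho>\<in>set \<rho>s. polygon_spectrum vs \<rho>) (limit_set b r s)) < a"
      unfolding eventually_prod_filter
    proof (intro exI conjI allI impI)
      show "eventually (\<lambda>x::real. x < \<delta>) (at_right 0)" "eventually (\<lambda>x::real. x < \<delta>) (at_right 0)" by (rule ev)+
      fix \<Delta>\<rho> \<Delta>v :: real assume \<Delta>: "\<Delta>\<rho> < \<delta>" "\<Delta>v < \<delta>"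
      have "(SUP (\<rho>s, vs) \<in> partitions \<rho>l \<rho>h \<Delta>\<rho> \<times> partitions 0 (2*pi) \<Delta>v.
        hausdorff_dist (\<Inter>\<rho>\<in>set \<rho>s. polygon_spectrum vs \<rho>) (limit_set b r s)) \<le> ennreal e"
      proof (rule SUP_least, clarify)
        fix \<rho>s vs assume "\<rho>s \<in> partitions \<rho>l \<rho>h \<Delta>\<rho>" "vs \<in> partitions 0 (2*pi) \<Delta>v"
        then have "\<rho>s \<in> partitions \<rho>l \<rho>h \<delta>" "vs \<in> partitions 0 (2*pi) \<delta>"
          using partitions_mono[OF less_imp_le[OF \<Delta>(1)]] partitions_mono[OF less_imp_le[OF \<Delta>(2)]] by blast+
        then show "hausdorff_dist (\<Inter>\<rho>\<in>set \<rho>s. polygon_spectrum vs \<rho>) (limit_set b r s) \<le> ennreal e"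
          using \<delta>(2) by blast
      qed
      also have "\<dots> < a" using c(2) e(1) by simp
      finally show "(case (\<Delta>\<rho>, \<Delta>v) of (\<Delta>\<rho>, \<Delta>v) \<Rightarrow>
        SUP (\<rho>s, vs) \<in> partitions \<rho>l \<rho>h \<Delta>\<rho> \<times> partitions 0 (2*pi) \<Delta>v.
        hausdorff_dist (\<Inter>\<rho>\<in>set \<rho>s. polygon_spectrum vs \<rho>) (limit_set b r s)) < a" by simp
    qed
  qed simp
qed

end
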